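(* Let $\mathcal{A}$ be an algebraic structure with universe $A$, and let $\mathcal{L}$ be a Lawvere theory with finitely many operations. Then every model of $\mathcal{L}$ in $\mathbf{ZFA}(\mathcal{A})$ is (the image under the canonical embedding of) a model of $\mathcal{L}$ in $\mathbf{Cont}(\mathrm{Aut}(\mathcal{A}\sqcup A_0))$ for some finite $A_0\subseteq A$. Moreover, if $X\in\mathbf{ZFA}(\mathcal{A})$ lies in $\mathbf{Cont}(\mathrm{Aut}(\mathcal{A}\sqcup A_0))$ (i.e. is $A_0$-equivariant), then the free $\mathcal{L}$-algebra over $X$ exists in $\mathbf{ZFA}(\mathcal{A})$ and is (the image under the canonical embedding of) the free $\mathcal{L}$-algebra over $X$ in $\mathbf{Cont}(\mathrm{Aut}(\mathcal{A}\sqcup A_0))$.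
   Context: Sets with atoms: $V_0(\mathcal{A})=A$, $V_{\alpha+1}(\mathcal{A})=\mathcal{P}(V_\alpha(\mathcal{A}))\cup V_\alpha(\mathcal{A})$, unions at limits, $V(\mathcal{A})=\bigcup_\alpha V_\alpha(\mathcal{A})$, with $\mathrm{Aut}(\mathcal{A})$ acting pointwise on atoms. $\mathrm{Aut}(\mathcal{A})$ has the topology inherited from the product topology on $A^A$ (a subgroup is open iff it contains the pointwise stabiliser of a finite set of atoms). $X\in V(\mathcal{A})$ is symmetric if every element of the reflexive-transitive membership closure of $X$ has open set-wise stabiliser; $\mathbf{ZFA}(\mathcal{A})$ is the category of symmetric sets and functions with symmetric graphs. For finite $A_0\subseteq A$, $\mathrm{Aut}(\mathcal{A}\sqcup A_0)$ is the pointwise stabiliser of $A_0$ (automorphisms of $\mathcal{A}$ expanded by constants for $A_0$), and $\mathbf{Cont}(G)$ is the topos of continuous actions of a topological group $G$ on discrete sets. A symmetric set is $A_0$-equivariant if $\mathrm{Aut}(\mathcal{A}\sqcup A_0)$ fixes it set-wise; $A_0$-equivariant sets and functions form a subcategory of $\mathbf{ZFA}(\mathcal{A})$ identified with $\mathbf{Cont}(\mathrm{Aut}(\mathcal{A}\sqcup A_0))$, giving canonical (logical) embeddings $\mathbf{Cont}(\mathrm{Aut}(\mathcal{A}\sqcup A_0))\to\mathbf{ZFA}(\mathcal{A})$. A model of a Lawvere theory $\mathcal{L}$ in a cartesian category $\mathcal{C}$ is a finite-product-preserving functor $\mathcal{L}\to\mathcal{C}$. *)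

theory Defs
  imports "HOL-Algebra.Group_Action" "HOL-Analysis.Analysis"
begin

section \<open>Sets with atoms\<close>

text \<open>
  The cumulative hierarchy over a set \<open>A\<close> of atoms, as a class of sets described up to isomorphism.
  The type \<open>'v\<close> is the class \<open>V(A)\<close> and \<open>'o\<close> the class of all ordinals; \<open>elts x\<close> is the set of
  members of \<open>x\<close>, and the non-atoms are the sets; in particular the empty set is the non-atom
  without members, hence distinct from all atoms. \<open>V\<close> satisfies the usual transfinite recursion at
  zero, successor and limit ordinals, and all subsets of a stage are present. The last two assumptions
  say that \<open>'o\<close> is as long as the class of ordinals: it has no cofinal map from a set (replacement),
  and it contains a limit ordinal (infinity).
\<close>

locale cumulative_hierarchy =
  fixes A :: "'v set"
    and elts :: "'v \<Rightarrow> 'v set"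
    and V :: "'o::wellorder \<Rightarrow> 'v set"
  assumes elts_atom: "a \<in> A \<Longrightarrow> elts a = {}"
    and extensionality: "x \<notin> A \<Longrightarrow> y \<notin> A \<Longrightarrow> elts x = elts y \<Longrightarrow> x = y"
    and V_zero: "(\<And>\<beta>. \<alpha> \<le> \<beta>) \<Longrightarrow> V \<alpha> = A"
    and V_succ: "\<alpha> < \<beta> \<Longrightarrow> (\<And>\<gamma>. \<alpha> < \<gamma> \<Longrightarrow> \<beta> \<le> \<gamma>) \<Longrightarrow>
                   V \<beta> = {x. x \<notin> A \<and> elts x \<subseteq> V \<alpha>} \<union> V \<alpha>"
    and V_limit: "\<alpha>' < \<alpha> \<Longrightarrow> (\<And>\<beta>. \<beta> < \<alpha> \<Longrightarrow> \<exists>\<gamma>. \<beta> < \<gamma> \<and> \<gamma> < \<alpha>) \<Longrightarrow> V \<alpha> = (\<Union>\<beta>\<in>{..<\<alpha>}. V \<beta>)"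
    and V_exhaustive: "\<exists>\<alpha>. x \<in> V \<alpha>"
    and powerset_full: "X \<subseteq> V \<alpha> \<Longrightarrow> \<exists>x. x \<notin> A \<and> elts x = X"
    and replacement: "\<exists>\<beta>. \<forall>y\<in>elts x. (f :: 'v \<Rightarrow> 'o) y < \<beta>"
    and infinity: "\<exists>\<alpha> \<alpha>' :: 'o. \<alpha>' < \<alpha> \<and> (\<forall>\<beta><\<alpha>. \<exists>\<gamma>. \<beta> < \<gamma> \<and> \<gamma> < \<alpha>)"

definition vset :: "'v set \<Rightarrow> ('v \<Rightarrow> 'v set) \<Rightarrow> 'v set \<Rightarrow> 'v" where
  "vset A elts X = (THE x. x \<notin> A \<and> elts x = X)"

definition vpair :: "'v set \<Rightarrow> ('v \<Rightarrow> 'v set) \<Rightarrow> 'v \<Rightarrow> 'v \<Rightarrow> 'v" where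
  "vpair A elts x y = vset A elts {vset A elts {x}, vset A elts {x, y}}"

definition act :: "'v set \<Rightarrow> ('v \<Rightarrow> 'v set) \<Rightarrow> ('v \<Rightarrow> 'v) \<Rightarrow> 'v \<Rightarrow> 'v" where
  "act A elts \<pi> = wfrec {(y, x). y \<in> elts x}
     (\<lambda>f x. if x \<in> A then \<pi> x else vset A elts (f ` elts x))"

context cumulative_hierarchy
begin

lemma V_cases:
  fixes \<alpha> :: 'o
  obtains (zero) "\<And>\<beta>. \<alpha> \<le> \<beta>"
  | (succ) \<alpha>' where "\<alpha>' < \<alpha>" "\<And>\<gamma>. \<alpha>' < \<gamma> \<Longrightarrow> \<alpha> \<le> \<gamma>"
  | (limit) \<alpha>' where "\<alpha>' < \<alpha>" "\<And>\<beta>. \<beta> < \<alpha> \<Longrightarrow> \<exists>\<gamma>. \<beta> < \<gamma> \<and> \<gamma> < \<alpha>"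
proof (cases "\<exists>\<alpha>'. \<alpha>' < \<alpha>")
  case False
  then show thesis by (intro zero) (meson not_le)
next
  case True
  then obtain \<alpha>' where \<alpha>': "\<alpha>' < \<alpha>" ..
  show thesis
  proof (cases "\<exists>\<beta><\<alpha>. \<forall>\<gamma>. \<beta> < \<gamma> \<longrightarrow> \<alpha> \<le> \<gamma>")
    case True
    then show thesis using succ by auto
  next
    case False
    then show thesis by (intro limit[OF \<alpha>']) (simp add: not_le)
  qed
qed

lemma V_mono: "\<beta> \<le> \<alpha> \<Longrightarrow> V \<beta> \<subseteq> V \<alpha>"
proof (induction \<alpha> rule: less_induct)
  case (less \<alpha>)
  show ?case
  proof (cases "\<beta> = \<alpha>")
    case False
    with less.prems have lt: "\<beta> < \<alpha>" by simp
    show ?thesis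
    proof (cases \<alpha> rule: V_cases)
      case zero
      then show ?thesis using lt leD by blast
    next
      case (succ \<alpha>')
      have "\<beta> \<le> \<alpha>'" using lt succ(2)[of \<beta>] by (auto simp: not_le[symmetric])
      then show ?thesis using less.IH[OF succ(1)] V_succ[OF succ] by blast
    next
      case (limit \<alpha>')
      then show ?thesis using V_limit[OF limit] lt by blast
    qed
  qed simp
qed

lemma V_elts: "x \<in> V \<alpha> \<Longrightarrow> y \<in> elts x \<Longrightarrow> \<exists>\<beta><\<alpha>. y \<in> V \<beta>"
proof (induction \<alpha> rule: less_induct)
  case (less \<alpha>)
  show ?case
  proof (cases \<alpha> rule: V_cases)
    case zero
    then show ?thesis using less.prems V_zero elts_atom by auto
  next
    case (succ \<alpha>')
    from less.prems(1) V_succ[OF succ] consider "elts x \<subseteq> V \<alpha>'" | "x \<in> V \<alpha>'" by auto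
    then show ?thesis
    proof cases
      case 1
      then show ?thesis using succ(1) less.prems(2) by auto
    next
      case 2
      then obtain \<beta> where "\<beta> < \<alpha>'" "y \<in> V \<beta>" using less.IH[OF succ(1)] less.prems(2) by auto
      then show ?thesis using succ(1) less_trans by auto
    qed
  next
    case (limit \<alpha>')
    then obtain \<beta> where "\<beta> < \<alpha>" "x \<in> V \<beta>" using less.prems V_limit[OF limit] by auto
    moreover from this obtain \<gamma> where "\<gamma> < \<beta>" "y \<in> V \<gamma>" using less.IH less.prems(2) by auto
    ultimately show ?thesis using less_trans by auto
  qed
qed

lemma wf_elts: "wf {(y, x). y \<in> elts x}"
proof -
  define rank where "rank x = (LEAST \<alpha>. x \<in> V \<alpha>)" for x
  have "rank y < rank x" if y: "y \<in> elts x" for x y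
  proof -
    have "x \<in> V (rank x)" unfolding rank_def using V_exhaustive by (rule LeastI_ex)
    then obtain \<beta> where "\<beta> < rank x" "y \<in> V \<beta>" using V_elts[OF _ y] by blast
    moreover from this(2) have "rank y \<le> \<beta>" unfolding rank_def by (rule Least_le)
    ultimately show ?thesis by simp
  qed
  then show ?thesis
    by (intro wf_subset[OF wf_inv_image[OF wf, where f = rank]]) (auto simp: inv_image_def)
qed

lemma image_set: "\<exists>z. z \<notin> A \<and> elts z = f ` elts x"
proof -
  have "\<forall>y. \<exists>\<alpha>. f y \<in> V \<alpha>" using V_exhaustive by blast
  then obtain r where r: "f y \<in> V (r y)" for y using choice[of "\<lambda>y \<alpha>. f y \<in> V \<alpha>"] by auto
  obtain \<beta> where \<beta>: "\<forall>y\<in>elts x. r y < \<beta>" using replacement by blast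
  have "f ` elts x \<subseteq> V \<beta>"
  proof
    fix z assume "z \<in> f ` elts x"
    then obtain y where "y \<in> elts x" "z = f y" by auto
    moreover from this \<beta> have "r y \<le> \<beta>" by (simp add: less_imp_le)
    ultimately show "z \<in> V \<beta>" using r[of y] V_mono[of "r y" \<beta>] by auto
  qed
  then show ?thesis by (rule powerset_full)
qed

lemma vset_eq: "x \<notin> A \<Longrightarrow> vset A elts (elts x) = x"
  unfolding vset_def by (rule the_equality) (auto intro: extensionality)

lemma act_atom: "a \<in> A \<Longrightarrow> act A elts \<pi> a = \<pi> a"
  unfolding act_def by (subst wfrec[OF wf_elts]) simp

lemma act_set:
  assumes "x \<notin> A"
  shows "act A elts \<pi> x \<notin> A" and "elts (act A elts \<pi> x) = act A elts \<pi> ` elts x"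
proof -
  have eq: "act A elts \<pi> x = vset A elts (act A elts \<pi> ` elts x)"
    unfolding act_def
    by (subst wfrec[OF wf_elts], simp add: assms, rule arg_cong[where f = "vset A elts"],
        rule image_cong, simp, simp add: cut_apply)
  obtain z where "z \<notin> A" "elts z = act A elts \<pi> ` elts x" using image_set by blast
  moreover from this have "vset A elts (act A elts \<pi> ` elts x) = z" using vset_eq[of z] by simp
  ultimately show "act A elts \<pi> x \<notin> A" "elts (act A elts \<pi> x) = act A elts \<pi> ` elts x"
    using eq by simp_all
qed

end


section \<open>Structures and their automorphism groups\<close>

text \<open>Algebraic structures may carry both operations and relations, of arbitrary finite arities.\<close>

record ('v, 'f, 'r) alg_structure =
  univ :: "'v set"
  op_arity :: "'f \<Rightarrow> nat"
  oper :: "'f \<Rightarrow> 'v list \<Rightarrow> 'v"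
  rel_arity :: "'r \<Rightarrow> nat"
  rel :: "'r \<Rightarrow> 'v list set"

definition is_structure :: "('v, 'f, 'r) alg_structure \<Rightarrow> bool" where
  "is_structure \<A> \<longleftrightarrow>
     (\<forall>f xs. set xs \<subseteq> univ \<A> \<and> length xs = op_arity \<A> f \<longrightarrow> oper \<A> f xs \<in> univ \<A>) \<and>
     (\<forall>r. rel \<A> r \<subseteq> {xs. set xs \<subseteq> univ \<A> \<and> length xs = rel_arity \<A> r})"

definition Aut :: "('v, 'f, 'r) alg_structure \<Rightarrow> ('v \<Rightarrow> 'v) set" where
  "Aut \<A> = {\<pi> \<in> Bij (univ \<A>).
     (\<forall>f xs. set xs \<subseteq> univ \<A> \<and> length xs = op_arity \<A> f \<longrightarrow>
        \<pi> (oper \<A> f xs) = oper \<A> f (map \<pi> xs)) \<and>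
     (\<forall>r xs. set xs \<subseteq> univ \<A> \<and> length xs = rel_arity \<A> r \<longrightarrow>
        (xs \<in> rel \<A> r \<longleftrightarrow> map \<pi> xs \<in> rel \<A> r))}"

text \<open>\<open>Aut_over \<A> B\<close> is \<open>Aut(\<A> \<squnion> B)\<close>: the automorphisms of \<open>\<A>\<close> expanded by constants for \<open>B\<close>.\<close>

definition Aut_over :: "('v, 'f, 'r) alg_structure \<Rightarrow> 'v set \<Rightarrow> ('v \<Rightarrow> 'v) set" where
  "Aut_over \<A> B = {\<pi> \<in> Aut \<A>. \<forall>b\<in>B. \<pi> b = b}"

definition Aut_group :: "('v, 'f, 'r) alg_structure \<Rightarrow> 'v set \<Rightarrow> ('v \<Rightarrow> 'v) monoid" where
  "Aut_group \<A> B = (BijGroup (univ \<A>)) \<lparr>carrier := Aut_over \<A> B\<rparr>"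

definition Aut_topology :: "('v, 'f, 'r) alg_structure \<Rightarrow> 'v set \<Rightarrow> ('v \<Rightarrow> 'v) topology" where
  "Aut_topology \<A> B =
     subtopology (product_topology (\<lambda>_. discrete_topology (univ \<A>)) (univ \<A>)) (Aut_over \<A> B)"


section \<open>Symmetric sets\<close>

definition symmetric :: "('v, 'f, 'r) alg_structure \<Rightarrow> ('v \<Rightarrow> 'v set) \<Rightarrow> 'v \<Rightarrow> bool" where
  "symmetric \<A> elts x \<longleftrightarrow>
     (\<forall>y. (y, x) \<in> {(z, w). z \<in> elts w}\<^sup>* \<longrightarrow>
        openin (Aut_topology \<A> {}) {\<pi> \<in> Aut \<A>. act (univ \<A>) elts \<pi> y = y})"

definition equivariant :: "('v, 'f, 'r) alg_structure \<Rightarrow> ('v \<Rightarrow> 'v set) \<Rightarrow> 'v set \<Rightarrow> 'v \<Rightarrow> bool" where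
  "equivariant \<A> elts B x \<longleftrightarrow>
     symmetric \<A> elts x \<and> (\<forall>\<pi>\<in>Aut_over \<A> B. act (univ \<A>) elts \<pi> x = x)"


section \<open>Categories, functors and finite products\<close>

record ('o, 'm) category =
  Obj :: "'o set"
  Arr :: "'m set"
  Dom :: "'m \<Rightarrow> 'o"
  Cod :: "'m \<Rightarrow> 'o"
  Ide :: "'o \<Rightarrow> 'm"
  Cmp :: "'m \<Rightarrow> 'm \<Rightarrow> 'm"

definition Hom :: "('o, 'm, 'z) category_scheme \<Rightarrow> 'o \<Rightarrow> 'o \<Rightarrow> 'm set" where
  "Hom C X Y = {f \<in> Arr C. Dom C f = X \<and> Cod C f = Y}"

definition is_category :: "('o, 'm, 'z) category_scheme \<Rightarrow> bool" where
  "is_category C \<longleftrightarrow>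
     (\<forall>f\<in>Arr C. Dom C f \<in> Obj C \<and> Cod C f \<in> Obj C) \<and>
     (\<forall>X\<in>Obj C. Ide C X \<in> Hom C X X) \<and>
     (\<forall>X Y Z. \<forall>f\<in>Hom C X Y. \<forall>g\<in>Hom C Y Z. Cmp C g f \<in> Hom C X Z) \<and>
     (\<forall>f\<in>Arr C. Cmp C f (Ide C (Dom C f)) = f \<and> Cmp C (Ide C (Cod C f)) f = f) \<and>
     (\<forall>X Y Z W. \<forall>f\<in>Hom C X Y. \<forall>g\<in>Hom C Y Z. \<forall>h\<in>Hom C Z W.
        Cmp C h (Cmp C g f) = Cmp C (Cmp C h g) f)"

definition is_iso :: "('o, 'm, 'z) category_scheme \<Rightarrow> 'm \<Rightarrow> bool" where
  "is_iso C f \<longleftrightarrow> f \<in> Arr C \<and>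
     (\<exists>g\<in>Hom C (Cod C f) (Dom C f). Cmp C g f = Ide C (Dom C f) \<and> Cmp C f g = Ide C (Cod C f))"

definition is_product ::
    "('o, 'm, 'z) category_scheme \<Rightarrow> nat \<Rightarrow> (nat \<Rightarrow> 'o) \<Rightarrow> 'o \<Rightarrow> (nat \<Rightarrow> 'm) \<Rightarrow> bool" where
  "is_product C n X P p \<longleftrightarrow>
     P \<in> Obj C \<and> (\<forall>i<n. X i \<in> Obj C \<and> p i \<in> Hom C P (X i)) \<and>
     (\<forall>Q\<in>Obj C. \<forall>q. (\<forall>i<n. q i \<in> Hom C Q (X i)) \<longrightarrow>
        (\<exists>!u. u \<in> Hom C Q P \<and> (\<forall>i<n. Cmp C (p i) u = q i)))"

record ('o, 'm, 'p, 'n) functor_data =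
  fobj :: "'o \<Rightarrow> 'p"
  farr :: "'m \<Rightarrow> 'n"

definition is_functor ::
    "('o, 'm, 'z) category_scheme \<Rightarrow> ('p, 'n, 'y) category_scheme \<Rightarrow> ('o, 'm, 'p, 'n) functor_data \<Rightarrow> bool"
  where
  "is_functor C D F \<longleftrightarrow>
     is_category C \<and> is_category D \<and>
     (\<forall>X\<in>Obj C. fobj F X \<in> Obj D \<and> farr F (Ide C X) = Ide D (fobj F X)) \<and>
     (\<forall>X Y. \<forall>f\<in>Hom C X Y. farr F f \<in> Hom D (fobj F X) (fobj F Y)) \<and>
     (\<forall>X Y Z. \<forall>f\<in>Hom C X Y. \<forall>g\<in>Hom C Y Z. farr F (Cmp C g f) = Cmp D (farr F g) (farr F f))"

definition functor_comp ::
    "('p, 'n, 'q, 'k) functor_data \<Rightarrow> ('o, 'm, 'p, 'n) functor_data \<Rightarrow> ('o, 'm, 'q, 'k) functor_data" where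
  "functor_comp G F = \<lparr>fobj = fobj G \<circ> fobj F, farr = farr G \<circ> farr F\<rparr>"

definition preserves_finite_products ::
    "('o, 'm, 'z) category_scheme \<Rightarrow> ('p, 'n, 'y) category_scheme \<Rightarrow> ('o, 'm, 'p, 'n) functor_data \<Rightarrow> bool"
  where
  "preserves_finite_products C D F \<longleftrightarrow>
     (\<forall>n X P p. is_product C n X P p \<longrightarrow>
        is_product D n (fobj F \<circ> X) (fobj F P) (farr F \<circ> p))"

definition natural_transformation ::
    "('o, 'm, 'z) category_scheme \<Rightarrow> ('p, 'n, 'y) category_scheme \<Rightarrow>
     ('o, 'm, 'p, 'n) functor_data \<Rightarrow> ('o, 'm, 'p, 'n) functor_data \<Rightarrow> ('o \<Rightarrow> 'n) \<Rightarrow> bool" where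
  "natural_transformation C D F G h \<longleftrightarrow>
     (\<forall>X\<in>Obj C. h X \<in> Hom D (fobj F X) (fobj G X)) \<and>
     (\<forall>X Y. \<forall>f\<in>Hom C X Y. Cmp D (h Y) (farr F f) = Cmp D (farr G f) (h X))"

definition naturally_isomorphic ::
    "('o, 'm, 'z) category_scheme \<Rightarrow> ('p, 'n, 'y) category_scheme \<Rightarrow>
     ('o, 'm, 'p, 'n) functor_data \<Rightarrow> ('o, 'm, 'p, 'n) functor_data \<Rightarrow> bool" where
  "naturally_isomorphic C D F G \<longleftrightarrow>
     (\<exists>h. natural_transformation C D F G h \<and> (\<forall>X\<in>Obj C. is_iso D (h X)))"


section \<open>Lawvere theories and their models\<close>

text \<open>
  A Lawvere theory has the natural numbers as objects, the object \<open>n\<close> being the \<open>n\<close>-th power of the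
  object \<open>1\<close> by means of the chosen projections \<open>Prj L n i : n \<rightarrow> 1\<close>. These projections are the
  images of the coproduct injections under the identity-on-objects functor from the dual of the
  category of finite cardinals, and they determine that functor.
\<close>

record 'l lawvere = "(nat, 'l) category" +
  Prj :: "nat \<Rightarrow> nat \<Rightarrow> 'l"

definition lawvere_theory :: "'l lawvere \<Rightarrow> bool" where
  "lawvere_theory L \<longleftrightarrow>
     is_category L \<and> Obj L = UNIV \<and>
     (\<forall>n. is_product L n (\<lambda>_. 1) n (Prj L n)) \<and> Prj L 1 0 = Ide L 1"

text \<open>The arrows of the least Lawvere subtheory containing \<open>\<Omega>\<close>; identities are tuples of projections.\<close>

inductive_set generated_by :: "'l lawvere \<Rightarrow> 'l set \<Rightarrow> 'l set"
  for L :: "'l lawvere" and \<Omega> :: "'l set" where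
  basic: "f \<in> \<Omega> \<Longrightarrow> f \<in> generated_by L \<Omega>"
| projection: "i < n \<Longrightarrow> Prj L n i \<in> generated_by L \<Omega>"
| composition: "f \<in> generated_by L \<Omega> \<Longrightarrow> g \<in> generated_by L \<Omega> \<Longrightarrow> Cod L f = Dom L g \<Longrightarrow>
    Cmp L g f \<in> generated_by L \<Omega>"
| tuple: "h \<in> Arr L \<Longrightarrow> (\<And>i. i < Cod L h \<Longrightarrow> Cmp L (Prj L (Cod L h) i) h \<in> generated_by L \<Omega>) \<Longrightarrow>
    h \<in> generated_by L \<Omega>"

definition finitely_many_operations :: "'l lawvere \<Rightarrow> bool" where
  "finitely_many_operations L \<longleftrightarrow>
     (\<exists>\<Omega>. finite \<Omega> \<and> \<Omega> \<subseteq> {f \<in> Arr L. Cod L f = 1} \<and> generated_by L \<Omega> = Arr L)"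

definition is_model ::
    "'l lawvere \<Rightarrow> ('p, 'n, 'y) category_scheme \<Rightarrow> (nat, 'l, 'p, 'n) functor_data \<Rightarrow> bool" where
  "is_model L C M \<longleftrightarrow> is_functor L C M \<and> preserves_finite_products L C M"

text \<open>
  The universal property of the free model with respect to the functor evaluating models, with
  natural transformations as homomorphisms, at the object \<open>1\<close>.
\<close>

definition is_free_algebra ::
    "'l lawvere \<Rightarrow> ('p, 'n, 'y) category_scheme \<Rightarrow> 'p \<Rightarrow> (nat, 'l, 'p, 'n) functor_data \<Rightarrow> 'n \<Rightarrow> bool" where
  "is_free_algebra L C X F \<eta> \<longleftrightarrow>
     X \<in> Obj C \<and> is_model L C F \<and> \<eta> \<in> Hom C X (fobj F 1) \<and>
     (\<forall>M f. is_model L C M \<and> f \<in> Hom C X (fobj M 1) \<longrightarrow>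
        (\<exists>!h. natural_transformation L C F M h \<and> Cmp C (h 1) \<eta> = f))"


section \<open>The category of symmetric sets\<close>

text \<open>An arrow is a domain, a codomain and a graph, the graph being a set of Kuratowski pairs.\<close>

definition is_graph :: "'v set \<Rightarrow> ('v \<Rightarrow> 'v set) \<Rightarrow> 'v \<Rightarrow> 'v \<Rightarrow> 'v \<Rightarrow> bool" where
  "is_graph A elts X Y f \<longleftrightarrow>
     f \<notin> A \<and> (\<forall>p\<in>elts f. \<exists>x\<in>elts X. \<exists>y\<in>elts Y. p = vpair A elts x y) \<and>
     (\<forall>x\<in>elts X. \<exists>!y. vpair A elts x y \<in> elts f)"

definition ZFA ::
    "('v, 'f, 'r) alg_structure \<Rightarrow> ('v \<Rightarrow> 'v set) \<Rightarrow> ('v, 'v \<times> 'v \<times> 'v) category" where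
  "ZFA \<A> elts = (let A = univ \<A> in
     \<lparr>Obj = {X. X \<notin> A \<and> symmetric \<A> elts X},
      Arr = {(X, Y, f). X \<notin> A \<and> symmetric \<A> elts X \<and> Y \<notin> A \<and> symmetric \<A> elts Y \<and>
               is_graph A elts X Y f \<and> symmetric \<A> elts f},
      Dom = (\<lambda>(X, Y, f). X),
      Cod = (\<lambda>(X, Y, f). Y),
      Ide = (\<lambda>X. (X, X, vset A elts {vpair A elts x x |x. x \<in> elts X})),
      Cmp = (\<lambda>(Y', Z, g) (X, Y, f).
               (X, Z, vset A elts {vpair A elts x z |x y z.
                        vpair A elts x y \<in> elts f \<and> vpair A elts y z \<in> elts g}))\<rparr>)"

text \<open>The subcategory of \<open>B\<close>-equivariant sets and functions.\<close>

definition ZFA_equivariant ::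
    "('v, 'f, 'r) alg_structure \<Rightarrow> ('v \<Rightarrow> 'v set) \<Rightarrow> 'v set \<Rightarrow> ('v, 'v \<times> 'v \<times> 'v) category" where
  "ZFA_equivariant \<A> elts B = (ZFA \<A> elts)
     \<lparr>Obj := {X \<in> Obj (ZFA \<A> elts). equivariant \<A> elts B X},
      Arr := {(X, Y, f). (X, Y, f) \<in> Arr (ZFA \<A> elts) \<and>
                equivariant \<A> elts B X \<and> equivariant \<A> elts B Y \<and> equivariant \<A> elts B f}\<rparr>"


section \<open>Continuous actions\<close>

text \<open>
  \<open>Cont G T S\<close>: continuous actions of the group \<open>G\<close> with topology \<open>T\<close> on discrete sets, the
  underlying sets being taken from \<open>S\<close>. Arrows carry their domain and codomain.
\<close>

definition continuous_action ::
    "('g, 'z) monoid_scheme \<Rightarrow> 'g topology \<Rightarrow> 'x set \<Rightarrow> ('g \<Rightarrow> 'x \<Rightarrow> 'x) \<Rightarrow> bool" where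
  "continuous_action G T X \<phi> \<longleftrightarrow>
     group_action G X \<phi> \<and> \<phi> \<in> extensional (carrier G) \<and>
     continuous_map (prod_topology T (discrete_topology X)) (discrete_topology X) (\<lambda>(g, x). \<phi> g x)"

definition Cont ::
    "('g, 'z) monoid_scheme \<Rightarrow> 'g topology \<Rightarrow> 'x set set \<Rightarrow>
     ('x set \<times> ('g \<Rightarrow> 'x \<Rightarrow> 'x),
      ('x set \<times> ('g \<Rightarrow> 'x \<Rightarrow> 'x)) \<times> ('x set \<times> ('g \<Rightarrow> 'x \<Rightarrow> 'x)) \<times> ('x \<Rightarrow> 'x)) category" where
  "Cont G T S =
     \<lparr>Obj = {(X, \<phi>). X \<in> S \<and> continuous_action G T X \<phi>},
      Arr = {((X, \<phi>), (Y, \<psi>), f). X \<in> S \<and> continuous_action G T X \<phi> \<and>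
               Y \<in> S \<and> continuous_action G T Y \<psi> \<and>
               f \<in> X \<rightarrow>\<^sub>E Y \<and> (\<forall>g\<in>carrier G. \<forall>x\<in>X. f (\<phi> g x) = \<psi> g (f x))},
      Dom = (\<lambda>(P, Q, f). P),
      Cod = (\<lambda>(P, Q, f). Q),
      Ide = (\<lambda>P. (P, P, \<lambda>x\<in>fst P. x)),
      Cmp = (\<lambda>(Q', R, g) (P, Q, f). (P, R, compose (fst P) g f))\<rparr>"

text \<open>\<open>Cont_Aut \<A> elts B\<close> is \<open>Cont(Aut(\<A> \<squnion> B))\<close>, over all sets that are members of the universe.\<close>

definition Cont_Aut where
  "Cont_Aut \<A> elts B =
     Cont (Aut_group \<A> B) (Aut_topology \<A> B) {elts X |X. X \<notin> univ \<A>}"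

text \<open>
  The identification of \<open>B\<close>-equivariant sets and functions with continuous actions of
  \<open>Aut(\<A> \<squnion> B)\<close>. The canonical embedding of \<open>Cont(Aut(\<A> \<squnion> B))\<close> into \<open>ZFA(\<A>)\<close> is the inclusion of
  the equivariant subcategory along this identification: a functor \<open>N\<close> into \<open>Cont(Aut(\<A> \<squnion> B))\<close> of the
  form \<open>functor_comp (as_action \<A> elts B) F\<close>, with \<open>F\<close> taking values in the equivariant
  subcategory, has \<open>F\<close> as its image.
\<close>

definition as_action_obj ::
    "('v, 'f, 'r) alg_structure \<Rightarrow> ('v \<Rightarrow> 'v set) \<Rightarrow> 'v set \<Rightarrow> 'v \<Rightarrow> 'v set \<times> (('v \<Rightarrow> 'v) \<Rightarrow> 'v \<Rightarrow> 'v)"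
  where
  "as_action_obj \<A> elts B X =
     (elts X, \<lambda>\<pi>\<in>Aut_over \<A> B. \<lambda>x\<in>elts X. act (univ \<A>) elts \<pi> x)"

definition as_action where
  "as_action \<A> elts B =
     \<lparr>fobj = as_action_obj \<A> elts B,
      farr = (\<lambda>(X, Y, f). (as_action_obj \<A> elts B X, as_action_obj \<A> elts B Y,
                \<lambda>x\<in>elts X. THE y. vpair (univ \<A>) elts x y \<in> elts f))\<rparr>"

definition canonical_image where
  "canonical_image L \<A> elts B N F \<longleftrightarrow>
     is_functor L (ZFA_equivariant \<A> elts B) F \<and> N = functor_comp (as_action \<A> elts B) F"

end

theory Submission
  imports Defs
begin

text \<open>
  Both \<open>ZFA(\<A>)\<close> and \<open>Cont(Aut(\<A> \<squnion> B))\<close> are concrete categories in which finite products are computed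
  on underlying sets, and in which a function is an arrow as soon as its composites with a jointly
  injective finite family of arrows are. A model in such a category therefore amounts to an ordinary
  algebra on its value at \<open>1\<close>, and a homomorphism to an arrow between these values that is a homomorphism
  of algebras.

  A model in \<open>ZFA(\<A>)\<close> interprets each arrow of the theory by a finitely supported function. As finitely many
  operations generate the theory, a common finite support \<open>B\<close> works for all arrows, and replacing the
  values of the model by sets of tuples over its value at \<open>1\<close> gives an isomorphic \<open>B\<close>-equivariant model.

  The ordinary free algebra over an equivariant set \<open>X\<close> consists of classes of formal expressions, hence is
  equivariant and free in \<open>Cont\<close>. It is a symmetric set, and it is free in \<open>ZFA(\<A>)\<close> too: by the
  first part, the homomorphism extending a finitely supported map to a model is finitely supported.
\<close>

section \<open>Set models and concrete categories\<close>

text \<open>A model assigns infinitely many symmetric sets to the numbers \<open>n\<close>, each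
  with its own finite support, and nothing bounds the union of these supports. In general
  equivariance is therefore reached only after the values at all \<open>n\<close> are replaced by
  powers of the value at 1, whence the natural isomorphism in the statement. What remains to be
  supported is the family of operations on the value at 1, and there closure under projections,
  composition and tupling costs no new support.

  The finite set of generators serves a second purpose: it makes the arrows countable. The type of
  arrows is unrelated to the hierarchy, yet formal expressions have to be coded in it, by sets that
  automorphisms move through the variables alone. Atom-free numerals therefore act as names of
  arrows.

  Preservation of products is demanded for every finite product diagram of the theory, not just for
  the chosen powers of 1. Retracts reduce the general case to the powers.\<close>

definition pw :: "'a set \<Rightarrow> nat \<Rightarrow> 'a list set" where
  "pw C n = {xs. length xs = n \<and> set xs \<subseteq> C}"

lemma pw_map: "xs \<in> pw C n \<Longrightarrow> k \<in> C \<rightarrow> C' \<Longrightarrow> map k xs \<in> pw C' n"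
  unfolding pw_def by auto

lemma pw_nth: "xs \<in> pw C n \<Longrightarrow> i < n \<Longrightarrow> xs ! i \<in> C"
  unfolding pw_def by auto

lemma pw_map_upt: "(\<And>i. i < n \<Longrightarrow> g i \<in> C) \<Longrightarrow> map g [0..<n] \<in> pw C n"
  unfolding pw_def by auto

lemma pw_1: "xs \<in> pw C (Suc 0) \<longleftrightarrow> (\<exists>x\<in>C. xs = [x])"
  unfolding pw_def by (auto simp: length_Suc_conv)

text \<open>A strict form of a model in sets: the value at \<open>n\<close> is the set of lists of
  length \<open>n\<close> and projections are list lookups, so no product isomorphisms have to be
  carried along. The carrier is any subset of the type; it need not be the member set of an element
  of the hierarchy.\<close>

definition set_model :: "'l lawvere \<Rightarrow> 'v set \<Rightarrow> ('l \<Rightarrow> 'v list \<Rightarrow> 'v list) \<Rightarrow> bool" where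
  "set_model L C I \<longleftrightarrow>
     (\<forall>n m. \<forall>t\<in>Hom L n m. \<forall>xs\<in>pw C n. I t xs \<in> pw C m) \<and>
     (\<forall>n. \<forall>xs\<in>pw C n. I (Ide L n) xs = xs) \<and>
     (\<forall>n m k. \<forall>t\<in>Hom L n m. \<forall>u\<in>Hom L m k. \<forall>xs\<in>pw C n. I (Cmp L u t) xs = I u (I t xs)) \<and>
     (\<forall>n. \<forall>i<n. \<forall>xs\<in>pw C n. I (Prj L n i) xs = [xs ! i])"

definition set_hom ::
    "'l lawvere \<Rightarrow> 'v set \<Rightarrow> ('l \<Rightarrow> 'v list \<Rightarrow> 'v list) \<Rightarrow> 'w set \<Rightarrow> ('l \<Rightarrow> 'w list \<Rightarrow> 'w list) \<Rightarrow>
     ('v \<Rightarrow> 'w) \<Rightarrow> bool" where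
  "set_hom L C I C' I' k \<longleftrightarrow> k \<in> C \<rightarrow> C' \<and>
     (\<forall>n m. \<forall>t\<in>Hom L n m. \<forall>xs\<in>pw C n. map k (I t xs) = I' t (map k xs))"

lemma
  assumes "set_model L C I"
  shows set_model_in: "t \<in> Hom L n m \<Longrightarrow> xs \<in> pw C n \<Longrightarrow> I t xs \<in> pw C m"
    and set_model_Ide: "xs \<in> pw C n \<Longrightarrow> I (Ide L n) xs = xs"
    and set_model_Cmp: "t \<in> Hom L n m \<Longrightarrow> u \<in> Hom L m k \<Longrightarrow> xs \<in> pw C n \<Longrightarrow>
      I (Cmp L u t) xs = I u (I t xs)"
    and set_model_Prj: "i < n \<Longrightarrow> xs \<in> pw C n \<Longrightarrow> I (Prj L n i) xs = [xs ! i]"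
  using assms unfolding set_model_def by blast+

lemma
  assumes "set_hom L C I C' I' k"
  shows set_hom_in: "k \<in> C \<rightarrow> C'"
    and set_hom_map: "t \<in> Hom L n m \<Longrightarrow> xs \<in> pw C n \<Longrightarrow> map k (I t xs) = I' t (map k xs)"
  using assms unfolding set_hom_def by blast+

text \<open>The function of an arrow is controlled on its domain only, so homomorphy has to be
  inferred from agreement on the carrier; the lists in question never leave it.\<close>

lemma set_hom_eq_on:
  assumes I: "set_model L C I" and k': "set_hom L C I C' I' k'" and eq: "\<And>u. u \<in> C \<Longrightarrow> k u = k' u"
  shows "set_hom L C I C' I' k"
  unfolding set_hom_def
proof (intro conjI allI ballI)
  show "k \<in> C \<rightarrow> C'" using eq set_hom_in[OF k'] by auto
  have map_k: "map k xs = map k' xs" if "xs \<in> pw C n" for xs n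
    using eq that unfolding pw_def by auto
  fix n m t xs assume t: "t \<in> Hom L n m" and xs: "xs \<in> pw C n"
  show "map k (I t xs) = I' t (map k xs)"
    unfolding map_k[OF xs] map_k[OF set_model_in[OF I t xs]] by (rule set_hom_map[OF k' t xs])
qed

section \<open>Arrows and finite products of a Lawvere theory\<close>

locale lawvere_theory_loc =
  fixes L :: "'l lawvere"
  assumes lawvere: "lawvere_theory L"
begin

lemma category: "is_category L"
  using lawvere unfolding lawvere_theory_def by blast

lemma Obj_L [simp]: "Obj L = UNIV"
  using lawvere unfolding lawvere_theory_def by blast

lemma Prj_1: "Prj L 1 0 = Ide L 1"
  using lawvere unfolding lawvere_theory_def by blast

lemma product_L: "is_product L n (\<lambda>_. 1) n (Prj L n)"
  using lawvere unfolding lawvere_theory_def by blast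

lemma Prj_Hom: "i < n \<Longrightarrow> Prj L n i \<in> Hom L n 1"
  using product_L[of n] unfolding is_product_def by blast

lemma Ide_Hom: "Ide L n \<in> Hom L n n"
  using category unfolding is_category_def by simp

lemma Cmp_Hom: "t \<in> Hom L n m \<Longrightarrow> u \<in> Hom L m k \<Longrightarrow> Cmp L u t \<in> Hom L n k"
  using category unfolding is_category_def by blast

lemma Cmp_assoc: "t \<in> Hom L n m \<Longrightarrow> u \<in> Hom L m k \<Longrightarrow> w \<in> Hom L k l \<Longrightarrow>
    Cmp L w (Cmp L u t) = Cmp L (Cmp L w u) t"
  using category unfolding is_category_def by blast

lemma Cmp_Ide: "t \<in> Hom L n m \<Longrightarrow> Cmp L t (Ide L n) = t"
  using category unfolding is_category_def Hom_def by blast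

lemma tuple_ex1:
  assumes "\<And>i. i < n \<Longrightarrow> q i \<in> Hom L k 1"
  shows "\<exists>!u. u \<in> Hom L k n \<and> (\<forall>i<n. Cmp L (Prj L n i) u = q i)"
  using product_L[of n] assms unfolding is_product_def by simp

lemma tuple_ex:
  assumes "\<And>i. i < n \<Longrightarrow> q i \<in> Hom L k 1"
  obtains u where "u \<in> Hom L k n" "\<And>i. i < n \<Longrightarrow> Cmp L (Prj L n i) u = q i"
  using ex1_implies_ex[OF tuple_ex1[of n q k]] assms by blast

lemma Hom_eqI:
  assumes "u \<in> Hom L k n" "v \<in> Hom L k n" "\<And>i. i < n \<Longrightarrow> Cmp L (Prj L n i) u = Cmp L (Prj L n i) v"
  shows "u = v"
  using tuple_ex1[of n "\<lambda>i. Cmp L (Prj L n i) v" k] assms Cmp_Hom[OF assms(2) Prj_Hom] by metis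

lemma set_model_component:
  assumes "set_model L C I" "t \<in> Hom L n m" "xs \<in> pw C n" "i < m"
  shows "I (Cmp L (Prj L m i) t) xs = [I t xs ! i]"
  using assms Prj_Hom[of i m] set_model_in[OF assms(1-3)]
  by (simp add: set_model_Cmp[OF assms(1)] set_model_Prj[OF assms(1)])

text \<open>An arbitrary product \<open>P\<close> of objects \<open>X i\<close> is a retract, compatibly with the projections, of the
  power of \<open>1\<close> indexed by the pairs \<open>(i, j)\<close> with \<open>j < X i\<close>.\<close>

lemma product_retract:
  assumes prod: "is_product L n X P p"
  obtains ps K u v r where
    "K = length ps" "set ps = {(i, j). i < n \<and> j < X i}"
    "u \<in> Hom L K P" "v \<in> Hom L P K" "Cmp L u v = Ide L P"
    "\<And>i. i < n \<Longrightarrow> r i \<in> Hom L K (X i)" "\<And>i. i < n \<Longrightarrow> Cmp L (p i) u = r i"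
    "\<And>k. k < K \<Longrightarrow> Cmp L (Prj L K k) v = Cmp L (Prj L (X (fst (ps ! k))) (snd (ps ! k))) (p (fst (ps ! k)))"
    "\<And>i j. i < n \<Longrightarrow> j < X i \<Longrightarrow> \<exists>k<K. ps ! k = (i, j) \<and> Cmp L (Prj L (X i) j) (r i) = Prj L K k"
proof -
  have p: "p i \<in> Hom L P (X i)" if "i < n" for i
    using prod that unfolding is_product_def by blast
  define ps where "ps = concat (map (\<lambda>i. map (Pair i) [0..<X i]) [0..<n])"
  define K where "K = length ps"
  have ps: "set ps = {(i, j). i < n \<and> j < X i}" unfolding ps_def by auto
  have ps_nth: "fst (ps ! k) < n" "snd (ps ! k) < X (fst (ps ! k))" if "k < K" for k
    using ps nth_mem[of k ps] that unfolding K_def by auto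
  have "\<exists>k<K. ps ! k = (i, j)" if "i < n" "j < X i" for i j
  proof -
    have "(i, j) \<in> set ps" using ps that by blast
    then show ?thesis by (simp add: in_set_conv_nth K_def)
  qed
  then obtain pos where pos: "\<And>i j. i < n \<Longrightarrow> j < X i \<Longrightarrow> pos i j < K \<and> ps ! pos i j = (i, j)"
    by metis
  \<comment> \<open>A tuple of length \<open>K\<close> contains, at the places
    \<open>pos i j\<close>, the coordinates of a component in \<open>X i\<close>. The arrow
    \<open>r i\<close> selects them, and the universal property of \<open>P\<close> assembles the
    \<open>r i\<close> to \<open>u\<close>.\<close>
  have "\<exists>r. r \<in> Hom L K (X i) \<and> (\<forall>j<X i. Cmp L (Prj L (X i) j) r = Prj L K (pos i j))" if "i < n" for i
    using tuple_ex[of "X i" "\<lambda>j. Prj L K (pos i j)" K] Prj_Hom pos that by metis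
  then obtain r where r: "\<And>i. i < n \<Longrightarrow> r i \<in> Hom L K (X i)"
    "\<And>i j. i < n \<Longrightarrow> j < X i \<Longrightarrow> Cmp L (Prj L (X i) j) (r i) = Prj L K (pos i j)"
    by metis
  have "\<exists>!u. u \<in> Hom L K P \<and> (\<forall>i<n. Cmp L (p i) u = r i)"
    using prod r(1) unfolding is_product_def by simp
  then obtain u where u: "u \<in> Hom L K P" "\<And>i. i < n \<Longrightarrow> Cmp L (p i) u = r i" by blast
  have q: "Cmp L (Prj L (X (fst (ps ! k))) (snd (ps ! k))) (p (fst (ps ! k))) \<in> Hom L P 1" if "k < K" for k
    using Cmp_Hom[OF p Prj_Hom] ps_nth[OF that] by blast
  obtain v where v: "v \<in> Hom L P K"
    "\<And>k. k < K \<Longrightarrow> Cmp L (Prj L K k) v = Cmp L (Prj L (X (fst (ps ! k))) (snd (ps ! k))) (p (fst (ps ! k)))"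
    using ex1_implies_ex[OF tuple_ex1[of K "\<lambda>k. Cmp L (Prj L (X (fst (ps ! k))) (snd (ps ! k))) (p (fst (ps ! k)))" P]] q
    by blast
  \<comment> \<open>\<open>v\<close> lists all coordinates of all components, so selecting those of
    \<open>X i\<close> gives back \<open>p i\<close>.\<close>
  have rv: "Cmp L (r i) v = p i" if i: "i < n" for i
  proof (rule Hom_eqI)
    show "Cmp L (r i) v \<in> Hom L P (X i)" using v(1) r(1)[OF i] by (rule Cmp_Hom)
    show "p i \<in> Hom L P (X i)" using p[OF i] .
    fix j assume j: "j < X i"
    have "Cmp L (Prj L (X i) j) (Cmp L (r i) v) = Cmp L (Prj L K (pos i j)) v"
      using Cmp_assoc[OF v(1) r(1)[OF i] Prj_Hom[OF j]] r(2)[OF i j] by simp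
    then show "Cmp L (Prj L (X i) j) (Cmp L (r i) v) = Cmp L (Prj L (X i) j) (p i)"
      using v(2)[of "pos i j"] pos[OF i j] by simp
  qed
  have "Cmp L u v \<in> Hom L P P \<and> (\<forall>i<n. Cmp L (p i) (Cmp L u v) = p i)"
    using Cmp_Hom[OF v(1) u(1)] Cmp_assoc[OF v(1) u(1) p] u(2) rv by simp
  moreover have "Ide L P \<in> Hom L P P \<and> (\<forall>i<n. Cmp L (p i) (Ide L P) = p i)"
    using Ide_Hom Cmp_Ide[OF p] by simp
  moreover have "\<exists>!u. u \<in> Hom L P P \<and> (\<forall>i<n. Cmp L (p i) u = p i)"
    using prod p unfolding is_product_def by simp
  ultimately have uv: "Cmp L u v = Ide L P" by blast
  have pos': "\<exists>k<K. ps ! k = (i, j) \<and> Cmp L (Prj L (X i) j) (r i) = Prj L K k" if "i < n" "j < X i" for i j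
    using pos[OF that] r(2)[OF that] by blast
  show thesis
    by (rule that[of K ps u v r]) (fact K_def ps u v uv r(1) pos')+
qed

end

text \<open>
  The assumption \<open>lift\<close> is what finite supports in \<open>ZFA\<close> and equivariance in \<open>Cont\<close> have in common:
  both pass from the composites with a jointly injective finite family of arrows to the function itself.
\<close>

locale concrete_cat = lawvere_theory_loc L for L :: "'l lawvere" +
  fixes D :: "('p, 'n) category" and car :: "'p \<Rightarrow> 'v set" and fn :: "'n \<Rightarrow> 'v \<Rightarrow> 'v"
  assumes arr_obj: "f \<in> Arr D \<Longrightarrow> Dom D f \<in> Obj D \<and> Cod D f \<in> Obj D"
    and ide_hom: "X \<in> Obj D \<Longrightarrow> Ide D X \<in> Hom D X X"
    and fn_ide: "X \<in> Obj D \<Longrightarrow> x \<in> car X \<Longrightarrow> fn (Ide D X) x = x"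
    and cmp_hom: "f \<in> Hom D X Y \<Longrightarrow> g \<in> Hom D Y Z \<Longrightarrow> Cmp D g f \<in> Hom D X Z"
    and fn_cmp: "f \<in> Hom D X Y \<Longrightarrow> g \<in> Hom D Y Z \<Longrightarrow> x \<in> car X \<Longrightarrow> fn (Cmp D g f) x = fn g (fn f x)"
    and fn_in: "f \<in> Hom D X Y \<Longrightarrow> x \<in> car X \<Longrightarrow> fn f x \<in> car Y"
    and faithful: "f \<in> Hom D X Y \<Longrightarrow> g \<in> Hom D X Y \<Longrightarrow> (\<And>x. x \<in> car X \<Longrightarrow> fn f x = fn g x) \<Longrightarrow> f = g"
    and lift: "P \<in> Obj D \<Longrightarrow> Q \<in> Obj D \<Longrightarrow> (\<And>i. i < (n::nat) \<Longrightarrow> p i \<in> Hom D P (Xs i)) \<Longrightarrow>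
      (\<And>i. i < n \<Longrightarrow> q i \<in> Hom D Q (Xs i)) \<Longrightarrow>
      (\<And>z z'. z \<in> car P \<Longrightarrow> z' \<in> car P \<Longrightarrow> (\<And>i. i < n \<Longrightarrow> fn (p i) z = fn (p i) z') \<Longrightarrow> z = z') \<Longrightarrow>
      (\<And>x. x \<in> car Q \<Longrightarrow> u x \<in> car P) \<Longrightarrow>
      (\<And>i x. i < n \<Longrightarrow> x \<in> car Q \<Longrightarrow> fn (p i) (u x) = fn (q i) x) \<Longrightarrow>
      \<exists>u'\<in>Hom D Q P. \<forall>x\<in>car Q. fn u' x = u x"
    and products: "(\<And>i. i < (n::nat) \<Longrightarrow> Xs i \<in> Obj D) \<Longrightarrow>
      \<exists>Q q. Q \<in> Obj D \<and> (\<forall>i<n. q i \<in> Hom D Q (Xs i)) \<and>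
        (\<forall>z\<in>car Q. \<forall>z'\<in>car Q. (\<forall>i<n. fn (q i) z = fn (q i) z') \<longrightarrow> z = z') \<and>
        (\<forall>y. (\<forall>i<n. y i \<in> car (Xs i)) \<longrightarrow> (\<exists>z\<in>car Q. \<forall>i<n. fn (q i) z = y i))"
begin

section \<open>Products in a concrete category, computed on elements\<close>

lemma hom_obj: "f \<in> Hom D X Y \<Longrightarrow> X \<in> Obj D" "f \<in> Hom D X Y \<Longrightarrow> Y \<in> Obj D"
  using arr_obj unfolding Hom_def by auto

lemma category_D: "is_category D"
  unfolding is_category_def
proof (intro conjI ballI allI)
  fix f assume "f \<in> Arr D"
  then have f: "f \<in> Hom D (Dom D f) (Cod D f)" unfolding Hom_def by simp
  note ideD = ide_hom[OF hom_obj(1)[OF f]] and ideC = ide_hom[OF hom_obj(2)[OF f]]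
  show "Cmp D f (Ide D (Dom D f)) = f"
    by (rule faithful[OF cmp_hom[OF ideD f] f]) (simp add: fn_cmp[OF ideD f] fn_ide[OF hom_obj(1)[OF f]])
  show "Cmp D (Ide D (Cod D f)) f = f"
    by (rule faithful[OF cmp_hom[OF f ideC] f])
      (simp add: fn_cmp[OF f ideC] fn_ide[OF hom_obj(2)[OF f]] fn_in[OF f])
next
  fix X Y Z W f g h assume fgh: "f \<in> Hom D X Y" "g \<in> Hom D Y Z" "h \<in> Hom D Z W"
  note gf = cmp_hom[OF fgh(1,2)] and hg = cmp_hom[OF fgh(2,3)]
  show "Cmp D h (Cmp D g f) = Cmp D (Cmp D h g) f"
  proof (rule faithful)
    fix x assume x: "x \<in> car X"
    show "fn (Cmp D h (Cmp D g f)) x = fn (Cmp D (Cmp D h g) f) x"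
      using fn_cmp[OF gf fgh(3) x] fn_cmp[OF fgh(1) hg x] fn_cmp[OF fgh(1,2) x]
        fn_cmp[OF fgh(2,3) fn_in[OF fgh(1) x]] by simp
  qed (rule cmp_hom[OF gf fgh(3)] cmp_hom[OF fgh(1) hg])+
next
  fix X Y Z f g assume "f \<in> Hom D X Y" "g \<in> Hom D Y Z"
  then show "Cmp D g f \<in> Hom D X Z" by (rule cmp_hom)
qed (use arr_obj ide_hom in auto)

lemma
  assumes "f \<in> Hom D X Y"
  shows cmp_ide: "Cmp D f (Ide D X) = f" and ide_cmp: "Cmp D (Ide D Y) f = f"
  using category_D assms unfolding is_category_def Hom_def by blast+

text \<open>Surjectivity solves the universal problem by a plain function. The projections are
  jointly injective and their composites with this function are the given arrows, so
  \<open>lift\<close> makes it an arrow.\<close>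

lemma is_productI:
  assumes P: "P \<in> Obj D" and p: "\<And>i. i < n \<Longrightarrow> p i \<in> Hom D P (X i)"
    and inj: "\<And>z z'. z \<in> car P \<Longrightarrow> z' \<in> car P \<Longrightarrow> (\<And>i. i < n \<Longrightarrow> fn (p i) z = fn (p i) z') \<Longrightarrow> z = z'"
    and surj: "\<And>y. (\<And>i. i < n \<Longrightarrow> y i \<in> car (X i)) \<Longrightarrow> \<exists>z\<in>car P. \<forall>i<n. fn (p i) z = y i"
  shows "is_product D n X P p"
  unfolding is_product_def
proof (intro conjI ballI allI impI)
  fix Q q assume Q: "Q \<in> Obj D" and "\<forall>i<n. q i \<in> Hom D Q (X i)"
  then have q: "\<And>i. i < n \<Longrightarrow> q i \<in> Hom D Q (X i)" by blast
  have "\<exists>z\<in>car P. \<forall>i<n. fn (p i) z = fn (q i) x" if "x \<in> car Q" for x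
    using that fn_in[OF q] by (intro surj) auto
  then obtain u where u: "\<And>x. x \<in> car Q \<Longrightarrow> u x \<in> car P"
    "\<And>i x. i < n \<Longrightarrow> x \<in> car Q \<Longrightarrow> fn (p i) (u x) = fn (q i) x"
    by metis
  have "\<exists>u'\<in>Hom D Q P. \<forall>x\<in>car Q. fn u' x = u x"
    by (rule lift[of P Q n p X q u]) (fact P Q p q inj u)+
  then obtain u' where u': "u' \<in> Hom D Q P" "\<forall>x\<in>car Q. fn u' x = u x" by blast
  show "\<exists>!u. u \<in> Hom D Q P \<and> (\<forall>i<n. Cmp D (p i) u = q i)"
  proof (rule ex1I[of _ u'], intro conjI allI impI)
    fix i assume i: "i < n"
    show "Cmp D (p i) u' = q i"
      using cmp_hom[OF u'(1) p[OF i]] q[OF i]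
      by (rule faithful) (simp add: fn_cmp[OF u'(1) p[OF i]] u'(2) u(2)[OF i])
  next
    fix w assume w: "w \<in> Hom D Q P \<and> (\<forall>i<n. Cmp D (p i) w = q i)"
    show "w = u'"
    proof (rule faithful)
      fix x assume x: "x \<in> car Q"
      show "fn w x = fn u' x"
      proof (rule inj)
        fix i assume "i < n"
        then show "fn (p i) (fn w x) = fn (p i) (fn u' x)"
          using w fn_cmp[of w Q P "p i" "X i" x] p x u u' by auto
      qed (use w u u' x fn_in in auto)
    qed (use w u' in auto)
  qed (use u' in auto)
next
  fix i assume "i < n"
  then show "X i \<in> Obj D" using hom_obj(2)[OF p] by blast
qed (use P p in auto)

text \<open>The given product is compared with the set-level product \<open>Q\<close> from
  \<open>products\<close>. For the mediating arrows, \<open>u\<close> after \<open>v\<close> is the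
  identity; thus \<open>v\<close> is injective and joint injectivity is inherited from
  \<open>Q\<close>, while \<open>u\<close> carries solutions found in \<open>Q\<close> back to
  \<open>P\<close>.\<close>

lemma
  assumes prod: "is_product D n X P p"
  shows is_product_inj: "\<And>z z'. z \<in> car P \<Longrightarrow> z' \<in> car P \<Longrightarrow>
      (\<And>i. i < n \<Longrightarrow> fn (p i) z = fn (p i) z') \<Longrightarrow> z = z'"
    and is_product_surj: "\<And>y. (\<And>i. i < n \<Longrightarrow> y i \<in> car (X i)) \<Longrightarrow> \<exists>z\<in>car P. \<forall>i<n. fn (p i) z = y i"
proof -
  have P: "P \<in> Obj D" and p: "\<And>i. i < n \<Longrightarrow> p i \<in> Hom D P (X i)" and X: "\<And>i. i < n \<Longrightarrow> X i \<in> Obj D"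
    using prod unfolding is_product_def by blast+
  obtain Q q where Q: "Q \<in> Obj D" and q: "\<And>i. i < n \<Longrightarrow> q i \<in> Hom D Q (X i)"
    and inj: "\<And>z z'. z \<in> car Q \<Longrightarrow> z' \<in> car Q \<Longrightarrow> (\<And>i. i < n \<Longrightarrow> fn (q i) z = fn (q i) z') \<Longrightarrow> z = z'"
    and surj: "\<And>y. (\<And>i. i < n \<Longrightarrow> y i \<in> car (X i)) \<Longrightarrow> \<exists>z\<in>car Q. \<forall>i<n. fn (q i) z = y i"
    using products[of n X] X by metis
  have "\<exists>!u. u \<in> Hom D Q P \<and> (\<forall>i<n. Cmp D (p i) u = q i)"
    using prod Q q unfolding is_product_def by simp
  then obtain u where u: "u \<in> Hom D Q P" "\<And>i. i < n \<Longrightarrow> Cmp D (p i) u = q i" by blast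
  have "is_product D n X Q q" by (rule is_productI) (fact Q q inj surj)+
  then have "\<exists>!v. v \<in> Hom D P Q \<and> (\<forall>i<n. Cmp D (q i) v = p i)"
    using P p unfolding is_product_def by simp
  then obtain v where v: "v \<in> Hom D P Q" "\<And>i. i < n \<Longrightarrow> Cmp D (q i) v = p i" by blast
  have "\<exists>!w. w \<in> Hom D P P \<and> (\<forall>i<n. Cmp D (p i) w = p i)"
    using prod P p unfolding is_product_def by simp
  moreover have "Cmp D u v \<in> Hom D P P \<and> (\<forall>i<n. Cmp D (p i) (Cmp D u v) = p i)"
  proof (intro conjI allI impI)
    show "Cmp D u v \<in> Hom D P P" using v(1) u(1) by (rule cmp_hom)
    fix i assume i: "i < n"
    have "Cmp D (p i) (Cmp D u v) = Cmp D (Cmp D (p i) u) v"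
      using category_D v(1) u(1) p[OF i] unfolding is_category_def by blast
    then show "Cmp D (p i) (Cmp D u v) = p i" using u(2)[OF i] v(2)[OF i] by simp
  qed
  moreover have "Ide D P \<in> Hom D P P \<and> (\<forall>i<n. Cmp D (p i) (Ide D P) = p i)"
    using ide_hom[OF P] cmp_ide[OF p] by blast
  ultimately have uv: "Cmp D u v = Ide D P" by blast
  show "z = z'" if z: "z \<in> car P" "z' \<in> car P" and eq: "\<And>i. i < n \<Longrightarrow> fn (p i) z = fn (p i) z'" for z z'
  proof -
    have "fn (q i) (fn v x) = fn (p i) x" if "i < n" "x \<in> car P" for i x
      using fn_cmp[OF v(1) q that(2), of i] v(2) that by simp
    then have "fn (q i) (fn v z) = fn (q i) (fn v z')" if "i < n" for i
      using z eq that by simp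
    then have "fn v z = fn v z'"
      by (rule inj[OF fn_in[OF v(1) z(1)] fn_in[OF v(1) z(2)]])
    then have "fn (Cmp D u v) z = fn (Cmp D u v) z'"
      using fn_cmp[OF v(1) u(1)] z by simp
    then show ?thesis using uv fn_ide[OF P] z by simp
  qed
  show "\<exists>z\<in>car P. \<forall>i<n. fn (p i) z = y i" if "\<And>i. i < n \<Longrightarrow> y i \<in> car (X i)" for y
  proof -
    have "\<exists>z\<in>car Q. \<forall>i<n. fn (q i) z = y i" by (rule surj) (fact that)
    then obtain z where z: "z \<in> car Q" "\<forall>i<n. fn (q i) z = y i" by blast
    have "fn (p i) (fn u z) = y i" if "i < n" for i
      using fn_cmp[OF u(1) p z(1), of i] u(2) z(2) that by simp
    then show ?thesis using fn_in[OF u(1) z(1)] by blast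
  qed
qed

section \<open>Models as algebras on the value at 1\<close>

definition dec :: "(nat, 'l, 'p, 'n) functor_data \<Rightarrow> nat \<Rightarrow> 'v \<Rightarrow> 'v list" where
  "dec M n x = map (\<lambda>i. fn (farr M (Prj L n i)) x) [0..<n]"

text \<open>An inverse of \<open>dec\<close> where \<open>dec\<close> is bijective, which
  \<open>model_dec_bij\<close> shows for models.\<close>

definition enc :: "(nat, 'l, 'p, 'n) functor_data \<Rightarrow> nat \<Rightarrow> 'v list \<Rightarrow> 'v" where
  "enc M n = inv_into (car (fobj M n)) (dec M n)"

text \<open>The operation of \<open>t\<close>, transported along the decoding bijections. As a
  function on lists it no longer depends on the category, so \<open>set_model\<close> and
  \<open>set_hom\<close> apply to models in \<open>ZFA\<close> and in \<open>Cont\<close>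
  alike.\<close>

definition interp :: "(nat, 'l, 'p, 'n) functor_data \<Rightarrow> 'l \<Rightarrow> 'v list \<Rightarrow> 'v list" where
  "interp M t xs = dec M (Cod L t) (fn (farr M t) (enc M (Dom L t) xs))"

lemma
  assumes "is_functor L D M"
  shows functor_obj: "fobj M n \<in> Obj D"
    and functor_ide: "farr M (Ide L n) = Ide D (fobj M n)"
    and functor_hom: "t \<in> Hom L n m \<Longrightarrow> farr M t \<in> Hom D (fobj M n) (fobj M m)"
    and functor_cmp: "t \<in> Hom L n m \<Longrightarrow> u \<in> Hom L m k \<Longrightarrow> farr M (Cmp L u t) = Cmp D (farr M u) (farr M t)"
  using assms unfolding is_functor_def by auto

lemma fn_functor_cmp:
  assumes "is_functor L D M" "t \<in> Hom L n m" "u \<in> Hom L m k" "x \<in> car (fobj M n)"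
  shows "fn (farr M (Cmp L u t)) x = fn (farr M u) (fn (farr M t) x)"
  using assms by (simp add: functor_cmp fn_cmp[OF functor_hom functor_hom])

lemma dec_in:
  assumes "is_functor L D M" "x \<in> car (fobj M n)"
  shows "dec M n x \<in> pw (car (fobj M 1)) n"
  unfolding dec_def using fn_in[OF functor_hom[OF assms(1) Prj_Hom]] assms(2)
  by (intro pw_map_upt) auto

lemma dec_nth: "i < n \<Longrightarrow> dec M n x ! i = fn (farr M (Prj L n i)) x"
  unfolding dec_def by simp

lemma length_dec [simp]: "length (dec M n x) = n"
  unfolding dec_def by simp

text \<open>The chosen power \<open>n\<close> of 1 is preserved, and a product in \<open>D\<close>
  is a product on elements.\<close>

lemma model_dec_bij:
  assumes "is_model L D M"
  shows "bij_betw (dec M n) (car (fobj M n)) (pw (car (fobj M 1)) n)"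
proof -
  have func: "is_functor L D M" using assms unfolding is_model_def by blast
  have prod: "is_product D n (fobj M \<circ> (\<lambda>_. 1)) (fobj M n) (farr M \<circ> Prj L n)"
    using assms product_L unfolding is_model_def preserves_finite_products_def by blast
  show ?thesis
    unfolding bij_betw_def
  proof (intro conjI equalityI subsetI inj_onI)
    fix x y assume *: "x \<in> car (fobj M n)" "y \<in> car (fobj M n)" "dec M n x = dec M n y"
    show "x = y"
    proof (rule is_product_inj[OF prod *(1,2)])
      fix i assume "i < n"
      then show "fn ((farr M \<circ> Prj L n) i) x = fn ((farr M \<circ> Prj L n) i) y"
        using arg_cong[OF *(3), of "\<lambda>xs. xs ! i"] by (simp add: dec_nth)
    qed
  next
    fix xs assume xs: "xs \<in> pw (car (fobj M 1)) n"
    have "\<exists>z\<in>car (fobj M n). \<forall>i<n. fn ((farr M \<circ> Prj L n) i) z = xs ! i"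
      using pw_nth[OF xs] by (intro is_product_surj[OF prod]) simp
    then obtain z where z: "z \<in> car (fobj M n)" "\<forall>i<n. fn (farr M (Prj L n i)) z = xs ! i" by auto
    have "xs = dec M n z"
      using xs z(2) by (intro nth_equalityI) (auto simp: pw_def dec_nth)
    then show "xs \<in> dec M n ` car (fobj M n)" using z(1) by blast
  qed (use dec_in[OF func] in auto)
qed

text \<open>Bijectivity of decoding concerns the powers of 1 only. By \<open>product_retract\<close>
  any product \<open>P\<close> is a retract of a power \<open>K\<close>: elements over
  \<open>P\<close> with equal projections have images under \<open>v\<close> with equal coordinates,
  and prescribed components are realised by writing all their coordinates into one list, encoding it
  at \<open>K\<close> and applying \<open>u\<close>.\<close>

lemma modelI:
  assumes func: "is_functor L D M"
    and bij: "\<And>n. bij_betw (dec M n) (car (fobj M n)) (pw (car (fobj M 1)) n)"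
  shows "is_model L D M"
  unfolding is_model_def preserves_finite_products_def
proof (intro conjI allI impI func)
  fix n X P p assume prod: "is_product L n X P p"
  have p: "p i \<in> Hom L P (X i)" if "i < n" for i
    using prod that unfolding is_product_def by blast
  have dec_eq: "z = z'" if "z \<in> car (fobj M m)" "z' \<in> car (fobj M m)"
      "\<And>j. j < m \<Longrightarrow> fn (farr M (Prj L m j)) z = fn (farr M (Prj L m j)) z'" for z z' m
  proof -
    have "dec M m z = dec M m z'" by (rule nth_equalityI) (auto simp: dec_nth that)
    then show ?thesis by (rule inj_onD[OF bij_betw_imp_inj_on[OF bij] _ that(1,2)])
  qed
  show "is_product D n (fobj M \<circ> X) (fobj M P) (farr M \<circ> p)"
  proof (rule product_retract[OF prod])
    fix ps :: "(nat \<times> nat) list" and K u v r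
    assume ps: "K = length ps" "set ps = {(i, j). i < n \<and> j < X i}"
      and u: "u \<in> Hom L K P" and v: "v \<in> Hom L P K" and uv: "Cmp L u v = Ide L P"
      and r: "\<And>i. i < n \<Longrightarrow> r i \<in> Hom L K (X i)" and pu: "\<And>i. i < n \<Longrightarrow> Cmp L (p i) u = r i"
      and Pv: "\<And>k. k < K \<Longrightarrow>
        Cmp L (Prj L K k) v = Cmp L (Prj L (X (fst (ps ! k))) (snd (ps ! k))) (p (fst (ps ! k)))"
      and pos: "\<And>i j. i < n \<Longrightarrow> j < X i \<Longrightarrow> \<exists>k<K. ps ! k = (i, j) \<and> Cmp L (Prj L (X i) j) (r i) = Prj L K k"
    have ps_nth: "fst (ps ! k) < n" "snd (ps ! k) < X (fst (ps ! k))" if "k < K" for k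
    proof -
      have "ps ! k \<in> set ps" using that ps(1) by simp
      then show "fst (ps ! k) < n" "snd (ps ! k) < X (fst (ps ! k))" unfolding ps(2) by auto
    qed
    show "is_product D n (fobj M \<circ> X) (fobj M P) (farr M \<circ> p)"
    proof (rule is_productI)
      show "fobj M P \<in> Obj D" using func by (rule functor_obj)
      show "(farr M \<circ> p) i \<in> Hom D (fobj M P) ((fobj M \<circ> X) i)" if "i < n" for i
        using functor_hom[OF func p[OF that]] by simp
    next
      fix z z' assume z: "z \<in> car (fobj M P)" "z' \<in> car (fobj M P)"
        and eq: "\<And>i. i < n \<Longrightarrow> fn ((farr M \<circ> p) i) z = fn ((farr M \<circ> p) i) z'"
      have "fn (farr M v) z = fn (farr M v) z'"
      proof (rule dec_eq)
        fix k assume k: "k < K"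
        have "fn (farr M (Prj L K k)) (fn (farr M v) x) =
            fn (farr M (Prj L (X (fst (ps ! k))) (snd (ps ! k)))) (fn (farr M (p (fst (ps ! k)))) x)"
          if "x \<in> car (fobj M P)" for x
          using fn_functor_cmp[OF func v Prj_Hom[OF k] that]
            fn_functor_cmp[OF func p[OF ps_nth(1)[OF k]] Prj_Hom[OF ps_nth(2)[OF k]] that] Pv[OF k] by simp
        then show "fn (farr M (Prj L K k)) (fn (farr M v) z) = fn (farr M (Prj L K k)) (fn (farr M v) z')"
          using z eq ps_nth(1)[OF k] by simp
      qed (use z fn_in[OF functor_hom[OF func v]] in auto)
      moreover have "fn (farr M u) (fn (farr M v) x) = x" if "x \<in> car (fobj M P)" for x
        using fn_functor_cmp[OF func v u that] uv that by (simp add: functor_ide[OF func] functor_obj[OF func] fn_ide)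
      ultimately show "z = z'" using z by metis
    next
      fix y assume y: "\<And>i. i < n \<Longrightarrow> y i \<in> car ((fobj M \<circ> X) i)"
      define w where "w = map (\<lambda>(i, j). fn (farr M (Prj L (X i) j)) (y i)) ps"
      have "w \<in> pw (car (fobj M 1)) K"
        using ps y fn_in[OF functor_hom[OF func Prj_Hom]] unfolding w_def pw_def by fastforce
      then have "w \<in> dec M K ` car (fobj M K)" using bij_betw_imp_surj_on[OF bij, of K] by blast
      then obtain x where x: "x \<in> car (fobj M K)" "dec M K x = w" by blast
      \<comment> \<open>Both sides lie in the value at \<open>X i\<close>, where
        \<open>dec_eq\<close> compares coordinates; coordinate \<open>j\<close> of the left side is
        the entry of \<open>w\<close> at the place of \<open>(i, j)\<close>.\<close>
      have "fn ((farr M \<circ> p) i) (fn (farr M u) x) = y i" if i: "i < n" for i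
      proof (rule dec_eq)
        have "fn ((farr M \<circ> p) i) (fn (farr M u) x) = fn (farr M (r i)) x"
          using fn_functor_cmp[OF func u p[OF i] x(1)] pu[OF i] by simp
        moreover fix j assume j: "j < X i"
        obtain k where k: "k < K" "ps ! k = (i, j)" "Cmp L (Prj L (X i) j) (r i) = Prj L K k"
          using pos[OF i j] by blast
        have "fn (farr M (Prj L (X i) j)) (fn (farr M (r i)) x) = w ! k"
          using fn_functor_cmp[OF func r[OF i] Prj_Hom[OF j] x(1)] k x(2)[symmetric] dec_nth[OF k(1)] by simp
        moreover have "w ! k = fn (farr M (Prj L (X i) j)) (y i)"
          using k ps unfolding w_def by simp
        ultimately show "fn (farr M (Prj L (X i) j)) (fn ((farr M \<circ> p) i) (fn (farr M u) x)) =
            fn (farr M (Prj L (X i) j)) (y i)" by simp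
      qed (use i y x fn_in[OF functor_hom[OF func p[OF i]]] fn_in[OF functor_hom[OF func u]] in auto)
      then show "\<exists>z\<in>car (fobj M P). \<forall>i<n. fn ((farr M \<circ> p) i) z = y i"
        using fn_in[OF functor_hom[OF func u] x(1)] by blast
    qed
  qed
qed

lemma model_functor: "is_model L D M \<Longrightarrow> is_functor L D M"
  unfolding is_model_def by blast

lemma
  assumes M: "is_model L D M"
  shows enc_in: "xs \<in> pw (car (fobj M 1)) n \<Longrightarrow> enc M n xs \<in> car (fobj M n)"
    and dec_enc: "xs \<in> pw (car (fobj M 1)) n \<Longrightarrow> dec M n (enc M n xs) = xs"
    and enc_dec: "x \<in> car (fobj M n) \<Longrightarrow> enc M n (dec M n x) = x"
    and dec_inj: "x \<in> car (fobj M n) \<Longrightarrow> y \<in> car (fobj M n) \<Longrightarrow> dec M n x = dec M n y \<Longrightarrow> x = y"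
  using model_dec_bij[OF M, of n] unfolding enc_def
  by (auto simp add: bij_betw_def inv_into_into f_inv_into_f dest: inj_onD)

lemma dec_farr:
  assumes M: "is_model L D M" and t: "t \<in> Hom L n m" and x: "x \<in> car (fobj M n)"
  shows "dec M m (fn (farr M t) x) = interp M t (dec M n x)"
  using t enc_dec[OF M x] unfolding interp_def Hom_def by auto

lemma interp_set_model:
  assumes M: "is_model L D M"
  shows "set_model L (car (fobj M 1)) (interp M)"
proof -
  note func = model_functor[OF M]
  have eq: "\<exists>x\<in>car (fobj M n). dec M n x = xs" if "xs \<in> pw (car (fobj M 1)) n" for n xs
    using enc_in[OF M that] dec_enc[OF M that] by blast
  show ?thesis
    unfolding set_model_def
  proof (intro conjI allI ballI impI)
    fix n m t xs assume t: "t \<in> Hom L n m" and "xs \<in> pw (car (fobj M 1)) n"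
    then obtain x where x: "x \<in> car (fobj M n)" "dec M n x = xs" using eq by blast
    show "interp M t xs \<in> pw (car (fobj M 1)) m"
      using dec_in[OF func fn_in[OF functor_hom[OF func t] x(1)]] dec_farr[OF M t x(1)] x(2) by simp
    fix k u assume u: "u \<in> Hom L m k"
    show "interp M (Cmp L u t) xs = interp M u (interp M t xs)"
      using dec_farr[OF M Cmp_Hom[OF t u] x(1)] dec_farr[OF M t x(1)] x(2)
        dec_farr[OF M u fn_in[OF functor_hom[OF func t] x(1)]] fn_functor_cmp[OF func t u x(1)]
      by simp
  next
    fix n xs assume "xs \<in> pw (car (fobj M 1)) n"
    then obtain x where x: "x \<in> car (fobj M n)" "dec M n x = xs" using eq by blast
    show "interp M (Ide L n) xs = xs"
      using dec_farr[OF M Ide_Hom x(1)] x(2) fn_ide[OF functor_obj[OF func] x(1)]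
      by (simp add: functor_ide[OF func])
    fix i assume i: "i < n"
    have "[fn (farr M (Prj L n i)) x] = interp M (Prj L n i) xs"
      using dec_farr[OF M Prj_Hom[OF i] x(1)] x(2)
        fn_ide[OF functor_obj[OF func] fn_in[OF functor_hom[OF func Prj_Hom[OF i]] x(1)]]
      using Prj_1 by (simp add: dec_def functor_ide[OF func])
    then show "interp M (Prj L n i) xs = [xs ! i]" using x(2) i dec_nth[OF i, of M x] by simp
  qed
qed

lemma dec_1:
  assumes M: "is_model L D M" and x: "x \<in> car (fobj M 1)"
  shows "dec M 1 x = [x]"
  using Prj_1 x fn_ide[OF functor_obj[OF model_functor[OF M]], of x 1]
  by (simp add: dec_def functor_ide[OF model_functor[OF M]])

text \<open>Naturality at the projections computes every component from the one at 1; naturality at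
  the other arrows then says that this one is a homomorphism of algebras.\<close>

lemma
  assumes F: "is_model L D F" and M: "is_model L D M" and h: "natural_transformation L D F M h"
  shows natural_hom: "h n \<in> Hom D (fobj F n) (fobj M n)"
    and natural_dec: "x \<in> car (fobj F n) \<Longrightarrow> dec M n (fn (h n) x) = map (fn (h 1)) (dec F n x)"
    and natural_set_hom: "set_hom L (car (fobj F 1)) (interp F) (car (fobj M 1)) (interp M) (fn (h 1))"
proof -
  note Ff = model_functor[OF F] and Mf = model_functor[OF M]
  show hom: "h n \<in> Hom D (fobj F n) (fobj M n)" for n
    using h unfolding natural_transformation_def by simp
  have nat: "fn (h m) (fn (farr F t) x) = fn (farr M t) (fn (h n) x)"
    if "t \<in> Hom L n m" "x \<in> car (fobj F n)" for t n m x
  proof -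
    have "Cmp D (h m) (farr F t) = Cmp D (farr M t) (h n)"
      using h that(1) unfolding natural_transformation_def by blast
    then show ?thesis
      using fn_cmp[OF functor_hom[OF Ff that(1)] hom that(2)]
        fn_cmp[OF hom functor_hom[OF Mf that(1)] that(2)] by simp
  qed
  show dec: "dec M n (fn (h n) x) = map (fn (h 1)) (dec F n x)" if "x \<in> car (fobj F n)" for n x
    using nat[OF Prj_Hom that] by (intro nth_equalityI) (auto simp: dec_nth)
  show "set_hom L (car (fobj F 1)) (interp F) (car (fobj M 1)) (interp M) (fn (h 1))"
    unfolding set_hom_def
  proof (intro conjI allI ballI)
    show "fn (h 1) \<in> car (fobj F 1) \<rightarrow> car (fobj M 1)" using fn_in[OF hom] by blast
    fix n m t xs assume t: "t \<in> Hom L n m" and xs: "xs \<in> pw (car (fobj F 1)) n"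
    define x where "x = enc F n xs"
    have x: "x \<in> car (fobj F n)" "dec F n x = xs" using enc_in[OF F xs] dec_enc[OF F xs] unfolding x_def by auto
    have "map (fn (h 1)) (interp F t xs) = dec M m (fn (h m) (fn (farr F t) x))"
      using dec[OF fn_in[OF functor_hom[OF Ff t] x(1)]] dec_farr[OF F t x(1)] x(2) by simp
    also have "\<dots> = interp M t (dec M n (fn (h n) x))"
      using nat[OF t x(1)] dec_farr[OF M t fn_in[OF hom x(1)]] by simp
    finally show "map (fn (h 1)) (interp F t xs) = interp M t (map (fn (h 1)) xs)"
      using dec[OF x(1)] x(2) by simp
  qed
qed

lemma natural_eqI:
  assumes F: "is_model L D F" and M: "is_model L D M"
    and h: "natural_transformation L D F M h" "natural_transformation L D F M h'"
    and eq: "\<And>x. x \<in> car (fobj F 1) \<Longrightarrow> fn (h 1) x = fn (h' 1) x"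
  shows "h = h'"
proof (rule ext, rule faithful[OF natural_hom[OF F M h(1)] natural_hom[OF F M h(2)]])
  fix n x assume x: "x \<in> car (fobj F n)"
  have "map (fn (h 1)) (dec F n x) = map (fn (h' 1)) (dec F n x)"
    using eq dec_in[OF model_functor[OF F] x] unfolding pw_def by auto
  then show "fn (h n) x = fn (h' n) x"
    using natural_dec[OF F M h(1) x] natural_dec[OF F M h(2) x]
    by (intro dec_inj[OF M fn_in[OF natural_hom[OF F M h(1)] x] fn_in[OF natural_hom[OF F M h(2)] x]]) simp
qed

text \<open>By \<open>natural_dec\<close> the component at \<open>n\<close> must apply
  \<open>k\<close> coordinatewise between decoding and encoding. It is an arrow by
  \<open>lift\<close>: the projections of \<open>M\<close> at \<open>n\<close> are jointly
  injective, and after them it becomes \<open>k\<close> composed with a projection of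
  \<open>F\<close>. Decoding turns naturality into homomorphy of \<open>k\<close>.\<close>

lemma extend_set_hom:
  assumes F: "is_model L D F" and M: "is_model L D M" and k: "k \<in> Hom D (fobj F 1) (fobj M 1)"
    and hom: "set_hom L (car (fobj F 1)) (interp F) (car (fobj M 1)) (interp M) (fn k)"
  shows "\<exists>h. natural_transformation L D F M h \<and> h 1 = k"
proof -
  note Ff = model_functor[OF F] and Mf = model_functor[OF M]
  have "\<exists>u'\<in>Hom D (fobj F n) (fobj M n). \<forall>x\<in>car (fobj F n). fn u' x = enc M n (map (fn k) (dec F n x))" for n
  proof (rule lift[where n = n and p = "\<lambda>i. farr M (Prj L n i)" and Xs = "\<lambda>_. fobj M 1"
        and q = "\<lambda>i. Cmp D k (farr F (Prj L n i))"])
    have map_in: "map (fn k) (dec F n x) \<in> pw (car (fobj M 1)) n" if "x \<in> car (fobj F n)" for x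
      using dec_in[OF Ff that] fn_in[OF k] by (intro pw_map) auto
    show "fobj M n \<in> Obj D" "fobj F n \<in> Obj D" using functor_obj Ff Mf by auto
    show "farr M (Prj L n i) \<in> Hom D (fobj M n) (fobj M 1)" if "i < n" for i
      by (rule functor_hom[OF Mf Prj_Hom[OF that]])
    show "Cmp D k (farr F (Prj L n i)) \<in> Hom D (fobj F n) (fobj M 1)" if "i < n" for i
      by (rule cmp_hom[OF functor_hom[OF Ff Prj_Hom[OF that]] k])
    show "z = z'" if "z \<in> car (fobj M n)" "z' \<in> car (fobj M n)"
      "\<And>i. i < n \<Longrightarrow> fn (farr M (Prj L n i)) z = fn (farr M (Prj L n i)) z'" for z z'
      by (rule dec_inj[OF M that(1,2)]) (simp add: dec_def that(3))
    show "enc M n (map (fn k) (dec F n x)) \<in> car (fobj M n)" if "x \<in> car (fobj F n)" for x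
      by (rule enc_in[OF M map_in[OF that]])
    show "fn (farr M (Prj L n i)) (enc M n (map (fn k) (dec F n x))) = fn (Cmp D k (farr F (Prj L n i))) x"
      if "i < n" "x \<in> car (fobj F n)" for i x
      using arg_cong[OF dec_enc[OF M map_in[OF that(2)]], of "\<lambda>xs. xs ! i"] that(1)
        fn_cmp[OF functor_hom[OF Ff Prj_Hom[OF that(1)]] k that(2)]
      by (simp add: dec_nth)
  qed
  then obtain h where h: "\<And>n. h n \<in> Hom D (fobj F n) (fobj M n)"
    and enc: "\<And>n x. x \<in> car (fobj F n) \<Longrightarrow> fn (h n) x = enc M n (map (fn k) (dec F n x))"
    by metis
  have dec: "dec M n (fn (h n) x) = map (fn k) (dec F n x)" if "x \<in> car (fobj F n)" for n x
    using enc[OF that] dec_enc[OF M pw_map[OF dec_in[OF Ff that]]] fn_in[OF k] by auto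
  have "natural_transformation L D F M h"
    unfolding natural_transformation_def
  proof (intro conjI ballI allI)
    fix n m t assume t: "t \<in> Hom L n m"
    note Ft = functor_hom[OF Ff t] and Mt = functor_hom[OF Mf t]
    show "Cmp D (h m) (farr F t) = Cmp D (farr M t) (h n)"
    proof (rule faithful[OF cmp_hom[OF Ft h] cmp_hom[OF h Mt]])
      fix x assume x: "x \<in> car (fobj F n)"
      have "dec M m (fn (h m) (fn (farr F t) x)) = map (fn k) (interp F t (dec F n x))"
        using dec[OF fn_in[OF Ft x]] dec_farr[OF F t x] by simp
      also have "\<dots> = interp M t (map (fn k) (dec F n x))"
        by (rule set_hom_map[OF hom t dec_in[OF Ff x]])
      also have "\<dots> = dec M m (fn (farr M t) (fn (h n) x))"
        using dec[OF x] dec_farr[OF M t fn_in[OF h x]] by simp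
      finally have "fn (h m) (fn (farr F t) x) = fn (farr M t) (fn (h n) x)"
        by (rule dec_inj[OF M fn_in[OF h fn_in[OF Ft x]] fn_in[OF Mt fn_in[OF h x]]])
      then show "fn (Cmp D (h m) (farr F t)) x = fn (Cmp D (farr M t) (h n)) x"
        by (simp only: fn_cmp[OF Ft h x] fn_cmp[OF h Mt x])
    qed
  qed (use h in auto)
  moreover have "h 1 = k"
  proof (rule faithful[OF h k])
    fix x assume x: "x \<in> car (fobj F 1)"
    have "[fn (h 1) x] = [fn k x]"
      using dec[OF x] dec_1[OF F x] dec_1[OF M fn_in[OF h x]] by simp
    then show "fn (h 1) x = fn k x" by simp
  qed
  ultimately show ?thesis by blast
qed

text \<open>Natural transformations are determined by their component at 1
  (\<open>natural_eqI\<close>) and are obtained from homomorphisms there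
  (\<open>extend_set_hom\<close>), so only functions on the value at 1 matter. Uniqueness is asked
  for arbitrary functions; it can then be settled in the set model, once for both
  categories.\<close>

lemma free_algebraI:
  assumes X: "X \<in> Obj D" and F: "is_model L D F" and \<eta>: "\<eta> \<in> Hom D X (fobj F 1)"
    and unique: "\<And>M k k'. is_model L D M \<Longrightarrow>
      set_hom L (car (fobj F 1)) (interp F) (car (fobj M 1)) (interp M) k \<Longrightarrow>
      set_hom L (car (fobj F 1)) (interp F) (car (fobj M 1)) (interp M) k' \<Longrightarrow>
      (\<And>x. x \<in> car X \<Longrightarrow> k (fn \<eta> x) = k' (fn \<eta> x)) \<Longrightarrow> \<forall>y\<in>car (fobj F 1). k y = k' y"
    and ex: "\<And>M f. is_model L D M \<Longrightarrow> f \<in> Hom D X (fobj M 1) \<Longrightarrow> \<exists>k\<in>Hom D (fobj F 1) (fobj M 1).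
      set_hom L (car (fobj F 1)) (interp F) (car (fobj M 1)) (interp M) (fn k) \<and>
      (\<forall>x\<in>car X. fn k (fn \<eta> x) = fn f x)"
  shows "is_free_algebra L D X F \<eta>"
  unfolding is_free_algebra_def
proof (intro conjI allI impI X F \<eta>)
  fix M f assume "is_model L D M \<and> f \<in> Hom D X (fobj M 1)"
  then have M: "is_model L D M" and f: "f \<in> Hom D X (fobj M 1)" by auto
  obtain k where k: "k \<in> Hom D (fobj F 1) (fobj M 1)"
    "set_hom L (car (fobj F 1)) (interp F) (car (fobj M 1)) (interp M) (fn k)"
    "\<forall>x\<in>car X. fn k (fn \<eta> x) = fn f x"
    using ex[OF M f] by blast
  obtain h where h: "natural_transformation L D F M h" "h 1 = k"
    using extend_set_hom[OF F M k(1,2)] by blast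
  show "\<exists>!h. natural_transformation L D F M h \<and> Cmp D (h 1) \<eta> = f"
  proof (rule ex1I[of _ h], intro conjI h(1))
    show "Cmp D (h 1) \<eta> = f"
      unfolding h(2)
      by (rule faithful[OF cmp_hom[OF \<eta> k(1)] f]) (use k(3) fn_cmp[OF \<eta> k(1)] in auto)
  next
    fix h' assume h': "natural_transformation L D F M h' \<and> Cmp D (h' 1) \<eta> = f"
    then have nat: "natural_transformation L D F M h'" by blast
    have "fn (h' 1) (fn \<eta> x) = fn (h 1) (fn \<eta> x)" if "x \<in> car X" for x
      using fn_cmp[OF \<eta> natural_hom[OF F M nat] that] h' k(3) h(2) that by simp
    then have "\<forall>y\<in>car (fobj F 1). fn (h' 1) y = fn (h 1) y"
      by (rule unique[OF M natural_set_hom[OF F M nat] natural_set_hom[OF F M h(1)]])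
    then show "h' = h" by (intro natural_eqI[OF F M nat h(1)]) blast
  qed
qed

text \<open>The identity of the common value at 1 is a homomorphism in both directions and extends
  to two natural transformations. Their composites act on decoded lists as the identity.\<close>

lemma naturally_isomorphicI:
  assumes F: "is_model L D F" and M: "is_model L D M" and obj: "fobj F 1 = fobj M 1"
    and eq: "\<And>n m t xs. t \<in> Hom L n m \<Longrightarrow> xs \<in> pw (car (fobj F 1)) n \<Longrightarrow> interp F t xs = interp M t xs"
  shows "naturally_isomorphic L D F M"
proof -
  note Ff = model_functor[OF F] and Mf = model_functor[OF M]
  define k where "k = Ide D (fobj F 1)"
  have k: "k \<in> Hom D (fobj F 1) (fobj M 1)" "k \<in> Hom D (fobj M 1) (fobj F 1)"
    using ide_hom[OF functor_obj[OF Ff, of 1]] unfolding k_def obj by auto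
  have fn_k: "fn k x = x" if "x \<in> car (fobj F 1)" for x
    using fn_ide[OF functor_obj[OF Ff] that] unfolding k_def .
  have map_k: "map (fn k) xs = xs" if "xs \<in> pw (car (fobj F 1)) n" for xs n
    using that fn_k unfolding pw_def by (auto intro: map_idI)
  have pw_eq: "pw (car (fobj M 1)) n = pw (car (fobj F 1)) n" for n using obj by simp
  note in_F = set_model_in[OF interp_set_model[OF F]]
  have "set_hom L (car (fobj F 1)) (interp F) (car (fobj M 1)) (interp M) (fn k)"
    unfolding set_hom_def
  proof (intro conjI allI ballI)
    show "fn k \<in> car (fobj F 1) \<rightarrow> car (fobj M 1)" using fn_in[OF k(1)] by blast
    fix n m t xs assume t: "t \<in> Hom L n m" and xs: "xs \<in> pw (car (fobj F 1)) n"
    show "map (fn k) (interp F t xs) = interp M t (map (fn k) xs)"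
      using eq[OF t xs] map_k[OF xs] map_k[OF in_F[OF t xs]] by simp
  qed
  then obtain h where h: "natural_transformation L D F M h" "h 1 = k"
    using extend_set_hom[OF F M k(1)] by blast
  have "set_hom L (car (fobj M 1)) (interp M) (car (fobj F 1)) (interp F) (fn k)"
    unfolding set_hom_def pw_eq
  proof (intro conjI allI ballI)
    show "fn k \<in> car (fobj M 1) \<rightarrow> car (fobj F 1)" using fn_in[OF k(2)] by blast
    fix n m t xs assume t: "t \<in> Hom L n m" and xs: "xs \<in> pw (car (fobj F 1)) n"
    show "map (fn k) (interp M t xs) = interp F t (map (fn k) xs)"
      using eq[OF t xs, symmetric] map_k[OF xs] map_k[OF in_F[OF t xs]] by simp
  qed
  then obtain h' where h': "natural_transformation L D M F h'" "h' 1 = k"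
    using extend_set_hom[OF M F k(2)] by blast
  have "is_iso D (h n)" for n
  proof -
    note hn = natural_hom[OF F M h(1), of n] and hn' = natural_hom[OF M F h'(1), of n]
    have "Cmp D (h' n) (h n) = Ide D (fobj F n)"
    proof (rule faithful[OF cmp_hom[OF hn hn'] ide_hom[OF functor_obj[OF Ff]]])
      fix x assume x: "x \<in> car (fobj F n)"
      have "dec F n (fn (h' n) (fn (h n) x)) = map (fn k) (map (fn k) (dec F n x))"
        using natural_dec[OF M F h'(1) fn_in[OF hn x]] natural_dec[OF F M h(1) x] h(2) h'(2) by simp
      then have "fn (h' n) (fn (h n) x) = x"
        using dec_inj[OF F fn_in[OF hn' fn_in[OF hn x]] x] map_k[OF dec_in[OF Ff x]] by simp
      then show "fn (Cmp D (h' n) (h n)) x = fn (Ide D (fobj F n)) x"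
        by (simp only: fn_cmp[OF hn hn' x] fn_ide[OF functor_obj[OF Ff] x])
    qed
    moreover have "Cmp D (h n) (h' n) = Ide D (fobj M n)"
    proof (rule faithful[OF cmp_hom[OF hn' hn] ide_hom[OF functor_obj[OF Mf]]])
      fix x assume x: "x \<in> car (fobj M n)"
      have "dec M n (fn (h n) (fn (h' n) x)) = map (fn k) (map (fn k) (dec M n x))"
        using natural_dec[OF F M h(1) fn_in[OF hn' x]] natural_dec[OF M F h'(1) x] h(2) h'(2) by simp
      moreover have "map (fn k) (dec M n x) = dec M n x"
        using map_k[of "dec M n x" n] dec_in[OF Mf x] obj by simp
      ultimately have "dec M n (fn (h n) (fn (h' n) x)) = dec M n x" by (simp only:)
      then have "fn (h n) (fn (h' n) x) = x" by (rule dec_inj[OF M fn_in[OF hn fn_in[OF hn' x]] x])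
      then show "fn (Cmp D (h n) (h' n)) x = fn (Ide D (fobj M n)) x"
        by (simp only: fn_cmp[OF hn' hn x] fn_ide[OF functor_obj[OF Mf] x])
    qed
    ultimately show ?thesis using hn hn' unfolding is_iso_def Hom_def by auto
  qed
  then show ?thesis using h(1) unfolding naturally_isomorphic_def by blast
qed

text \<open>The family \<open>a\<close> is meant to be an automorphism acting on all values of the
  model: by \<open>moved \<pi>\<close> in \<open>ZFA\<close>, by the action on each value in
  \<open>Cont\<close>. Compatibility with the projections makes \<open>a n\<close>, after decoding,
  the coordinatewise application of \<open>a 1\<close>.\<close>

lemma interp_commute:
  assumes M: "is_model L D M" and t: "t \<in> Hom L n m"
    and a_in: "\<And>x. x \<in> car (fobj M n) \<Longrightarrow> a n x \<in> car (fobj M n)"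
    and n: "\<And>i x. i < n \<Longrightarrow> x \<in> car (fobj M n) \<Longrightarrow>
      fn (farr M (Prj L n i)) (a n x) = a 1 (fn (farr M (Prj L n i)) x)"
    and m: "\<And>i x. i < m \<Longrightarrow> x \<in> car (fobj M m) \<Longrightarrow>
      fn (farr M (Prj L m i)) (a m x) = a 1 (fn (farr M (Prj L m i)) x)"
    and a: "\<And>x. x \<in> car (fobj M n) \<Longrightarrow> fn (farr M t) (a n x) = a m (fn (farr M t) x)"
    and xs: "xs \<in> pw (car (fobj M 1)) n"
  shows "interp M t (map (a 1) xs) = map (a 1) (interp M t xs)"
proof -
  define x where "x = enc M n xs"
  have x: "x \<in> car (fobj M n)" "dec M n x = xs" using enc_in[OF M xs] dec_enc[OF M xs] unfolding x_def by auto
  have tx: "fn (farr M t) x \<in> car (fobj M m)"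
    using fn_in[OF functor_hom[OF model_functor[OF M] t] x(1)] .
  have "dec M n (a n x) = map (a 1) (dec M n x)" "dec M m (a m (fn (farr M t) x)) = map (a 1) (dec M m (fn (farr M t) x))"
    using n[OF _ x(1)] m[OF _ tx] by (auto simp: dec_def)
  then show ?thesis
    using dec_farr[OF M t x(1)] dec_farr[OF M t a_in[OF x(1)]] x(2) a[OF x(1)] by simp
qed

end

section \<open>Free set models\<close>

text \<open>Syntax for the closure \<open>generated_by\<close>. A tuple records its domain
  explicitly, since the empty list of components does not determine it.\<close>

datatype 'a arrow_term = Basic 'a | Proj nat nat | Comp "'a arrow_term" "'a arrow_term" | Tup nat "'a arrow_term list"

instance arrow_term :: (countable) countable
  by countable_datatype

context lawvere_theory_loc
begin

primrec arrow_of :: "('a \<Rightarrow> 'l) \<Rightarrow> 'a arrow_term \<Rightarrow> 'l" where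
  "arrow_of \<omega> (Basic a) = \<omega> a"
| "arrow_of \<omega> (Proj n i) = Prj L n i"
| "arrow_of \<omega> (Comp s t) = Cmp L (arrow_of \<omega> s) (arrow_of \<omega> t)"
| "arrow_of \<omega> (Tup k ts) =
    (THE h. h \<in> Hom L k (length ts) \<and> (\<forall>i<length ts. Cmp L (Prj L (length ts) i) h = map (arrow_of \<omega>) ts ! i))"

text \<open>Every arrow is denoted by a term over the generators. Countability is what allows arrows
  to be numbered by sets of the hierarchy.\<close>

lemma countable_Arr:
  assumes "finitely_many_operations L"
  shows "countable (Arr L)"
proof -
  obtain \<Omega> where \<Omega>: "finite \<Omega>" "generated_by L \<Omega> = Arr L"
    using assms unfolding finitely_many_operations_def by blast
  \<comment> \<open>Natural numbers name the generators, so the terms form a countable type whatever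
    the type of arrows is.\<close>
  define \<omega> where "\<omega> = from_nat_into \<Omega>"
  have "t \<in> range (arrow_of \<omega>)" if "t \<in> generated_by L \<Omega>" for t
    using that
  proof induction
    case (basic f)
    then obtain n where "\<omega> n = f"
      unfolding \<omega>_def using from_nat_into_surj[OF countable_finite[OF \<Omega>(1)]] by blast
    then have "arrow_of \<omega> (Basic n) = f" by simp
    then show ?case by (metis rangeI)
  next
    case (projection i n)
    have "arrow_of \<omega> (Proj n i) = Prj L n i" by simp
    then show ?case by (metis rangeI)
  next
    case (composition f g)
    then obtain s t where "arrow_of \<omega> s = f" "arrow_of \<omega> t = g" by auto
    then have "arrow_of \<omega> (Comp t s) = Cmp L g f" by simp
    then show ?case by (metis rangeI)
  next
    case (tuple h)
    define m where "m = Cod L h"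
    have h: "h \<in> Hom L (Dom L h) m" using tuple.hyps(1) unfolding Hom_def m_def by simp
    have "\<forall>i. \<exists>s. i < m \<longrightarrow> arrow_of \<omega> s = Cmp L (Prj L m i) h"
      using tuple.IH unfolding m_def by (metis imageE)
    then obtain s where s: "\<And>i. i < m \<Longrightarrow> arrow_of \<omega> (s i) = Cmp L (Prj L m i) h" by metis
    define ts where "ts = map s [0..<m]"
    have ts: "length ts = m" "\<And>i. i < m \<Longrightarrow> map (arrow_of \<omega>) ts ! i = Cmp L (Prj L m i) h"
      using s unfolding ts_def by auto
    have "arrow_of \<omega> (Tup (Dom L h) ts) = h"
      unfolding arrow_of.simps ts(1)
    proof (rule the_equality)
      show "h \<in> Hom L (Dom L h) m \<and> (\<forall>i<m. Cmp L (Prj L m i) h = map (arrow_of \<omega>) ts ! i)"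
        using h ts(2) by simp
      fix g assume "g \<in> Hom L (Dom L h) m \<and> (\<forall>i<m. Cmp L (Prj L m i) g = map (arrow_of \<omega>) ts ! i)"
      then show "g = h" using ts(2) by (intro Hom_eqI[OF _ h]) auto
    qed
    then show ?case by (metis rangeI)
  qed
  then have "Arr L \<subseteq> range (arrow_of \<omega>)" using \<Omega>(2) by blast
  then show ?thesis by (rule countable_subset) simp
qed

end

text \<open>
  The free model on \<open>X\<close> consists of formal expressions \<open>(f, xs)\<close>, an arrow \<open>f : n \<rightarrow> 1\<close> and a list of
  \<open>n\<close> elements of \<open>X\<close>, identified if they have the same value in all set models. This makes
  well-definedness of the operations and the universal property immediate. The function \<open>E\<close> encodes
  the equivalence classes as elements of the given universe.
\<close>

locale free_set_model = lawvere_theory_loc L for L :: "'l lawvere" +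
  fixes X :: "'v set" and E :: "('l \<times> 'v list) set \<Rightarrow> 'v"
  assumes E_inj: "inj_on E (Pow {(f, xs). \<exists>n. f \<in> Hom L n 1 \<and> xs \<in> pw X n})"
begin

text \<open>The carriers range over all subsets of \<open>'v\<close>. This covers the values at 1 of
  the models in both categories, and the free algebra itself.\<close>

definition same_value :: "'l \<Rightarrow> 'v list \<Rightarrow> 'l \<Rightarrow> 'v list \<Rightarrow> bool" where
  "same_value f xs g ys \<longleftrightarrow>
     (\<forall>C I (\<phi> :: 'v \<Rightarrow> 'v). set_model L C I \<and> \<phi> \<in> X \<rightarrow> C \<longrightarrow> I f (map \<phi> xs) = I g (map \<phi> ys))"

definition expr_class :: "'l \<Rightarrow> 'v list \<Rightarrow> ('l \<times> 'v list) set" where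
  "expr_class f xs = {(g, ys). (\<exists>n. g \<in> Hom L n 1 \<and> ys \<in> pw X n) \<and> same_value f xs g ys}"

definition expr :: "'l \<Rightarrow> 'v list \<Rightarrow> 'v" where
  "expr f xs = E (expr_class f xs)"

definition T :: "'v set" where
  "T = {expr f xs |f xs n. f \<in> Hom L n 1 \<and> xs \<in> pw X n}"

definition eta :: "'v \<Rightarrow> 'v" where
  "eta x = expr (Ide L 1) [x]"

text \<open>The choice is among the values of all representatives of \<open>u\<close>, which
  coincide by \<open>expr_eqD\<close>.\<close>

definition value_of :: "('l \<Rightarrow> 'v list \<Rightarrow> 'v list) \<Rightarrow> ('v \<Rightarrow> 'v) \<Rightarrow> 'v \<Rightarrow> 'v" where
  "value_of I \<phi> u = (SOME v. \<exists>f xs n. f \<in> Hom L n 1 \<and> xs \<in> pw X n \<and> u = expr f xs \<and> v = hd (I f (map \<phi> xs)))"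

text \<open>The operation is specified by its values in all models instead of by representatives:
  existence is \<open>IT_ex\<close>, uniqueness is \<open>T_list_eqI\<close>. Compatibility with any
  evaluation is thereby built in.\<close>

definition IT :: "'l \<Rightarrow> 'v list \<Rightarrow> 'v list" where
  "IT t us = (SOME ws. ws \<in> pw T (Cod L t) \<and>
     (\<forall>C I \<phi>. set_model L C I \<and> \<phi> \<in> X \<rightarrow> C \<longrightarrow> map (value_of I \<phi>) ws = I t (map (value_of I \<phi>) us)))"

section \<open>Evaluation of expressions and operations on their classes\<close>

lemma expr_eqD:
  assumes "f \<in> Hom L n 1" "xs \<in> pw X n" "g \<in> Hom L m 1" "ys \<in> pw X m" "expr f xs = expr g ys"
  shows "same_value f xs g ys"
proof -
  have "expr_class f xs = expr_class g ys"
    by (rule inj_onD[OF E_inj]) (use assms(5) in \<open>auto simp: expr_def expr_class_def\<close>)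
  moreover have "(g, ys) \<in> expr_class g ys"
    using assms unfolding expr_class_def same_value_def by auto
  ultimately show ?thesis unfolding expr_class_def by auto
qed

lemma expr_eqI: "same_value f xs g ys \<Longrightarrow> expr f xs = expr g ys"
proof -
  assume "same_value f xs g ys"
  then have "same_value f xs h zs \<longleftrightarrow> same_value g ys h zs" for h zs
    unfolding same_value_def by metis
  then show ?thesis unfolding expr_def expr_class_def by simp
qed

text \<open>A valuation \<open>\<phi>\<close> is replaced by \<open>\<phi> \<circ> a\<close>.
  Automorphisms thus respect the identification of expressions.\<close>

lemma same_value_transport:
  assumes a: "a \<in> X \<rightarrow> X" and same: "same_value f xs g ys"
  shows "same_value f (map a xs) g (map a ys)"
  unfolding same_value_def
proof (intro allI impI)
  fix C :: "'v set" and I and \<phi> :: "'v \<Rightarrow> 'v" assume *: "set_model L C I \<and> \<phi> \<in> X \<rightarrow> C"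
  then have "\<phi> \<circ> a \<in> X \<rightarrow> C" using a by auto
  then have "I f (map (\<phi> \<circ> a) xs) = I g (map (\<phi> \<circ> a) ys)" using same * unfolding same_value_def by blast
  then show "I f (map \<phi> (map a xs)) = I g (map \<phi> (map a ys))" by simp
qed

lemma expr_in: "f \<in> Hom L n 1 \<Longrightarrow> xs \<in> pw X n \<Longrightarrow> expr f xs \<in> T"
  unfolding T_def by blast

lemma T_cases:
  assumes "u \<in> T"
  obtains f xs n where "f \<in> Hom L n 1" "xs \<in> pw X n" "u = expr f xs"
  using assms unfolding T_def by blast

lemma value_of_expr:
  assumes "set_model L C I" "\<phi> \<in> X \<rightarrow> C" "f \<in> Hom L n 1" "xs \<in> pw X n"
  shows "value_of I \<phi> (expr f xs) = hd (I f (map \<phi> xs))"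
  unfolding value_of_def
proof (rule someI2_ex)
  fix v assume "\<exists>g ys n. g \<in> Hom L n 1 \<and> ys \<in> pw X n \<and> expr f xs = expr g ys \<and> v = hd (I g (map \<phi> ys))"
  then obtain g ys m where "g \<in> Hom L m 1" "ys \<in> pw X m" "expr f xs = expr g ys" "v = hd (I g (map \<phi> ys))"
    by blast
  then show "v = hd (I f (map \<phi> xs))"
    using expr_eqD[OF assms(3,4)] assms(1,2) unfolding same_value_def by metis
qed (use assms in blast)

lemma value_of_expr_single:
  assumes "set_model L C I" "\<phi> \<in> X \<rightarrow> C" "f \<in> Hom L n 1" "xs \<in> pw X n"
  shows "I f (map \<phi> xs) = [value_of I \<phi> (expr f xs)]"
  using set_model_in[OF assms(1,3) pw_map[OF assms(4,2)]] value_of_expr[OF assms] by (auto simp: pw_1)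

lemma value_of_in:
  assumes "set_model L C I" "\<phi> \<in> X \<rightarrow> C"
  shows "value_of I \<phi> \<in> T \<rightarrow> C"
proof
  fix u assume "u \<in> T"
  then obtain f xs n where *: "f \<in> Hom L n 1" "xs \<in> pw X n" "u = expr f xs" by (rule T_cases)
  show "value_of I \<phi> u \<in> C"
    using set_model_in[OF assms(1) *(1) pw_map[OF *(2) assms(2)]] value_of_expr_single[OF assms *(1,2)] *(3)
    by (auto simp: pw_1)
qed

text \<open>Classes are separated by their values because they were formed by equality of values.
  Every law in \<open>T\<close> can therefore be tested in the models, where it holds by
  assumption.\<close>

lemma T_eqI:
  assumes "u \<in> T" "v \<in> T"
    and eq: "\<And>C I \<phi>. set_model L C I \<Longrightarrow> \<phi> \<in> X \<rightarrow> C \<Longrightarrow> value_of I \<phi> u = value_of I \<phi> v"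
  shows "u = v"
proof -
  obtain f xs n where f: "f \<in> Hom L n 1" "xs \<in> pw X n" "u = expr f xs" using assms(1) by (rule T_cases)
  obtain g ys m where g: "g \<in> Hom L m 1" "ys \<in> pw X m" "v = expr g ys" using assms(2) by (rule T_cases)
  have "same_value f xs g ys"
    unfolding same_value_def
  proof (intro allI impI)
    fix C I and \<phi> :: "'v \<Rightarrow> 'v" assume "set_model L C I \<and> \<phi> \<in> X \<rightarrow> C"
    then have *: "set_model L C I" "\<phi> \<in> X \<rightarrow> C" by auto
    show "I f (map \<phi> xs) = I g (map \<phi> ys)"
      using value_of_expr_single[OF * f(1,2)] value_of_expr_single[OF * g(1,2)] eq[OF *] f(3) g(3) by simp
  qed
  then show ?thesis using expr_eqI f(3) g(3) by simp
qed

lemma T_list_eqI: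
  assumes us: "us \<in> pw T n" and vs: "vs \<in> pw T n"
    and eq: "\<And>C I \<phi>. set_model L C I \<Longrightarrow> \<phi> \<in> X \<rightarrow> C \<Longrightarrow> map (value_of I \<phi>) us = map (value_of I \<phi>) vs"
  shows "us = vs"
proof (rule nth_equalityI)
  show len: "length us = length vs" using us vs unfolding pw_def by simp
  fix i assume i: "i < length us"
  show "us ! i = vs ! i"
  proof (rule T_eqI)
    show "us ! i \<in> T" "vs ! i \<in> T" using pw_nth[OF us] pw_nth[OF vs] i us unfolding pw_def by auto
    fix C :: "'v set" and I \<phi> assume *: "set_model L C I" "\<phi> \<in> X \<rightarrow> C"
    show "value_of I \<phi> (us ! i) = value_of I \<phi> (vs ! i)"
      using arg_cong[OF eq[OF *], of "\<lambda>ws. ws ! i"] i len by simp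
  qed
qed

text \<open>Substitution of expressions. Each argument is an arrow applied to variables of its own;
  the variables are merged into one list \<open>zs\<close>, over which a single arrow
  \<open>w\<close> represents all arguments, and the components of \<open>t\<close> after
  \<open>w\<close> represent the results.\<close>

lemma IT_ex:
  assumes t: "t \<in> Hom L n m" and us: "us \<in> pw T n"
  shows "\<exists>ws. ws \<in> pw T m \<and>
     (\<forall>C I \<phi>. set_model L C I \<and> \<phi> \<in> X \<rightarrow> C \<longrightarrow> map (value_of I \<phi>) ws = I t (map (value_of I \<phi>) us))"
proof -
  have "\<forall>i. \<exists>f xs k. i < n \<longrightarrow> f \<in> Hom L k 1 \<and> xs \<in> pw X k \<and> us ! i = expr f xs"
    using pw_nth[OF us] by (metis T_cases)
  then obtain f xs k where f: "\<And>i. i < n \<Longrightarrow> f i \<in> Hom L (k i) 1"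
    and xs: "\<And>i. i < n \<Longrightarrow> xs i \<in> pw X (k i)" and u: "\<And>i. i < n \<Longrightarrow> us ! i = expr (f i) (xs i)"
    by metis
  define zs where "zs = concat (map xs [0..<n])"
  define N where "N = length zs"
  have zs: "zs \<in> pw X N" using xs unfolding zs_def N_def pw_def by fastforce
  \<comment> \<open>A place of variable \<open>j\<close> of argument \<open>i\<close> in the merged
    list. Several places may carry the same element, and any of them will do.\<close>
  have "\<forall>i j. \<exists>p. i < n \<and> j < k i \<longrightarrow> p < N \<and> zs ! p = xs i ! j"
  proof (intro allI)
    fix i j
    have "xs i ! j \<in> set zs" if "i < n \<and> j < k i"
    proof -
      have "xs i ! j \<in> set (xs i)" using xs[of i] that unfolding pw_def by simp
      then show ?thesis using that unfolding zs_def by auto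
    qed
    then show "\<exists>p. i < n \<and> j < k i \<longrightarrow> p < N \<and> zs ! p = xs i ! j"
      unfolding in_set_conv_nth N_def by blast
  qed
  then obtain p where p: "\<And>i j. i < n \<Longrightarrow> j < k i \<Longrightarrow> p i j < N \<and> zs ! p i j = xs i ! j" by metis
  \<comment> \<open>Reindexing of variables: \<open>r i\<close> recovers the list of argument
    \<open>i\<close> from the merged one, so \<open>f i\<close> after \<open>r i\<close> is that
    argument over \<open>zs\<close>.\<close>
  have "\<forall>i. \<exists>r. i < n \<longrightarrow> r \<in> Hom L N (k i) \<and> (\<forall>j<k i. Cmp L (Prj L (k i) j) r = Prj L N (p i j))"
  proof
    fix i
    have "\<exists>!r. r \<in> Hom L N (k i) \<and> (\<forall>j<k i. Cmp L (Prj L (k i) j) r = Prj L N (p i j))" if "i < n"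
      by (rule tuple_ex1) (use p[OF that] Prj_Hom in blast)
    then show "\<exists>r. i < n \<longrightarrow> r \<in> Hom L N (k i) \<and> (\<forall>j<k i. Cmp L (Prj L (k i) j) r = Prj L N (p i j))"
      by blast
  qed
  then obtain r where r: "\<And>i. i < n \<Longrightarrow> r i \<in> Hom L N (k i)"
    "\<And>i j. i < n \<Longrightarrow> j < k i \<Longrightarrow> Cmp L (Prj L (k i) j) (r i) = Prj L N (p i j)"
    by metis
  have fr: "Cmp L (f i) (r i) \<in> Hom L N 1" if "i < n" for i
    by (rule Cmp_Hom[OF r(1)[OF that] f[OF that]])
  have "\<exists>!w. w \<in> Hom L N n \<and> (\<forall>i<n. Cmp L (Prj L n i) w = Cmp L (f i) (r i))"
    by (rule tuple_ex1) (fact fr)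
  then obtain w where w: "w \<in> Hom L N n" "\<And>i. i < n \<Longrightarrow> Cmp L (Prj L n i) w = Cmp L (f i) (r i)" by blast
  note tw = Cmp_Hom[OF w(1) t]
  have ptw: "Cmp L (Prj L m j) (Cmp L t w) \<in> Hom L N 1" if "j < m" for j
    by (rule Cmp_Hom[OF tw Prj_Hom[OF that]])
  define ws where "ws = map (\<lambda>j. expr (Cmp L (Prj L m j) (Cmp L t w)) zs) [0..<m]"
  have "ws \<in> pw T m" unfolding ws_def by (rule pw_map_upt) (rule expr_in[OF ptw zs])
  moreover have "map (value_of I \<phi>) ws = I t (map (value_of I \<phi>) us)"
    if I: "set_model L C I" and \<phi>: "\<phi> \<in> X \<rightarrow> C" for C I \<phi>
  proof -
    note zs' = pw_map[OF zs \<phi>]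
    have ri: "I (r i) (map \<phi> zs) = map \<phi> (xs i)" if i: "i < n" for i
    proof (rule nth_equalityI)
      have len: "length (I (r i) (map \<phi> zs)) = k i"
        using set_model_in[OF I r(1)[OF i] zs'] unfolding pw_def by simp
      show "length (I (r i) (map \<phi> zs)) = length (map \<phi> (xs i))" using len xs[OF i] unfolding pw_def by simp
      fix j assume "j < length (I (r i) (map \<phi> zs))"
      then have j: "j < k i" using len by simp
      have "[I (r i) (map \<phi> zs) ! j] = I (Prj L N (p i j)) (map \<phi> zs)"
        using set_model_component[OF I r(1)[OF i] zs' j] r(2)[OF i j] by simp
      then show "I (r i) (map \<phi> zs) ! j = map \<phi> (xs i) ! j"
        using set_model_Prj[OF I _ zs', of "p i j"] p[OF i j] j xs[OF i] by (simp add: pw_def N_def)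
    qed
    have wz: "I w (map \<phi> zs) = map (value_of I \<phi>) us"
    proof (rule nth_equalityI)
      have len: "length (I w (map \<phi> zs)) = n"
        using set_model_in[OF I w(1) zs'] unfolding pw_def by simp
      then show "length (I w (map \<phi> zs)) = length (map (value_of I \<phi>) us)"
        using us unfolding pw_def by simp
      fix i assume "i < length (I w (map \<phi> zs))"
      then have i: "i < n" using len by simp
      have "[I w (map \<phi> zs) ! i] = I (f i) (I (r i) (map \<phi> zs))"
        using set_model_component[OF I w(1) zs' i] w(2)[OF i] set_model_Cmp[OF I r(1)[OF i] f[OF i] zs'] by simp
      also have "\<dots> = [value_of I \<phi> (us ! i)]"
        using ri[OF i] value_of_expr_single[OF I \<phi> f[OF i] xs[OF i]] u[OF i] by simp
      finally show "I w (map \<phi> zs) ! i = map (value_of I \<phi>) us ! i"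
        using i us by (simp add: pw_def)
    qed
    show ?thesis
    proof (rule nth_equalityI)
      have tz: "I (Cmp L t w) (map \<phi> zs) = I t (map (value_of I \<phi>) us)"
        using set_model_Cmp[OF I w(1) t zs'] wz by simp
      then have len: "length (I t (map (value_of I \<phi>) us)) = m"
        using set_model_in[OF I tw zs'] unfolding pw_def by simp
      then show "length (map (value_of I \<phi>) ws) = length (I t (map (value_of I \<phi>) us))"
        unfolding ws_def by simp
      fix j assume "j < length (map (value_of I \<phi>) ws)"
      then have j: "j < m" unfolding ws_def by simp
      have "[value_of I \<phi> (ws ! j)] = I (Cmp L (Prj L m j) (Cmp L t w)) (map \<phi> zs)"
        using value_of_expr_single[OF I \<phi> ptw[OF j] zs] j unfolding ws_def by simp
      also have "\<dots> = [I t (map (value_of I \<phi>) us) ! j]"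
        using set_model_component[OF I tw zs' j] tz by simp
      finally show "map (value_of I \<phi>) ws ! j = I t (map (value_of I \<phi>) us) ! j"
        using j unfolding ws_def by simp
    qed
  qed
  ultimately show ?thesis by blast
qed

lemma
  assumes t: "t \<in> Hom L n m" and us: "us \<in> pw T n"
  shows IT_in: "IT t us \<in> pw T m"
    and value_of_IT: "set_model L C I \<Longrightarrow> \<phi> \<in> X \<rightarrow> C \<Longrightarrow>
      map (value_of I \<phi>) (IT t us) = I t (map (value_of I \<phi>) us)"
proof -
  have "Cod L t = m" using t unfolding Hom_def by simp
  then have "IT t us \<in> pw T m \<and> (\<forall>C I \<phi>. set_model L C I \<and> \<phi> \<in> X \<rightarrow> C \<longrightarrow>
      map (value_of I \<phi>) (IT t us) = I t (map (value_of I \<phi>) us))"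
    using someI_ex[OF IT_ex[OF t us]] unfolding IT_def by simp
  then show "IT t us \<in> pw T m" "set_model L C I \<Longrightarrow> \<phi> \<in> X \<rightarrow> C \<Longrightarrow>
      map (value_of I \<phi>) (IT t us) = I t (map (value_of I \<phi>) us)" by blast+
qed

lemma set_model_IT: "set_model L T IT"
  unfolding set_model_def
proof (intro conjI allI ballI impI)
  fix n m t us assume t: "t \<in> Hom L n m" and us: "us \<in> pw T n"
  show tus: "IT t us \<in> pw T m" by (rule IT_in[OF t us])
  fix k s assume s: "s \<in> Hom L m k"
  note st = Cmp_Hom[OF t s]
  show "IT (Cmp L s t) us = IT s (IT t us)"
  proof (rule T_list_eqI[OF IT_in[OF st us] IT_in[OF s tus]])
    fix C :: "'v set" and I \<phi> assume *: "set_model L C I" "\<phi> \<in> X \<rightarrow> C"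
    show "map (value_of I \<phi>) (IT (Cmp L s t) us) = map (value_of I \<phi>) (IT s (IT t us))"
      using set_model_Cmp[OF *(1) t s pw_map[OF us value_of_in[OF *]]]
      by (simp only: value_of_IT[OF st us *] value_of_IT[OF s tus *] value_of_IT[OF t us *])
  qed
next
  fix n us assume us: "us \<in> pw T n"
  show "IT (Ide L n) us = us"
  proof (rule T_list_eqI[OF IT_in[OF Ide_Hom us] us])
    fix C :: "'v set" and I \<phi> assume *: "set_model L C I" "\<phi> \<in> X \<rightarrow> C"
    show "map (value_of I \<phi>) (IT (Ide L n) us) = map (value_of I \<phi>) us"
      using set_model_Ide[OF *(1) pw_map[OF us value_of_in[OF *]]]
      by (simp only: value_of_IT[OF Ide_Hom us *])
  qed
  fix i assume i: "i < n"
  show "IT (Prj L n i) us = [us ! i]"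
  proof (rule T_list_eqI[OF IT_in[OF Prj_Hom[OF i] us]])
    show "[us ! i] \<in> pw T 1" using pw_nth[OF us i] unfolding pw_def by simp
    fix C :: "'v set" and I \<phi> assume *: "set_model L C I" "\<phi> \<in> X \<rightarrow> C"
    show "map (value_of I \<phi>) (IT (Prj L n i) us) = map (value_of I \<phi>) [us ! i]"
      using set_model_Prj[OF *(1) i pw_map[OF us value_of_in[OF *]]] us i
      by (simp add: value_of_IT[OF Prj_Hom[OF i] us *] pw_def)
  qed
qed

lemma set_hom_value_of:
  assumes "set_model L C I" "\<phi> \<in> X \<rightarrow> C"
  shows "set_hom L T IT C I (value_of I \<phi>)"
  unfolding set_hom_def using value_of_in[OF assms] value_of_IT[OF _ _ assms] by blast

lemma single_in: "x \<in> X \<Longrightarrow> [x] \<in> pw X 1"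
  unfolding pw_def by simp

lemma eta_in: "eta \<in> X \<rightarrow> T"
  using expr_in[OF Ide_Hom single_in] unfolding eta_def by blast

lemma value_of_eta:
  assumes "set_model L C I" "\<phi> \<in> X \<rightarrow> C" "x \<in> X"
  shows "value_of I \<phi> (eta x) = \<phi> x"
  using value_of_expr[OF assms(1,2) Ide_Hom single_in[OF assms(3)]]
    set_model_Ide[OF assms(1) pw_map[OF single_in[OF assms(3)] assms(2)]]
  unfolding eta_def by simp

text \<open>Every element of \<open>T\<close> is an operation applied to generators, which is why a
  homomorphism out of \<open>T\<close> is determined on them.\<close>

lemma expr_eq_IT:
  assumes f: "f \<in> Hom L n 1" and xs: "xs \<in> pw X n"
  shows "[expr f xs] = IT f (map eta xs)"
proof (rule T_list_eqI)
  note exs = pw_map[OF xs eta_in]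
  show "[expr f xs] \<in> pw T 1" using expr_in[OF f xs] unfolding pw_def by simp
  show "IT f (map eta xs) \<in> pw T 1" by (rule IT_in[OF f exs])
  fix C :: "'v set" and I \<phi> assume *: "set_model L C I" "\<phi> \<in> X \<rightarrow> C"
  have "map (value_of I \<phi>) (map eta xs) = map \<phi> xs"
    using value_of_eta[OF *] xs unfolding pw_def by auto
  then show "map (value_of I \<phi>) [expr f xs] = map (value_of I \<phi>) (IT f (map eta xs))"
    unfolding value_of_IT[OF f exs *] using value_of_expr_single[OF * f xs] by (simp del: map_map)
qed

lemma set_hom_unique:
  assumes k: "set_hom L T IT C I k" and k': "set_hom L T IT C I k'"
    and eq: "\<And>x. x \<in> X \<Longrightarrow> k (eta x) = k' (eta x)"
  shows "\<forall>u\<in>T. k u = k' u"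
proof
  fix u assume "u \<in> T"
  then obtain f xs n where *: "f \<in> Hom L n 1" "xs \<in> pw X n" "u = expr f xs" by (rule T_cases)
  note exs = pw_map[OF *(2) eta_in]
  have "map k (map eta xs) = map k' (map eta xs)"
    using eq *(2) unfolding pw_def by auto
  then have "map k [u] = map k' [u]"
    unfolding *(3) expr_eq_IT[OF *(1,2)] set_hom_map[OF k *(1) exs] set_hom_map[OF k' *(1) exs] by (simp only:)
  then show "k u = k' u" by simp
qed

text \<open>Evaluating a transported class under \<open>\<phi>\<close> is evaluating the class
  itself under \<open>\<phi> \<circ> a\<close>, and \<open>IT\<close> is specified by all valuations
  at once; hence \<open>b\<close> commutes with it. In the application both \<open>a\<close> and
  \<open>b\<close> are \<open>moved \<pi>\<close>.\<close>

lemma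
  assumes a: "a \<in> X \<rightarrow> X"
    and b: "\<And>f xs n. f \<in> Hom L n 1 \<Longrightarrow> xs \<in> pw X n \<Longrightarrow> b (expr f xs) = expr f (map a xs)"
  shows transport_in: "b \<in> T \<rightarrow> T"
    and IT_transport: "t \<in> Hom L n m \<Longrightarrow> us \<in> pw T n \<Longrightarrow> IT t (map b us) = map b (IT t us)"
    and eta_transport: "x \<in> X \<Longrightarrow> b (eta x) = eta (a x)"
proof -
  show b_in: "b \<in> T \<rightarrow> T"
  proof
    fix u assume "u \<in> T"
    then obtain f xs n where *: "f \<in> Hom L n 1" "xs \<in> pw X n" "u = expr f xs" by (rule T_cases)
    then show "b u \<in> T" using b[OF *(1,2)] expr_in[OF *(1) pw_map[OF *(2) a]] by simp
  qed
  have val: "value_of I \<phi> (b u) = value_of I (\<phi> \<circ> a) u"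
    if I: "set_model L C I" and \<phi>: "\<phi> \<in> X \<rightarrow> C" and u: "u \<in> T" for C I \<phi> u
  proof -
    obtain f xs n where *: "f \<in> Hom L n 1" "xs \<in> pw X n" "u = expr f xs" using u by (rule T_cases)
    have "\<phi> \<circ> a \<in> X \<rightarrow> C" using a \<phi> by auto
    then show ?thesis
      using value_of_expr[OF I \<phi> *(1) pw_map[OF *(2) a]] value_of_expr[OF I _ *(1,2), of "\<phi> \<circ> a"] b[OF *(1,2)] *(3)
      by simp
  qed
  show "IT t (map b us) = map b (IT t us)" if t: "t \<in> Hom L n m" and us: "us \<in> pw T n"
  proof (rule T_list_eqI)
    note bus = pw_map[OF us b_in] and tus = IT_in[OF t us]
    show "IT t (map b us) \<in> pw T m" by (rule IT_in[OF t bus])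
    show "map b (IT t us) \<in> pw T m" by (rule pw_map[OF tus b_in])
    fix C :: "'v set" and I \<phi> assume *: "set_model L C I" "\<phi> \<in> X \<rightarrow> C"
    have \<phi>a: "\<phi> \<circ> a \<in> X \<rightarrow> C" using a *(2) by auto
    have map_b: "map (value_of I \<phi>) (map b vs) = map (value_of I (\<phi> \<circ> a)) vs" if "vs \<in> pw T k" for vs k
      using val[OF *] that unfolding pw_def by auto
    show "map (value_of I \<phi>) (IT t (map b us)) = map (value_of I \<phi>) (map b (IT t us))"
      unfolding value_of_IT[OF t bus *] map_b[OF us] map_b[OF tus] value_of_IT[OF t us *(1) \<phi>a] ..
  qed
  show "b (eta x) = eta (a x)" if "x \<in> X"
    using b[OF Ide_Hom single_in[OF that]] unfolding eta_def by simp
qed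

end

section \<open>Sets with atoms and finite supports\<close>

context cumulative_hierarchy
begin

abbreviation "set_of \<equiv> vset A elts"
abbreviation "pair \<equiv> vpair A elts"
abbreviation "moved \<equiv> act A elts"

text \<open>The whole type plays the role of a proper class; \<open>set_of S\<close> is a set with
  members \<open>S\<close> only if \<open>S\<close> is small.\<close>

definition small :: "'v set \<Rightarrow> bool" where
  "small S \<longleftrightarrow> (\<exists>x. x \<notin> A \<and> elts x = S)"

lemma small_elts: "x \<notin> A \<Longrightarrow> small (elts x)"
  unfolding small_def by blast

lemma small_iff_V: "small S \<longleftrightarrow> (\<exists>\<alpha>. S \<subseteq> V \<alpha>)"
proof
  assume "small S"
  then obtain x \<alpha> where x: "elts x = S" "x \<in> V \<alpha>" unfolding small_def using V_exhaustive by blast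
  have "S \<subseteq> V \<alpha>"
    using V_elts[OF x(2)] x(1) V_mono by (meson less_imp_le subsetD subsetI)
  then show "\<exists>\<alpha>. S \<subseteq> V \<alpha>" ..
qed (auto simp: small_def dest: powerset_full)

lemma small_subset: "small S \<Longrightarrow> S' \<subseteq> S \<Longrightarrow> small S'"
  unfolding small_iff_V by blast

lemma small_image: "small S \<Longrightarrow> small (f ` S)"
  using image_set unfolding small_def by metis

text \<open>Replacement bounds the stages chosen for the individual \<open>F s\<close> by a single
  one.\<close>

lemma small_UN:
  assumes "small S" "\<And>s. s \<in> S \<Longrightarrow> small (F s)"
  shows "small (\<Union>s\<in>S. F s)"
proof -
  obtain x where x: "elts x = S" using assms(1) unfolding small_def by blast
  have "\<forall>s. \<exists>\<alpha>. s \<in> S \<longrightarrow> F s \<subseteq> V \<alpha>" using assms(2) unfolding small_iff_V by blast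
  then obtain r where r: "\<And>s. s \<in> S \<Longrightarrow> F s \<subseteq> V (r s)" by metis
  obtain \<beta> where \<beta>: "\<forall>y\<in>elts x. r y < \<beta>" using replacement by blast
  have "F s \<subseteq> V \<beta>" if "s \<in> S" for s
    using r[OF that] V_mono[of "r s" \<beta>] \<beta> x that by (auto simp: less_imp_le)
  then show ?thesis unfolding small_iff_V by blast
qed

lemma small_Un: "small S \<Longrightarrow> small S' \<Longrightarrow> small (S \<union> S')"
  unfolding small_iff_V by (metis V_mono le_sup_iff linorder_linear order_trans)

lemma small_empty [simp]: "small {}"
  unfolding small_iff_V by blast

lemma small_insert [simp]: "small S \<Longrightarrow> small (insert x S)"
  using small_Un[of "{x}" S] V_exhaustive[of x] unfolding small_iff_V by auto

lemma set_of_notin [simp]: "small S \<Longrightarrow> set_of S \<notin> A"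
  and elts_set_of [simp]: "small S \<Longrightarrow> elts (set_of S) = S"
  using vset_eq unfolding small_def by auto

lemma set_of_eq_iff [simp]: "small S \<Longrightarrow> small S' \<Longrightarrow> set_of S = set_of S' \<longleftrightarrow> S = S'"
  using elts_set_of by metis

lemma pair_eq_iff [simp]: "pair x y = pair x' y' \<longleftrightarrow> x = x' \<and> y = y'"
  unfolding vpair_def by (auto simp: doubleton_eq_iff)

text \<open>Zermelo numerals. Being free of atoms, they are fixed by every automorphism and can
  serve as names without affecting supports.\<close>

primrec num :: "nat \<Rightarrow> 'v" where
  "num 0 = set_of {}"
| "num (Suc n) = set_of {num n}"

lemma num_inj: "num n = num m \<Longrightarrow> n = m"
proof (induction n arbitrary: m)
  case 0
  then show ?case by (cases m) auto
next
  case (Suc n)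
  then show ?case by (cases m) auto
qed

text \<open>All numerals appear below the limit stage that \<open>infinity\<close> provides, since
  each step raises the stage only to a later one still below the limit.\<close>

lemma small_range_num: "small (range num)"
proof -
  obtain \<alpha> \<alpha>' :: 'o where \<alpha>: "\<alpha>' < \<alpha>" and lim: "\<And>\<beta>. \<beta> < \<alpha> \<Longrightarrow> \<exists>\<gamma>. \<beta> < \<gamma> \<and> \<gamma> < \<alpha>"
    using infinity by blast
  have step: "set_of S \<in> V \<gamma>" if "S \<subseteq> V \<beta>" "\<beta> < \<gamma>" for S and \<beta> \<gamma> :: 'o
  proof -
    \<comment> \<open>\<open>V_succ\<close> describes immediate successors, so the set is found in
      the stage right after \<open>\<beta>\<close> and lifted to \<open>\<gamma>\<close> by
      monotonicity.\<close>
    define \<delta> where "\<delta> = (LEAST \<delta>. \<beta> < \<delta>)"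
    have \<delta>: "\<beta> < \<delta>" "\<And>\<gamma>. \<beta> < \<gamma> \<Longrightarrow> \<delta> \<le> \<gamma>"
      unfolding \<delta>_def using that(2) by (auto intro: LeastI Least_le)
    have "small S" using that(1) unfolding small_iff_V by blast
    then have "set_of S \<in> V \<delta>" using V_succ[OF \<delta>] that(1) by simp
    then show ?thesis using V_mono[OF \<delta>(2)[OF that(2)]] by blast
  qed
  have "\<exists>\<beta><\<alpha>. num n \<in> V \<beta>" for n
  proof (induction n)
    case 0
    show ?case using lim[OF \<alpha>] step[of "{}" \<alpha>'] by auto
  next
    case (Suc n)
    then obtain \<beta> where \<beta>: "\<beta> < \<alpha>" "num n \<in> V \<beta>" by blast
    then show ?case using lim[OF \<beta>(1)] step[of "{num n}" \<beta>] by auto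
  qed
  then have "range num \<subseteq> V \<alpha>" using V_limit[OF \<alpha> lim] by blast
  then show ?thesis unfolding small_iff_V by blast
qed

text \<open>The index set may have any type, while \<open>small_UN\<close> wants indices from the
  hierarchy; numerals are substituted for them.\<close>

lemma small_UN_countable:
  assumes "countable J" "\<And>j. j \<in> J \<Longrightarrow> small (F j)"
  shows "small (\<Union>j\<in>J. F j)"
proof (cases "J = {}")
  case False
  define G where "G u = F (from_nat_into J (inv_into UNIV num u))" for u
  have "inv_into UNIV num (num n) = n" for n using num_inj by (intro inv_f_f injI) auto
  then have G: "G (num n) = F (from_nat_into J n)" for n unfolding G_def by simp
  have "small (\<Union>u\<in>range num. G u)"
    by (rule small_UN[OF small_range_num]) (use G assms(2) from_nat_into[OF False] in auto)
  also have "(\<Union>u\<in>range num. G u) = (\<Union>j\<in>range (from_nat_into J). F j)" using G by simp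
  also have "range (from_nat_into J) = J" using False assms(1) by (simp add: range_from_nat_into)
  finally show ?thesis .
qed simp

text \<open>Because of \<open>tup [x] = x\<close>, first powers are the sets themselves; the price is that \<open>tup\<close> is injective
  only on lists of the same length.\<close>

fun tup :: "'v list \<Rightarrow> 'v" where
  "tup [] = set_of {}"
| "tup [x] = x"
| "tup (x # y # ys) = pair x (tup (y # ys))"

lemma tup_inj: "length xs = length ys \<Longrightarrow> tup xs = tup ys \<Longrightarrow> xs = ys"
proof (induction xs arbitrary: ys rule: tup.induct)
  case (2 x)
  then show ?case by (cases ys) auto
next
  case (3 x y zs)
  then obtain x' y' zs' where ys: "ys = x' # y' # zs'" by (metis Suc_length_conv length_Cons)
  have "y # zs = y' # zs'" by (rule "3.IH") (use "3.prems" ys in auto)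
  then show ?case using "3.prems" ys by auto
qed simp

lemma small_tup: "small C \<Longrightarrow> small (tup ` pw C n)"
proof (induction n)
  case 0
  have "pw C 0 = {[]}" unfolding pw_def by auto
  then show ?case by simp
next
  case (Suc n)
  show ?case
  \<comment> \<open>A list of length 1 is coded by its entry without any pair, so length 1 cannot be
    reduced to length 0 and is treated separately.\<close>
  proof (cases n)
    case 0
    then have "tup ` pw C (Suc n) \<subseteq> C" by (auto simp: pw_1)
    then show ?thesis by (rule small_subset[OF Suc.prems])
  next
    case (Suc m)
    have "tup ` pw C (Suc n) \<subseteq> (\<Union>x\<in>C. pair x ` (tup ` pw C n))"
    proof
      fix z assume "z \<in> tup ` pw C (Suc n)"
      then obtain x y ys where "x \<in> C" "y # ys \<in> pw C n" "z = pair x (tup (y # ys))"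
        unfolding Suc pw_def by (auto simp: length_Suc_conv)
      then show "z \<in> (\<Union>x\<in>C. pair x ` (tup ` pw C n))" by blast
    qed
    moreover have "small (\<Union>x\<in>C. pair x ` (tup ` pw C n))"
      by (rule small_UN[OF Suc.prems]) (rule small_image[OF Suc.IH[OF Suc.prems]])
    ultimately show ?thesis by (rule small_subset[rotated])
  qed
qed

section \<open>The action of maps of atoms on the hierarchy\<close>

lemma moved_set_of: "small S \<Longrightarrow> moved \<pi> (set_of S) = set_of (moved \<pi> ` S)"
  using act_set[of "set_of S" \<pi>] vset_eq[of "moved \<pi> (set_of S)"] by simp

lemma moved_pair [simp]: "moved \<pi> (pair x y) = pair (moved \<pi> x) (moved \<pi> y)"
  unfolding vpair_def by (simp add: moved_set_of)

lemma moved_tup: "moved \<pi> (tup xs) = tup (map (moved \<pi>) xs)"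
  by (induction xs rule: tup.induct) (auto simp: moved_set_of)

lemma moved_num [simp]: "moved \<pi> (num n) = num n"
  by (induction n) (auto simp: moved_set_of)

lemma moved_id: "(\<And>a. a \<in> A \<Longrightarrow> \<pi> a = a) \<Longrightarrow> moved \<pi> x = x"
proof (induction x rule: wf_induct_rule[OF wf_elts])
  case (1 x)
  show ?case
  proof (cases "x \<in> A")
    case False
    have "moved \<pi> ` elts x = elts x" using 1 by force
    then show ?thesis using extensionality[OF act_set(1) False] act_set(2)[OF False] False by simp
  qed (use 1 act_atom in simp)
qed

text \<open>Agreement on atoms suffices, by induction on membership. This fits elements of
  \<open>Bij A\<close>, whose composites and inverses are meaningful on \<open>A\<close>
  only.\<close>

lemma moved_moved:
  assumes "\<And>a. a \<in> A \<Longrightarrow> \<rho> a \<in> A" "\<And>a. a \<in> A \<Longrightarrow> \<sigma> a = \<pi> (\<rho> a)"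
  shows "moved \<pi> (moved \<rho> x) = moved \<sigma> x"
proof (induction x rule: wf_induct_rule[OF wf_elts])
  case (1 x)
  show ?case
  proof (cases "x \<in> A")
    case False
    note \<rho>x = act_set[OF False, of \<rho>] and \<sigma>x = act_set[OF False, of \<sigma>]
    have "moved \<pi> ` moved \<rho> ` elts x = moved \<sigma> ` elts x" using 1 by (force simp: image_image)
    then show ?thesis using extensionality[OF act_set(1)[OF \<rho>x(1)] \<sigma>x(1)] act_set(2)[OF \<rho>x(1)] \<rho>x(2) \<sigma>x(2) by simp
  qed (use assms act_atom in simp)
qed

end

section \<open>Automorphism groups and their topology\<close>

locale structure_with_atoms = cumulative_hierarchy "univ \<A>" elts V
  for \<A> :: "('v, 'f, 'r) alg_structure" and elts and V :: "'o::wellorder \<Rightarrow> 'v set" +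
  assumes is_str: "is_structure \<A>"
begin

abbreviation "A \<equiv> univ \<A>"

lemma Aut_over_sub: "Aut_over \<A> B \<subseteq> Bij A"
  unfolding Aut_over_def Aut_def by blast

lemma Aut_over_in: "\<pi> \<in> Aut_over \<A> B \<Longrightarrow> a \<in> A \<Longrightarrow> \<pi> a \<in> A"
  using Aut_over_sub Bij_imp_funcset by blast

lemma Aut_over_mono: "B \<subseteq> B' \<Longrightarrow> Aut_over \<A> B' \<subseteq> Aut_over \<A> B"
  unfolding Aut_over_def by blast

lemma Aut_over_empty: "Aut_over \<A> {} = Aut \<A>"
  unfolding Aut_over_def by blast

lemma id_Aut_over: "B \<subseteq> A \<Longrightarrow> (\<lambda>a\<in>A. a) \<in> Aut_over \<A> B"
proof -
  assume B: "B \<subseteq> A"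
  have "map (\<lambda>a\<in>A. a) xs = xs" if "set xs \<subseteq> A" for xs using that by (intro map_idI) auto
  then show ?thesis
    using B is_str id_Bij[of A] unfolding Aut_over_def Aut_def is_structure_def by auto
qed

lemma compose_Aut_over:
  assumes B: "B \<subseteq> A" and \<pi>: "\<pi> \<in> Aut_over \<A> B" and \<rho>: "\<rho> \<in> Aut_over \<A> B"
  shows "compose A \<pi> \<rho> \<in> Aut_over \<A> B"
proof -
  have in_A: "set (map \<rho> xs) \<subseteq> A" if "set xs \<subseteq> A" for xs using that Aut_over_in[OF \<rho>] by auto
  have map: "map (compose A \<pi> \<rho>) xs = map \<pi> (map \<rho> xs)" if "set xs \<subseteq> A" for xs
    using that by (auto simp: compose_def)
  have "compose A \<pi> \<rho> \<in> Bij A" using compose_Bij \<pi> \<rho> Aut_over_sub by blast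
  moreover have "compose A \<pi> \<rho> (oper \<A> f xs) = oper \<A> f (map (compose A \<pi> \<rho>) xs)"
    if "set xs \<subseteq> A" "length xs = op_arity \<A> f" for f xs
  proof -
    have "oper \<A> f xs \<in> A" using is_str that unfolding is_structure_def by blast
    then have "compose A \<pi> \<rho> (oper \<A> f xs) = \<pi> (\<rho> (oper \<A> f xs))" by (simp add: compose_def)
    also have "\<dots> = \<pi> (oper \<A> f (map \<rho> xs))" using \<rho> that unfolding Aut_over_def Aut_def by simp
    also have "\<dots> = oper \<A> f (map \<pi> (map \<rho> xs))"
      using \<pi> in_A[OF that(1)] that(2) unfolding Aut_over_def Aut_def by auto
    finally show ?thesis by (simp only: map[OF that(1)])
  qed
  moreover have "xs \<in> rel \<A> r \<longleftrightarrow> map (compose A \<pi> \<rho>) xs \<in> rel \<A> r"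
    if "set xs \<subseteq> A" "length xs = rel_arity \<A> r" for r xs
  proof -
    have "xs \<in> rel \<A> r \<longleftrightarrow> map \<rho> xs \<in> rel \<A> r" using \<rho> that unfolding Aut_over_def Aut_def by simp
    also have "\<dots> \<longleftrightarrow> map \<pi> (map \<rho> xs) \<in> rel \<A> r"
      using \<pi> in_A[OF that(1)] that(2) unfolding Aut_over_def Aut_def by auto
    finally show ?thesis by (simp only: map[OF that(1)])
  qed
  moreover have "compose A \<pi> \<rho> b = b" if "b \<in> B" for b
    using that B \<pi> \<rho> unfolding Aut_over_def by (auto simp: compose_def)
  ultimately show ?thesis unfolding Aut_over_def Aut_def by blast
qed

lemma inverse_Aut_over:
  assumes B: "B \<subseteq> A" and \<pi>: "\<pi> \<in> Aut_over \<A> B"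
  shows "(\<lambda>a\<in>A. inv_into A \<pi> a) \<in> Aut_over \<A> B"
proof -
  define \<rho> where "\<rho> = (\<lambda>a\<in>A. inv_into A \<pi> a)"
  have bij: "bij_betw \<pi> A A" using \<pi> Aut_over_sub unfolding Bij_def by blast
  have \<rho>: "\<rho> a \<in> A" "\<pi> (\<rho> a) = a" "\<rho> (\<pi> a) = a" if "a \<in> A" for a
    using that bij bij_betwE[OF bij] unfolding \<rho>_def
    by (auto simp: bij_betw_def inv_into_into f_inv_into_f)
  have in_A: "set (map \<rho> xs) \<subseteq> A" if "set xs \<subseteq> A" for xs using that \<rho>(1) by auto
  have map: "map \<pi> (map \<rho> xs) = xs" if "set xs \<subseteq> A" for xs
    using that \<rho>(2) by (simp add: subset_iff map_idI)
  have "\<rho> \<in> Bij A" unfolding \<rho>_def using restrict_inv_into_Bij \<pi> Aut_over_sub by blast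
  moreover have "\<rho> (oper \<A> f xs) = oper \<A> f (map \<rho> xs)"
    if "set xs \<subseteq> A" "length xs = op_arity \<A> f" for f xs
  proof -
    have "oper \<A> f (map \<rho> xs) \<in> A" using is_str in_A[OF that(1)] that(2) unfolding is_structure_def by simp
    moreover have "\<pi> (oper \<A> f (map \<rho> xs)) = oper \<A> f (map \<pi> (map \<rho> xs))"
      using \<pi> in_A[OF that(1)] that(2) unfolding Aut_over_def Aut_def by auto
    ultimately show ?thesis using \<rho>(3) map[OF that(1)] by metis
  qed
  moreover have "xs \<in> rel \<A> r \<longleftrightarrow> map \<rho> xs \<in> rel \<A> r"
    if "set xs \<subseteq> A" "length xs = rel_arity \<A> r" for r xs
  proof -
    have "map \<rho> xs \<in> rel \<A> r \<longleftrightarrow> map \<pi> (map \<rho> xs) \<in> rel \<A> r"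
      using \<pi> in_A[OF that(1)] that(2) unfolding Aut_over_def Aut_def by auto
    then show ?thesis by (simp only: map[OF that(1)])
  qed
  moreover have "\<rho> b = b" if "b \<in> B" for b
    using that B \<pi> \<rho>(3)[of b] unfolding Aut_over_def by auto
  ultimately show ?thesis unfolding Aut_over_def Aut_def \<rho>_def by blast
qed

lemma moved_compose: "\<rho> \<in> Aut_over \<A> B \<Longrightarrow> moved (compose A \<pi> \<rho>) x = moved \<pi> (moved \<rho> x)"
  using moved_moved[of \<rho> "compose A \<pi> \<rho>" \<pi> x] Aut_over_in by (auto simp: compose_def)

text \<open>The inverse is expressed by its action on the hierarchy: composites that are identities
  on atoms become identities on all of \<open>'v\<close>.\<close>

lemma Aut_over_inverse:
  assumes B: "B \<subseteq> A" and \<pi>: "\<pi> \<in> Aut_over \<A> B"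
  obtains \<rho> where "\<rho> \<in> Aut_over \<A> B" "\<And>x. moved \<rho> (moved \<pi> x) = x" "\<And>x. moved \<pi> (moved \<rho> x) = x"
proof -
  define \<rho> where "\<rho> = (\<lambda>a\<in>A. inv_into A \<pi> a)"
  have bij: "bij_betw \<pi> A A" using \<pi> Aut_over_sub unfolding Bij_def by blast
  have \<rho>: "\<rho> \<in> Aut_over \<A> B" using inverse_Aut_over[OF B \<pi>] unfolding \<rho>_def .
  have inv: "\<pi> (\<rho> a) = a" "\<rho> (\<pi> a) = a" if "a \<in> A" for a
    using that bij bij_betwE[OF bij] unfolding \<rho>_def
    by (auto simp: bij_betw_def inv_into_into f_inv_into_f)
  have "moved \<rho> (moved \<pi> x) = x" for x
    using moved_moved[of \<pi> id \<rho> x] Aut_over_in[OF \<pi>] inv moved_id[of id x] by simp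
  moreover have "moved \<pi> (moved \<rho> x) = x" for x
    using moved_moved[of \<rho> id \<pi> x] Aut_over_in[OF \<rho>] inv moved_id[of id x] by simp
  ultimately show thesis using that[OF \<rho>] by blast
qed

lemma group_Aut: "B \<subseteq> A \<Longrightarrow> group (Aut_group \<A> B)"
proof -
  assume B: "B \<subseteq> A"
  have "subgroup (Aut_over \<A> B) (BijGroup A)"
  proof (rule group.subgroupI[OF group_BijGroup])
    show "Aut_over \<A> B \<subseteq> carrier (BijGroup A)" using Aut_over_sub by (simp add: BijGroup_def)
    show "Aut_over \<A> B \<noteq> {}" using id_Aut_over[OF B] by blast
    fix \<pi> assume \<pi>: "\<pi> \<in> Aut_over \<A> B"
    show "inv\<^bsub>BijGroup A\<^esub> \<pi> \<in> Aut_over \<A> B"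
      using inv_BijGroup[of \<pi> A] inverse_Aut_over[OF B \<pi>] subsetD[OF Aut_over_sub \<pi>] by auto
    fix \<rho> assume \<rho>: "\<rho> \<in> Aut_over \<A> B"
    show "\<pi> \<otimes>\<^bsub>BijGroup A\<^esub> \<rho> \<in> Aut_over \<A> B"
      using compose_Aut_over[OF B \<pi> \<rho>] \<pi> \<rho> Aut_over_sub[of B] by (auto simp: BijGroup_def subset_iff)
  qed
  then show ?thesis unfolding Aut_group_def by (rule subgroup.subgroup_is_group[OF _ group_BijGroup])
qed

lemma carrier_Aut_group [simp]: "carrier (Aut_group \<A> B) = Aut_over \<A> B"
  unfolding Aut_group_def by simp

lemma mult_Aut_group: "\<pi> \<in> Aut_over \<A> B \<Longrightarrow> \<rho> \<in> Aut_over \<A> B \<Longrightarrow>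
    \<pi> \<otimes>\<^bsub>Aut_group \<A> B\<^esub> \<rho> = compose A \<pi> \<rho>"
  using Aut_over_sub[of B] unfolding Aut_group_def BijGroup_def by auto

lemma one_Aut_group: "\<one>\<^bsub>Aut_group \<A> B\<^esub> = (\<lambda>a\<in>A. a)"
  unfolding Aut_group_def BijGroup_def by simp

lemma Aut_over_PiE: "Aut_over \<A> B \<subseteq> A \<rightarrow>\<^sub>E A"
proof
  fix \<pi> assume "\<pi> \<in> Aut_over \<A> B"
  then have "\<pi> \<in> Bij A" using Aut_over_sub by blast
  then show "\<pi> \<in> A \<rightarrow>\<^sub>E A" using Bij_imp_funcset Bij_imp_extensional unfolding PiE_def by blast
qed

lemma Aut_over_extensional: "\<pi> \<in> Aut_over \<A> B \<Longrightarrow> \<pi> \<in> extensional A"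
  using Aut_over_PiE unfolding PiE_def by blast

lemma topspace_Aut [simp]: "topspace (Aut_topology \<A> B) = Aut_over \<A> B"
  using Aut_over_PiE unfolding Aut_topology_def by auto

text \<open>Neighbourhoods of \<open>\<pi>\<close> are given by prescribing its values at finitely
  many atoms: these are the basic boxes of the product topology, restricted to the group.\<close>

lemma openin_Aut_iff:
  "openin (Aut_topology \<A> B) U \<longleftrightarrow> U \<subseteq> Aut_over \<A> B \<and>
     (\<forall>\<pi>\<in>U. \<exists>C. finite C \<and> C \<subseteq> A \<and> (\<forall>\<rho>\<in>Aut_over \<A> B. (\<forall>c\<in>C. \<rho> c = \<pi> c) \<longrightarrow> \<rho> \<in> U))"
proof
  assume U: "openin (Aut_topology \<A> B) U"
  show "U \<subseteq> Aut_over \<A> B \<and>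
     (\<forall>\<pi>\<in>U. \<exists>C. finite C \<and> C \<subseteq> A \<and> (\<forall>\<rho>\<in>Aut_over \<A> B. (\<forall>c\<in>C. \<rho> c = \<pi> c) \<longrightarrow> \<rho> \<in> U))"
  proof (intro conjI ballI)
    show "U \<subseteq> Aut_over \<A> B" using openin_subset[OF U] by simp
    fix \<pi> assume \<pi>: "\<pi> \<in> U"
    obtain W where W: "openin (product_topology (\<lambda>_. discrete_topology A) A) W" "U = W \<inter> Aut_over \<A> B"
      using U unfolding Aut_topology_def openin_subtopology by blast
    then obtain N where N: "finite {a\<in>A. N a \<noteq> A}" "\<pi> \<in> Pi\<^sub>E A N" "Pi\<^sub>E A N \<subseteq> W"
      using \<pi> unfolding openin_product_topology_alt by auto
    \<comment> \<open>The finitely many coordinates that the basic box really restricts.\<close>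
    define C where "C = {a\<in>A. N a \<noteq> A}"
    have "\<rho> \<in> U" if \<rho>: "\<rho> \<in> Aut_over \<A> B" "\<forall>c\<in>C. \<rho> c = \<pi> c" for \<rho>
    proof -
      have "\<rho> a \<in> N a" if "a \<in> A" for a
        using \<rho>(2) N(2) Aut_over_in[OF \<rho>(1) that] that unfolding C_def by (cases "a \<in> C") (auto simp: C_def PiE_iff)
      then have "\<rho> \<in> Pi\<^sub>E A N" using Aut_over_extensional[OF \<rho>(1)] by (auto simp: PiE_iff)
      then show ?thesis using N(3) W(2) \<rho>(1) by blast
    qed
    then show "\<exists>C. finite C \<and> C \<subseteq> A \<and> (\<forall>\<rho>\<in>Aut_over \<A> B. (\<forall>c\<in>C. \<rho> c = \<pi> c) \<longrightarrow> \<rho> \<in> U)"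
      using N(1) by (intro exI[of _ C]) (auto simp: C_def)
  qed
next
  assume U: "U \<subseteq> Aut_over \<A> B \<and>
     (\<forall>\<pi>\<in>U. \<exists>C. finite C \<and> C \<subseteq> A \<and> (\<forall>\<rho>\<in>Aut_over \<A> B. (\<forall>c\<in>C. \<rho> c = \<pi> c) \<longrightarrow> \<rho> \<in> U))"
  show "openin (Aut_topology \<A> B) U"
  proof (subst openin_subopen, intro ballI)
    fix \<pi> assume \<pi>: "\<pi> \<in> U"
    then obtain C where C: "finite C" "C \<subseteq> A" "\<And>\<rho>. \<rho> \<in> Aut_over \<A> B \<Longrightarrow> \<forall>c\<in>C. \<rho> c = \<pi> c \<Longrightarrow> \<rho> \<in> U"
      using U by metis
    define N where "N a = (if a \<in> C then {\<pi> a} else A)" for a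
    have \<pi>A: "\<pi> \<in> Aut_over \<A> B" using U \<pi> by blast
    have "openin (product_topology (\<lambda>_. discrete_topology A) A) (Pi\<^sub>E A N)"
      unfolding openin_PiE_gen
    proof (intro disjI2 conjI ballI)
      show "finite {a \<in> A. N a \<noteq> topspace (discrete_topology A)}"
        by (rule finite_subset[OF _ C(1)]) (auto simp: N_def)
      show "openin (discrete_topology A) (N a)" if "a \<in> A" for a
        using that Aut_over_in[OF \<pi>A] by (auto simp: N_def)
    qed
    then have "openin (Aut_topology \<A> B) (Pi\<^sub>E A N \<inter> Aut_over \<A> B)"
      unfolding Aut_topology_def openin_subtopology by blast
    moreover have "\<pi> \<in> Pi\<^sub>E A N \<inter> Aut_over \<A> B"
      using \<pi>A Aut_over_extensional[OF \<pi>A] Aut_over_in[OF \<pi>A] by (auto simp: PiE_iff N_def)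
    moreover have "Pi\<^sub>E A N \<inter> Aut_over \<A> B \<subseteq> U"
    proof
      fix \<rho> assume \<rho>: "\<rho> \<in> Pi\<^sub>E A N \<inter> Aut_over \<A> B"
      have "\<rho> c = \<pi> c" if c: "c \<in> C" for c
      proof -
        have "\<rho> c \<in> N c" using \<rho> c C(2) by (auto simp: PiE_iff)
        then show ?thesis using c by (simp add: N_def)
      qed
      then show "\<rho> \<in> U" using C(3) \<rho> by blast
    qed
    ultimately show "\<exists>T. openin (Aut_topology \<A> B) T \<and> \<pi> \<in> T \<and> T \<subseteq> U" by blast
  qed
qed

section \<open>Finite supports and symmetric sets\<close>

definition supports :: "'v set \<Rightarrow> 'v \<Rightarrow> bool" where
  "supports B x \<longleftrightarrow> finite B \<and> B \<subseteq> A \<and> (\<forall>\<pi>\<in>Aut_over \<A> B. moved \<pi> x = x)"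

lemma supportsD: "supports B x \<Longrightarrow> \<pi> \<in> Aut_over \<A> B \<Longrightarrow> moved \<pi> x = x"
  unfolding supports_def by blast

lemma supports_mono: "supports B x \<Longrightarrow> B \<subseteq> B' \<Longrightarrow> finite B' \<Longrightarrow> B' \<subseteq> A \<Longrightarrow> supports B' x"
  unfolding supports_def using Aut_over_mono by blast

text \<open>If \<open>\<rho>\<close> agrees with \<open>\<pi>\<close> on the support, then the
  inverse of \<open>\<pi>\<close> after \<open>\<rho>\<close> fixes the support pointwise and hence
  fixes \<open>x\<close>. For \<open>y = x\<close> this gives open stabilisers, for arbitrary
  \<open>y\<close> the continuity of actions.\<close>

lemma open_transporter:
  assumes B: "supports B x" and C: "C \<subseteq> A"
  shows "openin (Aut_topology \<A> C) {\<pi> \<in> Aut_over \<A> C. moved \<pi> x = y}"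
  unfolding openin_Aut_iff
proof (intro conjI ballI)
  fix \<pi> assume \<pi>: "\<pi> \<in> {\<pi> \<in> Aut_over \<A> C. moved \<pi> x = y}"
  obtain \<sigma> where \<sigma>: "\<sigma> \<in> Aut_over \<A> C" "\<And>x. moved \<sigma> (moved \<pi> x) = x" "\<And>x. moved \<pi> (moved \<sigma> x) = x"
    using Aut_over_inverse[OF C, of \<pi>] \<pi> by blast
  have "moved \<rho> x = y" if \<rho>: "\<rho> \<in> Aut_over \<A> C" "\<forall>b\<in>B. \<rho> b = \<pi> b" for \<rho>
  proof -
    have BA: "B \<subseteq> A" using B unfolding supports_def by blast
    have "compose A \<sigma> \<rho> \<in> Aut_over \<A> C" by (rule compose_Aut_over[OF C \<sigma>(1) \<rho>(1)])
    moreover have "compose A \<sigma> \<rho> b = b" if b: "b \<in> B" for b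
    proof -
      have "b \<in> A" "\<pi> b \<in> A" using b BA \<pi> Aut_over_in by auto
      then have "\<sigma> (\<pi> b) = b" using \<sigma>(2)[of b] act_atom by metis
      then show ?thesis using \<rho>(2) b \<open>b \<in> A\<close> by (simp add: compose_def)
    qed
    ultimately have "compose A \<sigma> \<rho> \<in> Aut_over \<A> B" unfolding Aut_over_def by blast
    then have "moved \<sigma> (moved \<rho> x) = x"
      using supportsD[OF B] moved_compose[OF \<rho>(1)] by metis
    then show ?thesis using \<sigma>(3)[of "moved \<rho> x"] \<pi> by simp
  qed
  then show "\<exists>B. finite B \<and> B \<subseteq> A \<and> (\<forall>\<rho>\<in>Aut_over \<A> C. (\<forall>b\<in>B. \<rho> b = \<pi> b) \<longrightarrow>
      \<rho> \<in> {\<pi> \<in> Aut_over \<A> C. moved \<pi> x = y})"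
    using B unfolding supports_def by blast
qed blast

text \<open>A basic neighbourhood of the identity inside the stabiliser is the pointwise stabiliser
  of a finite set of atoms; the converse is \<open>open_transporter\<close>.\<close>

lemma open_stabilizer_iff:
  "openin (Aut_topology \<A> {}) {\<pi> \<in> Aut \<A>. moved \<pi> x = x} \<longleftrightarrow> (\<exists>B. supports B x)"
proof
  assume "openin (Aut_topology \<A> {}) {\<pi> \<in> Aut \<A>. moved \<pi> x = x}"
  moreover have id: "(\<lambda>a\<in>A. a) \<in> {\<pi> \<in> Aut \<A>. moved \<pi> x = x}"
    using id_Aut_over[of "{}"] moved_id[of "\<lambda>a\<in>A. a"] by (simp add: Aut_over_empty)
  ultimately obtain C where C: "finite C" "C \<subseteq> A"
    "\<forall>\<rho>\<in>Aut_over \<A> {}. (\<forall>c\<in>C. \<rho> c = (\<lambda>a\<in>A. a) c) \<longrightarrow> \<rho> \<in> {\<pi> \<in> Aut \<A>. moved \<pi> x = x}"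
    unfolding openin_Aut_iff by blast
  have "supports C x"
    unfolding supports_def using C Aut_over_mono[of "{}" C]
    by (auto simp: Aut_over_def subset_iff)
  then show "\<exists>B. supports B x" ..
next
  assume "\<exists>B. supports B x"
  then show "openin (Aut_topology \<A> {}) {\<pi> \<in> Aut \<A>. moved \<pi> x = x}"
    using open_transporter[of _ x "{}" x] by (auto simp: Aut_over_empty)
qed

text \<open>One step of the membership closure is split off. Symmetry can thus be shown by a support
  of the set and symmetry of its members, whose supports need not be uniform.\<close>

lemma symmetric_iff: "symmetric \<A> elts x \<longleftrightarrow> (\<exists>B. supports B x) \<and> (\<forall>y\<in>elts x. symmetric \<A> elts y)"
proof -
  define R where "R = {(z, w). z \<in> elts w}"
  have sym: "symmetric \<A> elts x \<longleftrightarrow> (\<forall>z. (z, x) \<in> R\<^sup>* \<longrightarrow> (\<exists>B. supports B z))" for x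
    unfolding symmetric_def open_stabilizer_iff R_def ..
  have "(z, x) \<in> R\<^sup>* \<longleftrightarrow> z = x \<or> (\<exists>y\<in>elts x. (z, y) \<in> R\<^sup>*)" for z
  proof -
    have "(y, x) \<in> R \<longleftrightarrow> y \<in> elts x" for y unfolding R_def by simp
    then show ?thesis by (metis rtrancl.simps)
  qed
  then show ?thesis unfolding sym by metis
qed

lemma symmetric_supports:
  assumes "symmetric \<A> elts x" obtains B where "supports B x"
  using assms symmetric_iff by blast

lemma symmetric_elts: "symmetric \<A> elts x \<Longrightarrow> y \<in> elts x \<Longrightarrow> symmetric \<A> elts y"
  using symmetric_iff by blast

text \<open>Closure under the group gives one inclusion for each automorphism; applied to its
  inverse it gives the other.\<close>

lemma supports_set_of:
  assumes "small S" "finite B" "B \<subseteq> A" "\<And>\<pi> x. \<pi> \<in> Aut_over \<A> B \<Longrightarrow> x \<in> S \<Longrightarrow> moved \<pi> x \<in> S"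
  shows "supports B (set_of S)"
  unfolding supports_def
proof (intro conjI ballI assms)
  fix \<pi> assume \<pi>: "\<pi> \<in> Aut_over \<A> B"
  obtain \<rho> where \<rho>: "\<rho> \<in> Aut_over \<A> B" "\<And>x. moved \<rho> (moved \<pi> x) = x" "\<And>x. moved \<pi> (moved \<rho> x) = x"
    using Aut_over_inverse[OF assms(3) \<pi>] by blast
  have "x \<in> moved \<pi> ` S" if "x \<in> S" for x
    using assms(4)[OF \<rho>(1) that] \<rho>(3)[of x] by (metis imageI)
  then have "moved \<pi> ` S = S" using assms(4)[OF \<pi>] by blast
  then show "moved \<pi> (set_of S) = set_of S" using moved_set_of[OF assms(1)] by simp
qed

lemma supports_elts:
  assumes "supports B X" "X \<notin> A" "\<pi> \<in> Aut_over \<A> B" "x \<in> elts X"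
  shows "moved \<pi> x \<in> elts X"
  using supportsD[OF assms(1,3)] act_set(2)[OF assms(2)] assms(4) by (metis imageI)

lemma symmetric_set_ofI:
  assumes "supports B (set_of S)" "small S" "\<And>x. x \<in> S \<Longrightarrow> symmetric \<A> elts x"
  shows "symmetric \<A> elts (set_of S)"
  unfolding symmetric_iff[of "set_of S"] elts_set_of[OF assms(2)] using assms(1,3) by blast

lemma symmetric_doubleton:
  assumes "symmetric \<A> elts x" "symmetric \<A> elts y" shows "symmetric \<A> elts (set_of {x, y})"
proof -
  obtain B where B: "supports B x" using assms(1) by (rule symmetric_supports)
  obtain B' where B': "supports B' y" using assms(2) by (rule symmetric_supports)
  have "supports (B \<union> B') (set_of {x, y})"
  proof (rule supports_set_of)
    fix \<pi> z assume "\<pi> \<in> Aut_over \<A> (B \<union> B')" "z \<in> {x, y}"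
    then show "moved \<pi> z \<in> {x, y}"
      using supportsD[OF B] supportsD[OF B'] Aut_over_mono[of B "B \<union> B'"] Aut_over_mono[of B' "B \<union> B'"] by auto
  qed (use B B' in \<open>auto simp: supports_def\<close>)
  then show ?thesis by (rule symmetric_set_ofI) (use assms in auto)
qed

lemma symmetric_pair: "symmetric \<A> elts x \<Longrightarrow> symmetric \<A> elts y \<Longrightarrow> symmetric \<A> elts (pair x y)"
  unfolding vpair_def using symmetric_doubleton[of x x] by (intro symmetric_doubleton) auto

lemma symmetric_empty: "symmetric \<A> elts (set_of {})"
  by (rule symmetric_set_ofI[of "{}"], rule supports_set_of) auto

lemma symmetric_tup: "(\<And>x. x \<in> set xs \<Longrightarrow> symmetric \<A> elts x) \<Longrightarrow> symmetric \<A> elts (tup xs)"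
  by (induction xs rule: tup.induct) (auto intro: symmetric_pair symmetric_empty)

lemma symmetric_num: "symmetric \<A> elts (num n)"
proof (induction n)
  case (Suc n)
  then show ?case using symmetric_doubleton[of "num n" "num n"] by simp
qed (simp add: symmetric_empty)

section \<open>Symmetric sets as a concrete category\<close>

definition tuples :: "nat \<Rightarrow> (nat \<Rightarrow> 'v set) \<Rightarrow> 'v set" where
  "tuples n S = tup ` {xs. length xs = n \<and> (\<forall>i<n. xs ! i \<in> S i)}"

text \<open>The length is a parameter because \<open>tup\<close> does not determine it.\<close>

definition untup :: "nat \<Rightarrow> 'v \<Rightarrow> 'v list" where
  "untup n = inv_into {xs. length xs = n} tup"

lemma untup_tup [simp]: "length xs = n \<Longrightarrow> untup n (tup xs) = xs"
  unfolding untup_def by (rule inv_into_f_f) (auto intro!: inj_onI dest: tup_inj[rotated])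

lemma tuples_pw: "tuples n (\<lambda>_. C) = tup ` pw C n"
  unfolding tuples_def pw_def by (rule arg_cong[where f = "\<lambda>X. tup ` X"]) (force simp: set_conv_nth)

lemma small_tuples:
  assumes "\<And>i. i < n \<Longrightarrow> small (S i)"
  shows "small (tuples n S)"
proof -
  have "small (\<Union>i\<in>{..<n}. S i)" by (rule small_UN_countable) (use assms in auto)
  then have "small (tup ` pw (\<Union>i\<in>{..<n}. S i) n)" by (rule small_tup)
  moreover have "tuples n S \<subseteq> tup ` pw (\<Union>i\<in>{..<n}. S i) n"
    unfolding tuples_def pw_def by (rule image_mono) (fastforce simp: in_set_conv_nth)
  ultimately show ?thesis by (rule small_subset)
qed

lemma tuples_cases:
  assumes "z \<in> tuples n S"
  obtains xs where "length xs = n" "\<forall>i<n. xs ! i \<in> S i" "z = tup xs"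
  using assms unfolding tuples_def by blast

lemma untup_nth_in: "z \<in> tuples n S \<Longrightarrow> i < n \<Longrightarrow> untup n z ! i \<in> S i"
  by (erule tuples_cases) simp

lemma tuples_eqI:
  assumes "z \<in> tuples n S" "z' \<in> tuples n S" "\<And>i. i < n \<Longrightarrow> untup n z ! i = untup n z' ! i"
  shows "z = z'"
proof -
  obtain xs where xs: "length xs = n" "z = tup xs" using assms(1) by (rule tuples_cases)
  obtain ys where ys: "length ys = n" "z' = tup ys" using assms(2) by (rule tuples_cases)
  have "xs = ys" using assms(3) xs ys by (intro nth_equalityI) auto
  then show ?thesis using xs ys by simp
qed

lemma tup_map_in: "(\<And>i. i < n \<Longrightarrow> y i \<in> S i) \<Longrightarrow> tup (map y [0..<n]) \<in> tuples n S"
  unfolding tuples_def by (rule imageI) simp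

section \<open>Functions as set-theoretic graphs\<close>

fun zfn :: "'v \<times> 'v \<times> 'v \<Rightarrow> 'v \<Rightarrow> 'v" where
  "zfn (X, Y, f) x = (THE y. pair x y \<in> elts f)"

declare zfn.simps [simp del]

definition graph :: "'v \<Rightarrow> ('v \<Rightarrow> 'v) \<Rightarrow> 'v" where
  "graph X k = set_of ((\<lambda>x. pair x (k x)) ` elts X)"

lemma ZFA_simps:
  "Obj (ZFA \<A> elts) = {X. X \<notin> A \<and> symmetric \<A> elts X}"
  "Arr (ZFA \<A> elts) = {(X, Y, f). X \<notin> A \<and> symmetric \<A> elts X \<and> Y \<notin> A \<and> symmetric \<A> elts Y \<and>
     is_graph A elts X Y f \<and> symmetric \<A> elts f}"
  "Dom (ZFA \<A> elts) (X, Y, f) = X"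
  "Cod (ZFA \<A> elts) (X, Y, f) = Y"
  "Ide (ZFA \<A> elts) X = (X, X, set_of {pair x x |x. x \<in> elts X})"
  "Cmp (ZFA \<A> elts) (Y', Z, g) (X, Y, f) =
     (X, Z, set_of {pair x z |x y z. pair x y \<in> elts f \<and> pair y z \<in> elts g})"
  by (simp_all add: ZFA_def Let_def)

lemma elts_graph: "X \<notin> A \<Longrightarrow> elts (graph X k) = (\<lambda>x. pair x (k x)) ` elts X"
  unfolding graph_def using small_image[OF small_elts] by simp

lemma graph_notin: "X \<notin> A \<Longrightarrow> graph X k \<notin> A"
  unfolding graph_def using small_image[OF small_elts] by simp

lemma zfn_graph: "X \<notin> A \<Longrightarrow> x \<in> elts X \<Longrightarrow> zfn (X, Y, graph X k) x = k x"
  by (auto simp: elts_graph zfn.simps)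

lemma is_graph_graph:
  assumes "X \<notin> A" "k \<in> elts X \<rightarrow> elts Y" shows "is_graph A elts X Y (graph X k)"
  unfolding is_graph_def using graph_notin[OF assms(1)] assms(2) by (auto simp: elts_graph[OF assms(1)])

lemma
  assumes f: "is_graph A elts X Y f"
  shows zfn_in: "x \<in> elts X \<Longrightarrow> zfn (X, Y, f) x \<in> elts Y"
    and pair_in_graph: "x \<in> elts X \<Longrightarrow> pair x y \<in> elts f \<longleftrightarrow> y = zfn (X, Y, f) x"
    and pair_in_graph_dom: "pair x y \<in> elts f \<Longrightarrow> x \<in> elts X"
    and graph_zfn: "X \<notin> A \<Longrightarrow> f = graph X (zfn (X, Y, f))"
proof -
  have f': "\<forall>p\<in>elts f. \<exists>x\<in>elts X. \<exists>y\<in>elts Y. p = pair x y" "\<forall>x\<in>elts X. \<exists>!y. pair x y \<in> elts f"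
    using f unfolding is_graph_def by blast+
  show dom: "x \<in> elts X" if "pair x y \<in> elts f" for x y using f'(1) that by fastforce
  have the: "pair x (zfn (X, Y, f) x) \<in> elts f" if "x \<in> elts X" for x
    using theI'[of "\<lambda>y. pair x y \<in> elts f"] f'(2) that by (simp add: zfn.simps)
  show iff: "pair x y \<in> elts f \<longleftrightarrow> y = zfn (X, Y, f) x" if "x \<in> elts X" for x y
    using the[OF that] f'(2) that by metis
  show "zfn (X, Y, f) x \<in> elts Y" if "x \<in> elts X" for x
    using f'(1) the[OF that] by fastforce
  assume X: "X \<notin> A"
  have "elts f = elts (graph X (zfn (X, Y, f)))"
    unfolding elts_graph[OF X]
  proof (intro equalityI subsetI)
    fix p assume p: "p \<in> elts f"
    then obtain x y where x: "x \<in> elts X" "p = pair x y" using f'(1) by blast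
    have "pair x y \<in> elts f" using p x(2) by simp
    then have "p = pair x (zfn (X, Y, f) x)" using iff[OF x(1), of y] x(2) by simp
    then show "p \<in> (\<lambda>x. pair x (zfn (X, Y, f) x)) ` elts X" using x(1) by (rule image_eqI)
  next
    fix p assume "p \<in> (\<lambda>x. pair x (zfn (X, Y, f) x)) ` elts X"
    then show "p \<in> elts f" using the by blast
  qed
  moreover have "f \<notin> A" using f unfolding is_graph_def by blast
  ultimately show "f = graph X (zfn (X, Y, f))" using graph_notin[OF X] extensionality by blast
qed

lemma ZFA_HomE:
  assumes "F \<in> Hom (ZFA \<A> elts) X Y"
  obtains f where "F = (X, Y, f)" "X \<notin> A" "symmetric \<A> elts X" "Y \<notin> A" "symmetric \<A> elts Y"
    "is_graph A elts X Y f" "symmetric \<A> elts f"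
  using assms unfolding Hom_def ZFA_simps(2) by (auto simp: ZFA_simps)

lemma Ide_ZFA: "Ide (ZFA \<A> elts) X = (X, X, graph X (\<lambda>x. x))"
  unfolding ZFA_simps graph_def by (simp add: setcompr_eq_image)

lemma Cmp_ZFA:
  assumes "(X, Y, f) \<in> Hom (ZFA \<A> elts) X Y" "(Y, Z, g) \<in> Hom (ZFA \<A> elts) Y Z"
  shows "Cmp (ZFA \<A> elts) (Y, Z, g) (X, Y, f) = (X, Z, graph X (\<lambda>x. zfn (Y, Z, g) (zfn (X, Y, f) x)))"
proof -
  have f: "is_graph A elts X Y f" using assms(1) by (rule ZFA_HomE) simp
  have g: "is_graph A elts Y Z g" using assms(2) by (rule ZFA_HomE) simp
  have "{pair x z |x y z. pair x y \<in> elts f \<and> pair y z \<in> elts g} =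
      (\<lambda>x. pair x (zfn (Y, Z, g) (zfn (X, Y, f) x))) ` elts X"
  proof (intro equalityI subsetI)
    fix p assume "p \<in> {pair x z |x y z. pair x y \<in> elts f \<and> pair y z \<in> elts g}"
    then obtain x y z where p: "p = pair x z" "pair x y \<in> elts f" "pair y z \<in> elts g" by blast
    have x: "x \<in> elts X" and y: "y \<in> elts Y"
      using pair_in_graph_dom[OF f p(2)] pair_in_graph_dom[OF g p(3)] .
    then have "y = zfn (X, Y, f) x" "z = zfn (Y, Z, g) y"
      using pair_in_graph[OF f x] pair_in_graph[OF g y] p by blast+
    then show "p \<in> (\<lambda>x. pair x (zfn (Y, Z, g) (zfn (X, Y, f) x))) ` elts X" using p x by blast
  next
    fix p assume "p \<in> (\<lambda>x. pair x (zfn (Y, Z, g) (zfn (X, Y, f) x))) ` elts X"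
    then obtain x where x: "x \<in> elts X" "p = pair x (zfn (Y, Z, g) (zfn (X, Y, f) x))" by blast
    then show "p \<in> {pair x z |x y z. pair x y \<in> elts f \<and> pair y z \<in> elts g}"
      using pair_in_graph[OF f x(1)] pair_in_graph[OF g zfn_in[OF f x(1)]] by blast
  qed
  then show ?thesis unfolding ZFA_simps graph_def by simp
qed

lemma supports_graph:
  assumes X: "supports B X" "X \<notin> A"
    and k: "\<And>\<pi> x. \<pi> \<in> Aut_over \<A> B \<Longrightarrow> x \<in> elts X \<Longrightarrow> k (moved \<pi> x) = moved \<pi> (k x)"
  shows "supports B (graph X k)"
  unfolding graph_def
proof (rule supports_set_of)
  show "small ((\<lambda>x. pair x (k x)) ` elts X)" by (rule small_image[OF small_elts[OF X(2)]])
  show "finite B" "B \<subseteq> A" using X(1) unfolding supports_def by auto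
  fix \<pi> p assume \<pi>: "\<pi> \<in> Aut_over \<A> B" and "p \<in> (\<lambda>x. pair x (k x)) ` elts X"
  then obtain x where x: "x \<in> elts X" "p = pair x (k x)" by blast
  have "moved \<pi> p = pair (moved \<pi> x) (k (moved \<pi> x))" using x k[OF \<pi>] by simp
  then show "moved \<pi> p \<in> (\<lambda>x. pair x (k x)) ` elts X" using supports_elts[OF X \<pi> x(1)] by blast
qed

lemma zfn_equivariant:
  assumes X: "supports B X" "X \<notin> A" and f: "is_graph A elts X Y f" "supports B f"
    and \<pi>: "\<pi> \<in> Aut_over \<A> B" and x: "x \<in> elts X"
  shows "zfn (X, Y, f) (moved \<pi> x) = moved \<pi> (zfn (X, Y, f) x)"
proof -
  have "pair x (zfn (X, Y, f) x) \<in> elts f" using pair_in_graph[OF f(1) x] by blast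
  moreover have "f \<notin> A" using f(1) unfolding is_graph_def by blast
  ultimately have "moved \<pi> (pair x (zfn (X, Y, f) x)) \<in> elts f"
    by (intro supports_elts[OF f(2) _ \<pi>])
  then show ?thesis using pair_in_graph[OF f(1) supports_elts[OF X \<pi> x]] by simp
qed

text \<open>The graph has to be symmetric hereditarily: as a set it is supported by
  \<open>B\<close>, and its members are pairs of members of symmetric sets.\<close>

lemma graph_Hom:
  assumes X: "X \<in> Obj (ZFA \<A> elts)" and Y: "Y \<in> Obj (ZFA \<A> elts)" and B: "supports B X"
    and k: "k \<in> elts X \<rightarrow> elts Y" "\<And>\<pi> x. \<pi> \<in> Aut_over \<A> B \<Longrightarrow> x \<in> elts X \<Longrightarrow> k (moved \<pi> x) = moved \<pi> (k x)"
  shows "(X, Y, graph X k) \<in> Hom (ZFA \<A> elts) X Y"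
proof -
  have X': "X \<notin> A" "symmetric \<A> elts X" and Y': "Y \<notin> A" "symmetric \<A> elts Y"
    using X Y by (auto simp: ZFA_simps)
  have "supports B (graph X k)" by (rule supports_graph[OF B X'(1) k(2)])
  moreover have "symmetric \<A> elts p" if p: "p \<in> elts (graph X k)" for p
  proof -
    obtain x where "x \<in> elts X" "p = pair x (k x)"
      using p unfolding elts_graph[OF X'(1)] by blast
    then show ?thesis using symmetric_pair symmetric_elts[OF X'(2)] symmetric_elts[OF Y'(2)] k(1) by blast
  qed
  ultimately have "symmetric \<A> elts (graph X k)" using symmetric_iff[of "graph X k"] by blast
  then show ?thesis
    using X' Y' is_graph_graph[OF X'(1) k(1)] by (simp add: Hom_def ZFA_simps)
qed

text \<open>Domain, codomain and graph have finite supports. Over their union the graph is fixed, so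
  the function commutes with the automorphisms.\<close>

lemma Hom_equivariant:
  assumes "F \<in> Hom (ZFA \<A> elts) X Y"
  obtains B where "supports B X" "supports B Y"
    "\<forall>\<pi>\<in>Aut_over \<A> B. \<forall>x\<in>elts X. zfn F (moved \<pi> x) = moved \<pi> (zfn F x)"
proof -
  obtain f where f: "F = (X, Y, f)" "X \<notin> A" "symmetric \<A> elts X" "Y \<notin> A" "symmetric \<A> elts Y"
    "is_graph A elts X Y f" "symmetric \<A> elts f"
    using assms by (rule ZFA_HomE)
  obtain B1 where B1: "supports B1 X" using f(3) by (rule symmetric_supports)
  obtain B2 where B2: "supports B2 Y" using f(5) by (rule symmetric_supports)
  obtain B3 where B3: "supports B3 f" using f(7) by (rule symmetric_supports)
  define B where "B = B1 \<union> B2 \<union> B3"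
  have B: "finite B" "B \<subseteq> A" using B1 B2 B3 unfolding supports_def B_def by auto
  have BX: "supports B X" by (rule supports_mono[OF B1 _ B]) (auto simp: B_def)
  have BY: "supports B Y" by (rule supports_mono[OF B2 _ B]) (auto simp: B_def)
  have Bf: "supports B f" by (rule supports_mono[OF B3 _ B]) (auto simp: B_def)
  show thesis
    by (rule that[OF BX BY]) (unfold f(1), intro ballI, rule zfn_equivariant[OF BX f(2,6) Bf])
qed

text \<open>For finitely many conditions that persist under enlarging the support, the union of the
  individual supports works for all.\<close>

lemma finite_supports:
  assumes "\<And>i. i < (n::nat) \<Longrightarrow> \<exists>B. finite B \<and> B \<subseteq> A \<and> P i B"
    and "\<And>i B B'. i < n \<Longrightarrow> P i B \<Longrightarrow> B \<subseteq> B' \<Longrightarrow> finite B' \<Longrightarrow> B' \<subseteq> A \<Longrightarrow> P i B'"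
  shows "\<exists>B. finite B \<and> B \<subseteq> A \<and> (\<forall>i<n. P i B)"
proof -
  have "\<forall>i. \<exists>B. i < n \<longrightarrow> finite B \<and> B \<subseteq> A \<and> P i B" using assms(1) by blast
  then obtain B where B: "\<And>i. i < n \<Longrightarrow> finite (B i)" "\<And>i. i < n \<Longrightarrow> B i \<subseteq> A" "\<And>i. i < n \<Longrightarrow> P i (B i)"
    by metis
  define B' where "B' = (\<Union>i\<in>{..<n}. B i)"
  have B': "finite B'" "B' \<subseteq> A" using B unfolding B'_def by auto
  have "P i B'" if "i < n" for i
    by (rule assms(2)[OF that B(3)[OF that] _ B']) (use that in \<open>auto simp: B'_def\<close>)
  then show ?thesis using B' by blast
qed

lemma
  assumes X: "\<And>i. i < n \<Longrightarrow> X i \<in> Obj (ZFA \<A> elts)" and B: "finite B" "B \<subseteq> A" "\<And>i. i < n \<Longrightarrow> supports B (X i)"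
  defines "Q \<equiv> set_of (tuples n (\<lambda>i. elts (X i)))"
  shows tuples_Obj: "Q \<in> Obj (ZFA \<A> elts)" and tuples_supports: "supports B Q"
    and elts_tuples: "elts Q = tuples n (\<lambda>i. elts (X i))"
    and tuples_proj: "i < n \<Longrightarrow> (Q, X i, graph Q (\<lambda>z. untup n z ! i)) \<in> Hom (ZFA \<A> elts) Q (X i)"
proof -
  have X': "X i \<notin> A" "symmetric \<A> elts (X i)" if "i < n" for i using X[OF that] by (auto simp: ZFA_simps)
  have small: "small (tuples n (\<lambda>i. elts (X i)))" by (rule small_tuples) (rule small_elts[OF X'(1)])
  then show elts: "elts Q = tuples n (\<lambda>i. elts (X i))" unfolding Q_def by simp
  show sup: "supports B Q"
    unfolding Q_def
  proof (rule supports_set_of[OF small B(1,2)])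
    fix \<pi> z assume \<pi>: "\<pi> \<in> Aut_over \<A> B" and z: "z \<in> tuples n (\<lambda>i. elts (X i))"
    from z obtain xs where xs: "length xs = n" "\<forall>i<n. xs ! i \<in> elts (X i)" "z = tup xs"
      by (rule tuples_cases)
    have "map (moved \<pi>) xs ! i \<in> elts (X i)" if "i < n" for i
      using supports_elts[OF B(3)[OF that] X'(1)[OF that] \<pi>] xs(1,2) that by simp
    then show "moved \<pi> z \<in> tuples n (\<lambda>i. elts (X i))"
      unfolding xs(3) moved_tup tuples_def by (intro imageI CollectI) (simp add: xs(1))
  qed
  have "symmetric \<A> elts z" if z: "z \<in> tuples n (\<lambda>i. elts (X i))" for z
  proof -
    obtain xs where xs: "length xs = n" "\<forall>i<n. xs ! i \<in> elts (X i)" "z = tup xs"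
      by (rule tuples_cases[OF z])
    show ?thesis
      unfolding xs(3)
    proof (rule symmetric_tup)
      fix x assume "x \<in> set xs"
      then obtain i where "i < n" "x = xs ! i" using xs(1) by (auto simp: in_set_conv_nth)
      then show "symmetric \<A> elts x" using symmetric_elts[OF X'(2)] xs(2) by blast
    qed
  qed
  then have "symmetric \<A> elts Q"
    using sup small unfolding Q_def by (intro symmetric_set_ofI)
  moreover have Q: "Q \<notin> A" unfolding Q_def using small by simp
  ultimately show Obj: "Q \<in> Obj (ZFA \<A> elts)" by (simp add: ZFA_simps)
  show "(Q, X i, graph Q (\<lambda>z. untup n z ! i)) \<in> Hom (ZFA \<A> elts) Q (X i)" if i: "i < n"
  proof (rule graph_Hom[OF Obj X[OF i] sup])
    show "(\<lambda>z. untup n z ! i) \<in> elts Q \<rightarrow> elts (X i)"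
      unfolding elts using untup_nth_in[OF _ i] by blast
    fix \<pi> z assume "z \<in> elts Q"
    then obtain xs where xs: "length xs = n" "z = tup xs" unfolding elts by (rule tuples_cases)
    then show "untup n (moved \<pi> z) ! i = moved \<pi> (untup n z ! i)" using i by (simp add: moved_tup)
  qed
qed

text \<open>A common finite support of \<open>P\<close>, \<open>Q\<close> and all
  \<open>p i\<close>, \<open>q i\<close> supports \<open>u\<close> as well: its values are pinned
  down by supported data.\<close>

lemma ZFA_lift:
  assumes P: "P \<in> Obj (ZFA \<A> elts)" and Q: "Q \<in> Obj (ZFA \<A> elts)"
    and p: "\<And>i. i < n \<Longrightarrow> p i \<in> Hom (ZFA \<A> elts) P (X i)"
    and q: "\<And>i. i < n \<Longrightarrow> q i \<in> Hom (ZFA \<A> elts) Q (X i)"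
    and inj: "\<And>z z'. z \<in> elts P \<Longrightarrow> z' \<in> elts P \<Longrightarrow> (\<And>i. i < n \<Longrightarrow> zfn (p i) z = zfn (p i) z') \<Longrightarrow> z = z'"
    and u: "\<And>x. x \<in> elts Q \<Longrightarrow> u x \<in> elts P"
    and pu: "\<And>i x. i < (n::nat) \<Longrightarrow> x \<in> elts Q \<Longrightarrow> zfn (p i) (u x) = zfn (q i) x"
  shows "\<exists>u'\<in>Hom (ZFA \<A> elts) Q P. \<forall>x\<in>elts Q. zfn u' x = u x"
proof -
  define E where "E i B \<longleftrightarrow> (\<forall>\<pi>\<in>Aut_over \<A> B. (\<forall>z\<in>elts P. zfn (p i) (moved \<pi> z) = moved \<pi> (zfn (p i) z)) \<and>
    (\<forall>z\<in>elts Q. zfn (q i) (moved \<pi> z) = moved \<pi> (zfn (q i) z)))" for i B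
  have "\<exists>B. finite B \<and> B \<subseteq> A \<and> (\<forall>i<n. E i B)"
  proof (rule finite_supports)
    fix i assume i: "i < n"
    obtain B1 where B1: "supports B1 P"
      "\<forall>\<pi>\<in>Aut_over \<A> B1. \<forall>x\<in> elts P. zfn (p i) (moved \<pi> x) = moved \<pi> (zfn (p i) x)"
      by (rule Hom_equivariant[OF p[OF i]])
    obtain B2 where B2: "supports B2 Q"
      "\<forall>\<pi>\<in>Aut_over \<A> B2. \<forall>x\<in> elts Q. zfn (q i) (moved \<pi> x) = moved \<pi> (zfn (q i) x)"
      by (rule Hom_equivariant[OF q[OF i]])
    have "Aut_over \<A> (B1 \<union> B2) \<subseteq> Aut_over \<A> B1" "Aut_over \<A> (B1 \<union> B2) \<subseteq> Aut_over \<A> B2"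
      by (rule Aut_over_mono, blast)+
    then have "E i (B1 \<union> B2)" unfolding E_def using B1(2) B2(2) by blast
    then show "\<exists>B. finite B \<and> B \<subseteq> A \<and> E i B"
      using B1(1) B2(1) unfolding supports_def by (intro exI[of _ "B1 \<union> B2"]) auto
  next
    fix i B B' assume "E i B" "B \<subseteq> B'"
    then show "E i B'" unfolding E_def using Aut_over_mono by blast
  qed
  then obtain B0 where B0: "finite B0" "B0 \<subseteq> A" "\<And>i. i < n \<Longrightarrow> E i B0" by blast
  obtain B1 where B1: "supports B1 P" using P symmetric_supports by (auto simp: ZFA_simps)
  obtain B2 where B2: "supports B2 Q" using Q symmetric_supports by (auto simp: ZFA_simps)
  define B where "B = B0 \<union> B1 \<union> B2"
  have B: "finite B" "B \<subseteq> A" using B0 B1 B2 unfolding supports_def B_def by auto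
  have BP: "supports B P" by (rule supports_mono[OF B1 _ B]) (auto simp: B_def)
  have BQ: "supports B Q" by (rule supports_mono[OF B2 _ B]) (auto simp: B_def)
  have PA: "P \<notin> A" and QA: "Q \<notin> A" using P Q by (auto simp: ZFA_simps)
  have sub: "Aut_over \<A> B \<subseteq> Aut_over \<A> B0" by (rule Aut_over_mono) (auto simp: B_def)
  have "(Q, P, graph Q u) \<in> Hom (ZFA \<A> elts) Q P"
  proof (rule graph_Hom[OF Q P BQ])
    show "u \<in> elts Q \<rightarrow> elts P" using u by blast
    fix \<pi> x assume \<pi>: "\<pi> \<in> Aut_over \<A> B" and x: "x \<in> elts Q"
    have \<pi>x: "moved \<pi> x \<in> elts Q" by (rule supports_elts[OF BQ QA \<pi> x])
    have \<pi>u: "moved \<pi> (u x) \<in> elts P" by (rule supports_elts[OF BP PA \<pi> u[OF x]])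
    show "u (moved \<pi> x) = moved \<pi> (u x)"
    \<comment> \<open>After each projection both sides become
      \<open>moved \<pi> (zfn (q i) x)\<close>.\<close>
    proof (rule inj[OF u[OF \<pi>x] \<pi>u])
      fix i assume i: "i < n"
      have "E i B0" by (rule B0(3)[OF i])
      then have "zfn (p i) (moved \<pi> (u x)) = moved \<pi> (zfn (p i) (u x))"
        "zfn (q i) (moved \<pi> x) = moved \<pi> (zfn (q i) x)"
        unfolding E_def using subsetD[OF sub \<pi>] u[OF x] x by blast+
      then show "zfn (p i) (u (moved \<pi> x)) = zfn (p i) (moved \<pi> (u x))"
        using pu[OF i \<pi>x] pu[OF i x] by simp
    qed
  qed
  moreover have "\<forall>x\<in>elts Q. zfn (Q, P, graph Q u) x = u x" using zfn_graph[OF QA] by blast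
  ultimately show ?thesis by blast
qed

lemma ZFA_products:
  assumes X: "\<And>i. i < (n::nat) \<Longrightarrow> X i \<in> Obj (ZFA \<A> elts)"
  shows "\<exists>Q q. Q \<in> Obj (ZFA \<A> elts) \<and> (\<forall>i<n. q i \<in> Hom (ZFA \<A> elts) Q (X i)) \<and>
      (\<forall>z\<in>elts Q. \<forall>z'\<in>elts Q. (\<forall>i<n. zfn (q i) z = zfn (q i) z') \<longrightarrow> z = z') \<and>
      (\<forall>y. (\<forall>i<n. y i \<in> elts (X i)) \<longrightarrow> (\<exists>z\<in>elts Q. \<forall>i<n. zfn (q i) z = y i))"
proof -
  have "\<exists>B. finite B \<and> B \<subseteq> A \<and> (\<forall>i<n. supports B (X i))"
  proof (rule finite_supports)
    fix i assume "i < n"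
    then have "symmetric \<A> elts (X i)" using X by (simp add: ZFA_simps)
    then show "\<exists>B. finite B \<and> B \<subseteq> A \<and> supports B (X i)"
      using symmetric_iff[of "X i"] unfolding supports_def by blast
  qed (rule supports_mono)
  then obtain B where B: "finite B" "B \<subseteq> A" "\<And>i. i < n \<Longrightarrow> supports B (X i)" by blast
  define Q where "Q = set_of (tuples n (\<lambda>i. elts (X i)))"
  have Q: "Q \<in> Obj (ZFA \<A> elts)" "elts Q = tuples n (\<lambda>i. elts (X i))"
    unfolding Q_def by (rule tuples_Obj elts_tuples, (fact X B)+)+
  have proj: "(Q, X i, graph Q (\<lambda>z. untup n z ! i)) \<in> Hom (ZFA \<A> elts) Q (X i)" if "i < n" for i
    unfolding Q_def by (rule tuples_proj) (fact X B that)+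
  have QA: "Q \<notin> A" using Q(1) by (simp add: ZFA_simps)
  define q where "q i = (Q, X i, graph Q (\<lambda>z. untup n z ! i))" for i
  have q: "zfn (q i) z = untup n z ! i" if "z \<in> elts Q" for i z
    unfolding q_def by (rule zfn_graph[OF QA that])
  show ?thesis
  proof (intro exI[of _ Q] exI[of _ q] conjI allI impI ballI)
    fix z z' assume z: "z \<in> elts Q" "z' \<in> elts Q" and eq: "\<forall>i<n. zfn (q i) z = zfn (q i) z'"
    show "z = z'"
    proof (rule tuples_eqI[OF z[unfolded Q(2)]])
      fix i assume "i < n"
      then show "untup n z ! i = untup n z' ! i" using eq q[OF z(1), of i] q[OF z(2), of i] by simp
    qed
  next
    fix y assume y: "\<forall>i<n. y i \<in> elts (X i)"
    have "tup (map y [0..<n]) \<in> elts Q" unfolding Q(2) by (rule tup_map_in) (use y in blast)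
    moreover from this have "\<forall>i<n. zfn (q i) (tup (map y [0..<n])) = y i" using q by simp
    ultimately show "\<exists>z\<in>elts Q. \<forall>i<n. zfn (q i) z = y i" by blast
  next
    show "q i \<in> Hom (ZFA \<A> elts) Q (X i)" if "i < n" for i unfolding q_def by (rule proj[OF that])
  qed (rule Q(1))
qed

lemma concrete_cat_ZFA:
  assumes "lawvere_theory L"
  shows "concrete_cat L (ZFA \<A> elts) elts zfn"
proof (unfold_locales)
  show "lawvere_theory L" by fact
  show "Dom (ZFA \<A> elts) F \<in> Obj (ZFA \<A> elts) \<and> Cod (ZFA \<A> elts) F \<in> Obj (ZFA \<A> elts)"
    if "F \<in> Arr (ZFA \<A> elts)" for F
    using that unfolding ZFA_simps(1,2) by (auto simp: ZFA_simps)
  show ide: "Ide (ZFA \<A> elts) X \<in> Hom (ZFA \<A> elts) X X" if X: "X \<in> Obj (ZFA \<A> elts)" for X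
  proof -
    obtain B where "supports B X" using X symmetric_supports by (auto simp: ZFA_simps)
    then show ?thesis unfolding Ide_ZFA by (rule graph_Hom[OF X X]) auto
  qed
  show "zfn (Ide (ZFA \<A> elts) X) x = x" if "X \<in> Obj (ZFA \<A> elts)" "x \<in> elts X" for X x
    using that unfolding Ide_ZFA by (intro zfn_graph) (auto simp: ZFA_simps)
  show hom_in: "zfn F x \<in> elts Y" if "F \<in> Hom (ZFA \<A> elts) X Y" "x \<in> elts X" for F X Y x
    using that(1) by (rule ZFA_HomE) (use zfn_in that(2) in auto)
  show "Cmp (ZFA \<A> elts) G F \<in> Hom (ZFA \<A> elts) X Z"
    if F: "F \<in> Hom (ZFA \<A> elts) X Y" and G: "G \<in> Hom (ZFA \<A> elts) Y Z" for F G X Y Z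
  proof -
    obtain f where f: "F = (X, Y, f)" using F by (rule ZFA_HomE)
    obtain g where g: "G = (Y, Z, g)" using G by (rule ZFA_HomE)
    obtain B1 where B1: "supports B1 X" "supports B1 Y"
      "\<forall>\<pi>\<in>Aut_over \<A> B1. \<forall>x\<in> elts X. zfn F (moved \<pi> x) = moved \<pi> (zfn F x)"
      by (rule Hom_equivariant[OF F])
    obtain B2 where B2: "supports B2 Y" "supports B2 Z"
      "\<forall>\<pi>\<in>Aut_over \<A> B2. \<forall>y\<in> elts Y. zfn G (moved \<pi> y) = moved \<pi> (zfn G y)"
      by (rule Hom_equivariant[OF G])
    have B: "finite (B1 \<union> B2)" "B1 \<union> B2 \<subseteq> A" using B1 B2 unfolding supports_def by auto
    have X: "X \<in> Obj (ZFA \<A> elts)" by (rule ZFA_HomE[OF F]) (simp add: ZFA_simps)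
    have Z: "Z \<in> Obj (ZFA \<A> elts)" by (rule ZFA_HomE[OF G]) (simp add: ZFA_simps)
    have sub: "Aut_over \<A> (B1 \<union> B2) \<subseteq> Aut_over \<A> B1" "Aut_over \<A> (B1 \<union> B2) \<subseteq> Aut_over \<A> B2"
      by (rule Aut_over_mono, blast)+
    have "(X, Z, graph X (\<lambda>x. zfn G (zfn F x))) \<in> Hom (ZFA \<A> elts) X Z"
    proof (rule graph_Hom[OF X Z supports_mono[OF B1(1) _ B]])
      show "(\<lambda>x. zfn G (zfn F x)) \<in> elts X \<rightarrow> elts Z" using hom_in[OF G hom_in[OF F]] by blast
      fix \<pi> x assume \<pi>: "\<pi> \<in> Aut_over \<A> (B1 \<union> B2)" and x: "x \<in> elts X"
      show "zfn G (zfn F (moved \<pi> x)) = moved \<pi> (zfn G (zfn F x))"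
        using B1(3) B2(3) subsetD[OF sub(1) \<pi>] subsetD[OF sub(2) \<pi>] x hom_in[OF F x] by simp
    qed blast
    then show ?thesis using Cmp_ZFA F G unfolding f g by metis
  qed
  show "zfn (Cmp (ZFA \<A> elts) G F) x = zfn G (zfn F x)"
    if F: "F \<in> Hom (ZFA \<A> elts) X Y" and G: "G \<in> Hom (ZFA \<A> elts) Y Z" and x: "x \<in> elts X" for F G X Y Z x
  proof -
    obtain f where f: "F = (X, Y, f)" and X: "X \<notin> A" using F by (rule ZFA_HomE)
    obtain g where g: "G = (Y, Z, g)" using G by (rule ZFA_HomE)
    show ?thesis using F G zfn_graph[OF X x] unfolding f g by (metis Cmp_ZFA)
  qed
  show "F = G" if F: "F \<in> Hom (ZFA \<A> elts) X Y" and G: "G \<in> Hom (ZFA \<A> elts) X Y"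
    and eq: "\<And>x. x \<in> elts X \<Longrightarrow> zfn F x = zfn G x" for F G X Y
  proof -
    obtain f where f: "F = (X, Y, f)" "X \<notin> A" "is_graph A elts X Y f" using F by (rule ZFA_HomE)
    obtain g where g: "G = (X, Y, g)" "is_graph A elts X Y g" using G by (rule ZFA_HomE)
    have FG: "graph X (zfn F) = graph X (zfn G)"
      unfolding graph_def by (rule arg_cong[where f = set_of], rule image_cong) (use eq in auto)
    have fF: "f = graph X (zfn F)" unfolding f(1) by (rule graph_zfn[OF f(3,2)])
    have gG: "g = graph X (zfn G)" unfolding g(1) by (rule graph_zfn[OF g(2) f(2)])
    have "f = g" by (rule trans[OF fF trans[OF FG gG[symmetric]]])
    then show ?thesis using f(1) g(1) by (simp only:)
  qed
next
  fix P Q and n :: nat and p Xs q u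
  assume *: "P \<in> Obj (ZFA \<A> elts)" "Q \<in> Obj (ZFA \<A> elts)"
    "\<And>i. i < n \<Longrightarrow> p i \<in> Hom (ZFA \<A> elts) P (Xs i)" "\<And>i. i < n \<Longrightarrow> q i \<in> Hom (ZFA \<A> elts) Q (Xs i)"
    "\<And>z z'. z \<in> elts P \<Longrightarrow> z' \<in> elts P \<Longrightarrow> (\<And>i. i < n \<Longrightarrow> zfn (p i) z = zfn (p i) z') \<Longrightarrow> z = z'"
    "\<And>x. x \<in> elts Q \<Longrightarrow> u x \<in> elts P"
    "\<And>i x. i < n \<Longrightarrow> x \<in> elts Q \<Longrightarrow> zfn (p i) (u x) = zfn (q i) x"
  show "\<exists>u'\<in>Hom (ZFA \<A> elts) Q P. \<forall>x\<in>elts Q. zfn u' x = u x"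
    by (rule ZFA_lift[of P Q n p Xs q u]) (fact *)+
qed (rule ZFA_products)

section \<open>Continuous actions as a concrete category\<close>

text \<open>Bijectivity of \<open>\<phi> \<pi>\<close> comes from the law for composites, applied to
  \<open>\<pi>\<close> and its inverse.\<close>

lemma group_action_AutI:
  assumes B: "B \<subseteq> A"
    and \<phi>: "\<And>\<pi>. \<pi> \<in> Aut_over \<A> B \<Longrightarrow> \<phi> \<pi> \<in> extensional X"
      "\<And>\<pi> x. \<pi> \<in> Aut_over \<A> B \<Longrightarrow> x \<in> X \<Longrightarrow> \<phi> \<pi> x \<in> X"
      "\<And>x. x \<in> X \<Longrightarrow> \<phi> (\<lambda>a\<in>A. a) x = x"
      "\<And>\<pi> \<rho> x. \<pi> \<in> Aut_over \<A> B \<Longrightarrow> \<rho> \<in> Aut_over \<A> B \<Longrightarrow> x \<in> X \<Longrightarrow> \<phi> (compose A \<pi> \<rho>) x = \<phi> \<pi> (\<phi> \<rho> x)"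
  shows "group_action (Aut_group \<A> B) X \<phi>"
proof -
  have Bij: "\<phi> \<pi> \<in> Bij X" if \<pi>: "\<pi> \<in> Aut_over \<A> B" for \<pi>
  proof -
    define \<rho> where "\<rho> = (\<lambda>a\<in>A. inv_into A \<pi> a)"
    have \<rho>: "\<rho> \<in> Aut_over \<A> B" unfolding \<rho>_def by (rule inverse_Aut_over[OF B \<pi>])
    have bij: "bij_betw \<pi> A A" using \<pi> Aut_over_sub unfolding Bij_def by blast
    have "compose A \<rho> \<pi> = (\<lambda>a\<in>A. a)" "compose A \<pi> \<rho> = (\<lambda>a\<in>A. a)"
      unfolding \<rho>_def using bij bij_betwE[OF bij]
      by (auto simp: compose_def fun_eq_iff bij_betw_def inv_into_into f_inv_into_f)
    then have inv: "\<phi> \<rho> (\<phi> \<pi> x) = x" "\<phi> \<pi> (\<phi> \<rho> x) = x" if "x \<in> X" for x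
      using \<phi>(4)[OF \<rho> \<pi> that] \<phi>(4)[OF \<pi> \<rho> that] \<phi>(3)[OF that] by simp_all
    have "bij_betw (\<phi> \<pi>) X X"
      by (rule bij_betw_byWitness[where f' = "\<phi> \<rho>"]) (use inv \<phi>(2)[OF \<pi>] \<phi>(2)[OF \<rho>] in auto)
    then show ?thesis using \<phi>(1)[OF \<pi>] unfolding Bij_def by blast
  qed
  have "\<phi> \<in> hom (Aut_group \<A> B) (BijGroup X)"
    unfolding hom_def
  proof (intro CollectI conjI ballI)
    show "\<phi> \<in> carrier (Aut_group \<A> B) \<rightarrow> carrier (BijGroup X)" using Bij by (auto simp: BijGroup_def)
    fix \<pi> \<rho> assume "\<pi> \<in> carrier (Aut_group \<A> B)" "\<rho> \<in> carrier (Aut_group \<A> B)"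
    then have \<pi>: "\<pi> \<in> Aut_over \<A> B" and \<rho>: "\<rho> \<in> Aut_over \<A> B" by simp_all
    have "\<phi> (compose A \<pi> \<rho>) = compose X (\<phi> \<pi>) (\<phi> \<rho>)"
    proof (rule extensionalityI[of _ X])
      show "\<phi> (compose A \<pi> \<rho>) \<in> extensional X" by (rule \<phi>(1)[OF compose_Aut_over[OF B \<pi> \<rho>]])
      show "compose X (\<phi> \<pi>) (\<phi> \<rho>) \<in> extensional X" by (rule compose_extensional)
      show "\<phi> (compose A \<pi> \<rho>) x = compose X (\<phi> \<pi>) (\<phi> \<rho>) x" if "x \<in> X" for x
        using \<phi>(4)[OF \<pi> \<rho> that] that by (simp add: compose_def)
    qed
    then show "\<phi> (\<pi> \<otimes>\<^bsub>Aut_group \<A> B\<^esub> \<rho>) = \<phi> \<pi> \<otimes>\<^bsub>BijGroup X\<^esub> \<phi> \<rho>"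
      using Bij[OF \<pi>] Bij[OF \<rho>] by (simp add: mult_Aut_group[OF \<pi> \<rho>] BijGroup_def)
  qed
  then show ?thesis
    by (intro group_action.intro group_hom.intro group_hom_axioms.intro group_Aut[OF B] group_BijGroup)
qed

lemma group_action_AutD:
  assumes B: "B \<subseteq> A" and act: "group_action (Aut_group \<A> B) X \<phi>"
  shows "\<pi> \<in> Aut_over \<A> B \<Longrightarrow> \<phi> \<pi> \<in> extensional X"
    and "\<pi> \<in> Aut_over \<A> B \<Longrightarrow> x \<in> X \<Longrightarrow> \<phi> \<pi> x \<in> X"
    and "x \<in> X \<Longrightarrow> \<phi> (\<lambda>a\<in>A. a) x = x"
    and "\<pi> \<in> Aut_over \<A> B \<Longrightarrow> \<rho> \<in> Aut_over \<A> B \<Longrightarrow> x \<in> X \<Longrightarrow> \<phi> (compose A \<pi> \<rho>) x = \<phi> \<pi> (\<phi> \<rho> x)"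
proof -
  interpret group_action "Aut_group \<A> B" X \<phi> by (rule act)
  show "\<phi> \<pi> \<in> extensional X" if "\<pi> \<in> Aut_over \<A> B"
    using bij_prop0[of \<pi>] that by (simp add: Bij_def)
  show "\<phi> \<pi> x \<in> X" if "\<pi> \<in> Aut_over \<A> B" "x \<in> X"
    using element_image[of \<pi> x] that by simp
  show "\<phi> (\<lambda>a\<in>A. a) x = x" if "x \<in> X"
    using id_eq_one that unfolding one_Aut_group by (metis restrict_apply')
  show "\<phi> (compose A \<pi> \<rho>) x = \<phi> \<pi> (\<phi> \<rho> x)" if "\<pi> \<in> Aut_over \<A> B" "\<rho> \<in> Aut_over \<A> B" "x \<in> X"
    using composition_rule[of x \<pi> \<rho>] that by (simp add: mult_Aut_group)
qed

text \<open>As \<open>X\<close> is discrete, the preimage of a set under the action splits into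
  products of a transporter with a point; conversely, restricting the action to one point shows its
  transporters to be open.\<close>

lemma continuous_action_topology_iff:
  assumes "\<And>\<pi> x. \<pi> \<in> Aut_over \<A> B \<Longrightarrow> x \<in> X \<Longrightarrow> \<phi> \<pi> x \<in> X"
  shows "continuous_map (prod_topology (Aut_topology \<A> B) (discrete_topology X)) (discrete_topology X) (\<lambda>(\<pi>, x). \<phi> \<pi> x)
    \<longleftrightarrow> (\<forall>x\<in>X. \<forall>y. openin (Aut_topology \<A> B) {\<pi> \<in> Aut_over \<A> B. \<phi> \<pi> x = y})" (is "?l \<longleftrightarrow> ?r")
proof
  assume l: ?l
  show ?r
  proof (intro ballI allI)
    fix x y assume x: "x \<in> X"
    have "continuous_map (Aut_topology \<A> B) (prod_topology (Aut_topology \<A> B) (discrete_topology X)) (\<lambda>\<pi>. (\<pi>, x))"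
      using x by (simp add: continuous_map_paired)
    from continuous_map_compose[OF this l]
    have cont: "continuous_map (Aut_topology \<A> B) (discrete_topology X) (\<lambda>\<pi>. \<phi> \<pi> x)" by (simp add: o_def)
    have "openin (Aut_topology \<A> B) {\<pi> \<in> topspace (Aut_topology \<A> B). \<phi> \<pi> x \<in> {y} \<inter> X}"
      by (rule openin_continuous_map_preimage[OF cont]) simp
    also have "{\<pi> \<in> topspace (Aut_topology \<A> B). \<phi> \<pi> x \<in> {y} \<inter> X} = {\<pi> \<in> Aut_over \<A> B. \<phi> \<pi> x = y}"
      using assms[OF _ x] by auto
    finally show "openin (Aut_topology \<A> B) {\<pi> \<in> Aut_over \<A> B. \<phi> \<pi> x = y}" .
  qed
next
  assume r: ?r
  show ?l
    unfolding continuous_map_def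
  proof (intro conjI allI impI)
    show "(\<lambda>(\<pi>, x). \<phi> \<pi> x) \<in> topspace (prod_topology (Aut_topology \<A> B) (discrete_topology X)) \<rightarrow> topspace (discrete_topology X)"
      using assms by auto
    fix U assume "openin (discrete_topology X) U"
    have "{p \<in> topspace (prod_topology (Aut_topology \<A> B) (discrete_topology X)). (\<lambda>(\<pi>, x). \<phi> \<pi> x) p \<in> U} =
        (\<Union>x\<in>X. \<Union>y\<in>U. {\<pi> \<in> Aut_over \<A> B. \<phi> \<pi> x = y} \<times> {x})" by auto
    moreover have "openin (prod_topology (Aut_topology \<A> B) (discrete_topology X))
        (\<Union>x\<in>X. \<Union>y\<in>U. {\<pi> \<in> Aut_over \<A> B. \<phi> \<pi> x = y} \<times> {x})"
    proof (intro openin_Union ballI, clarsimp)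
      fix x assume x: "x \<in> X"
      show "openin (prod_topology (Aut_topology \<A> B) (discrete_topology X))
          (\<Union>y\<in>U. {\<pi> \<in> Aut_over \<A> B. \<phi> \<pi> x = y} \<times> {x})"
      proof (intro openin_Union ballI, clarsimp)
        fix y
        show "openin (prod_topology (Aut_topology \<A> B) (discrete_topology X)) ({\<pi> \<in> Aut_over \<A> B. \<phi> \<pi> x = y} \<times> {x})"
          using r x by (simp add: openin_prod_Times_iff)
      qed
    qed
    ultimately show "openin (prod_topology (Aut_topology \<A> B) (discrete_topology X))
        {p \<in> topspace (prod_topology (Aut_topology \<A> B) (discrete_topology X)). (\<lambda>(\<pi>, x). \<phi> \<pi> x) p \<in> U}" by simp
  qed
qed

lemma Cont_simps:
  "Obj (Cont_Aut \<A> elts B) = {(X, \<phi>). small X \<and> continuous_action (Aut_group \<A> B) (Aut_topology \<A> B) X \<phi>}"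
  "Dom (Cont_Aut \<A> elts B) (P, Q, f) = P"
  "Cod (Cont_Aut \<A> elts B) (P, Q, f) = Q"
  "Ide (Cont_Aut \<A> elts B) P = (P, P, \<lambda>x\<in>fst P. x)"
  "Cmp (Cont_Aut \<A> elts B) (Q', R, g) (P, Q, f) = (P, R, compose (fst P) g f)"
  by (auto simp: Cont_Aut_def Cont_def small_def)

lemma Cont_Arr_iff:
  "(P, Q, f) \<in> Arr (Cont_Aut \<A> elts B) \<longleftrightarrow> P \<in> Obj (Cont_Aut \<A> elts B) \<and> Q \<in> Obj (Cont_Aut \<A> elts B) \<and>
     f \<in> fst P \<rightarrow>\<^sub>E fst Q \<and> (\<forall>\<pi>\<in>Aut_over \<A> B. \<forall>x\<in>fst P. f (snd P \<pi> x) = snd Q \<pi> (f x))"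
  unfolding Cont_simps by (cases P; cases Q) (auto simp: Cont_Aut_def Cont_def small_def)

lemma Cont_Hom_iff:
  "F \<in> Hom (Cont_Aut \<A> elts B) P Q \<longleftrightarrow> (\<exists>f. F = (P, Q, f) \<and>
     P \<in> Obj (Cont_Aut \<A> elts B) \<and> Q \<in> Obj (Cont_Aut \<A> elts B) \<and>
     f \<in> fst P \<rightarrow>\<^sub>E fst Q \<and> (\<forall>\<pi>\<in>Aut_over \<A> B. \<forall>x\<in>fst P. f (snd P \<pi> x) = snd Q \<pi> (f x)))"
proof -
  obtain P' Q' f where "F = (P', Q', f)" by (cases F)
  then show ?thesis by (auto simp: Hom_def Cont_Arr_iff Cont_simps)
qed

lemma Cont_ObjI:
  assumes B: "B \<subseteq> A" and X: "small X" and ext: "\<phi> \<in> extensional (Aut_over \<A> B)"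
    and \<phi>: "\<And>\<pi>. \<pi> \<in> Aut_over \<A> B \<Longrightarrow> \<phi> \<pi> \<in> extensional X"
      "\<And>\<pi> x. \<pi> \<in> Aut_over \<A> B \<Longrightarrow> x \<in> X \<Longrightarrow> \<phi> \<pi> x \<in> X"
      "\<And>x. x \<in> X \<Longrightarrow> \<phi> (\<lambda>a\<in>A. a) x = x"
      "\<And>\<pi> \<rho> x. \<pi> \<in> Aut_over \<A> B \<Longrightarrow> \<rho> \<in> Aut_over \<A> B \<Longrightarrow> x \<in> X \<Longrightarrow> \<phi> (compose A \<pi> \<rho>) x = \<phi> \<pi> (\<phi> \<rho> x)"
    and top: "\<And>x y. x \<in> X \<Longrightarrow> openin (Aut_topology \<A> B) {\<pi> \<in> Aut_over \<A> B. \<phi> \<pi> x = y}"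
  shows "(X, \<phi>) \<in> Obj (Cont_Aut \<A> elts B)"
proof -
  have "group_action (Aut_group \<A> B) X \<phi>" by (rule group_action_AutI[OF B]) (fact \<phi>)+
  moreover have "continuous_map (prod_topology (Aut_topology \<A> B) (discrete_topology X)) (discrete_topology X)
      (\<lambda>(\<pi>, x). \<phi> \<pi> x)"
    by (subst continuous_action_topology_iff) (use \<phi>(2) top in blast)+
  ultimately show ?thesis using X ext by (simp add: Cont_simps continuous_action_def)
qed

lemma
  assumes B: "B \<subseteq> A" and X: "P \<in> Obj (Cont_Aut \<A> elts B)"
  shows Cont_small: "small (fst P)"
    and Cont_closed: "\<pi> \<in> Aut_over \<A> B \<Longrightarrow> x \<in> fst P \<Longrightarrow> snd P \<pi> x \<in> fst P"
    and Cont_one: "x \<in> fst P \<Longrightarrow> snd P (\<lambda>a\<in>A. a) x = x"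
    and Cont_mult: "\<pi> \<in> Aut_over \<A> B \<Longrightarrow> \<rho> \<in> Aut_over \<A> B \<Longrightarrow> x \<in> fst P \<Longrightarrow>
      snd P (compose A \<pi> \<rho>) x = snd P \<pi> (snd P \<rho> x)"
    and Cont_open: "x \<in> fst P \<Longrightarrow> openin (Aut_topology \<A> B) {\<pi> \<in> Aut_over \<A> B. snd P \<pi> x = y}"
proof -
  have s: "small (fst P)" and act: "group_action (Aut_group \<A> B) (fst P) (snd P)"
    and cont: "continuous_map (prod_topology (Aut_topology \<A> B) (discrete_topology (fst P))) (discrete_topology (fst P))
      (\<lambda>(\<pi>, x). snd P \<pi> x)"
    using X by (auto simp: Cont_simps continuous_action_def)
  note D = group_action_AutD[OF B act]
  show "small (fst P)" by (rule s)
  show "\<pi> \<in> Aut_over \<A> B \<Longrightarrow> x \<in> fst P \<Longrightarrow> snd P \<pi> x \<in> fst P" by (rule D(2))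
  show "x \<in> fst P \<Longrightarrow> snd P (\<lambda>a\<in>A. a) x = x" by (rule D(3))
  show "\<pi> \<in> Aut_over \<A> B \<Longrightarrow> \<rho> \<in> Aut_over \<A> B \<Longrightarrow> x \<in> fst P \<Longrightarrow>
      snd P (compose A \<pi> \<rho>) x = snd P \<pi> (snd P \<rho> x)" by (rule D(4))
  show "x \<in> fst P \<Longrightarrow> openin (Aut_topology \<A> B) {\<pi> \<in> Aut_over \<A> B. snd P \<pi> x = y}"
    using iffD1[OF continuous_action_topology_iff cont] D(2) by blast
qed

text \<open>Equivariance of \<open>u\<close> is tested after the jointly injective arrows
  \<open>p i\<close>, as in \<open>ZFA_lift\<close>, but now over the whole group at once.\<close>

lemma Cont_lift:
  assumes B: "B \<subseteq> A" and P: "P \<in> Obj (Cont_Aut \<A> elts B)" and Q: "Q \<in> Obj (Cont_Aut \<A> elts B)"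
    and p: "\<And>i. i < n \<Longrightarrow> p i \<in> Hom (Cont_Aut \<A> elts B) P (X i)"
    and q: "\<And>i. i < n \<Longrightarrow> q i \<in> Hom (Cont_Aut \<A> elts B) Q (X i)"
    and inj: "\<And>z z'. z \<in> fst P \<Longrightarrow> z' \<in> fst P \<Longrightarrow> (\<And>i. i < n \<Longrightarrow> snd (snd (p i)) z = snd (snd (p i)) z') \<Longrightarrow> z = z'"
    and u: "\<And>x. x \<in> fst Q \<Longrightarrow> u x \<in> fst P"
    and pu: "\<And>i x. i < (n::nat) \<Longrightarrow> x \<in> fst Q \<Longrightarrow> snd (snd (p i)) (u x) = snd (snd (q i)) x"
  shows "\<exists>u'\<in>Hom (Cont_Aut \<A> elts B) Q P. \<forall>x\<in>fst Q. snd (snd u') x = u x"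
proof -
  have equiv: "u (snd Q \<pi> x) = snd P \<pi> (u x)" if \<pi>: "\<pi> \<in> Aut_over \<A> B" and x: "x \<in> fst Q" for \<pi> x
  proof (rule inj)
    note \<pi>x = Cont_closed[OF B Q \<pi> x]
    show "u (snd Q \<pi> x) \<in> fst P" by (rule u[OF \<pi>x])
    show "snd P \<pi> (u x) \<in> fst P" by (rule Cont_closed[OF B P \<pi> u[OF x]])
    fix i assume i: "i < n"
    have "snd (snd (p i)) (snd P \<pi> (u x)) = snd (X i) \<pi> (snd (snd (p i)) (u x))"
      using p[OF i] \<pi> u[OF x] unfolding Cont_Hom_iff by auto
    moreover have "snd (snd (q i)) (snd Q \<pi> x) = snd (X i) \<pi> (snd (snd (q i)) x)"
      using q[OF i] \<pi> x unfolding Cont_Hom_iff by auto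
    ultimately show "snd (snd (p i)) (u (snd Q \<pi> x)) = snd (snd (p i)) (snd P \<pi> (u x))"
      using pu[OF i \<pi>x] pu[OF i x] by simp
  qed
  have "(Q, P, \<lambda>x\<in>fst Q. u x) \<in> Hom (Cont_Aut \<A> elts B) Q P"
    unfolding Cont_Hom_iff
  proof (intro exI conjI ballI refl P Q)
    show "(\<lambda>x\<in>fst Q. u x) \<in> fst Q \<rightarrow>\<^sub>E fst P" using u by simp
    fix \<pi> x assume \<pi>: "\<pi> \<in> Aut_over \<A> B" and x: "x \<in> fst Q"
    show "(\<lambda>x\<in>fst Q. u x) (snd Q \<pi> x) = snd P \<pi> ((\<lambda>x\<in>fst Q. u x) x)"
      using equiv[OF \<pi> x] Cont_closed[OF B Q \<pi> x] x by simp
  qed (rule refl)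
  then show ?thesis by (rule bexI[rotated]) simp
qed

lemma Cont_products:
  assumes B: "B \<subseteq> A" and X: "\<And>i. i < (n::nat) \<Longrightarrow> X i \<in> Obj (Cont_Aut \<A> elts B)"
  shows "\<exists>Q q. Q \<in> Obj (Cont_Aut \<A> elts B) \<and> (\<forall>i<n. q i \<in> Hom (Cont_Aut \<A> elts B) Q (X i)) \<and>
      (\<forall>z\<in>fst Q. \<forall>z'\<in>fst Q. (\<forall>i<n. snd (snd (q i)) z = snd (snd (q i)) z') \<longrightarrow> z = z') \<and>
      (\<forall>y. (\<forall>i<n. y i \<in> fst (X i)) \<longrightarrow> (\<exists>z\<in>fst Q. \<forall>i<n. snd (snd (q i)) z = y i))"
proof -
  define Q where "Q = tuples n (\<lambda>i. fst (X i))"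
  define \<psi> where "\<psi> = (\<lambda>\<pi>\<in>Aut_over \<A> B. \<lambda>z\<in>Q. tup (map (\<lambda>i. snd (X i) \<pi> (untup n z ! i)) [0..<n]))"
  have untup_in: "untup n z ! i \<in> fst (X i)" if "i < n" "z \<in> Q" for i z
    using untup_nth_in that unfolding Q_def by blast
  have \<psi>_in: "\<psi> \<pi> z \<in> Q" if \<pi>: "\<pi> \<in> Aut_over \<A> B" and z: "z \<in> Q" for \<pi> z
  proof -
    have "tup (map (\<lambda>i. snd (X i) \<pi> (untup n z ! i)) [0..<n]) \<in> Q"
      unfolding Q_def by (rule tup_map_in) (rule Cont_closed[OF B X \<pi> untup_in[OF _ z]])
    then show ?thesis using \<pi> z unfolding \<psi>_def by simp
  qed
  have untup_\<psi>: "untup n (\<psi> \<pi> z) ! i = snd (X i) \<pi> (untup n z ! i)"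
    if "\<pi> \<in> Aut_over \<A> B" "z \<in> Q" "i < n" for \<pi> z i
    using that unfolding \<psi>_def by simp
  have Q_eqI: "z = z'" if "z \<in> Q" "z' \<in> Q" "\<And>i. i < n \<Longrightarrow> untup n z ! i = untup n z' ! i" for z z'
    using that(1,2) unfolding Q_def by (rule tuples_eqI) (rule that(3))
  have Obj: "(Q, \<psi>) \<in> Obj (Cont_Aut \<A> elts B)"
  proof (rule Cont_ObjI[OF B])
    show "small Q" unfolding Q_def by (rule small_tuples) (rule Cont_small[OF B X])
    show "\<psi> \<in> extensional (Aut_over \<A> B)" unfolding \<psi>_def by simp
    show "\<psi> \<pi> \<in> extensional Q" if "\<pi> \<in> Aut_over \<A> B" for \<pi> using that unfolding \<psi>_def by simp
    show "\<psi> \<pi> z \<in> Q" if "\<pi> \<in> Aut_over \<A> B" "z \<in> Q" for \<pi> z by (rule \<psi>_in[OF that])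
    show "\<psi> (\<lambda>a\<in>A. a) z = z" if z: "z \<in> Q" for z
      by (rule Q_eqI[OF \<psi>_in[OF id_Aut_over[OF B] z] z])
        (simp only: untup_\<psi>[OF id_Aut_over[OF B] z] Cont_one[OF B X untup_in[OF _ z]])
    show "\<psi> (compose A \<pi> \<rho>) z = \<psi> \<pi> (\<psi> \<rho> z)"
      if \<pi>: "\<pi> \<in> Aut_over \<A> B" and \<rho>: "\<rho> \<in> Aut_over \<A> B" and z: "z \<in> Q" for \<pi> \<rho> z
      by (rule Q_eqI[OF \<psi>_in[OF compose_Aut_over[OF B \<pi> \<rho>] z] \<psi>_in[OF \<pi> \<psi>_in[OF \<rho> z]]])
        (simp only: untup_\<psi>[OF compose_Aut_over[OF B \<pi> \<rho>] z] untup_\<psi>[OF \<pi> \<psi>_in[OF \<rho> z]] untup_\<psi>[OF \<rho> z]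
          Cont_mult[OF B X \<pi> \<rho> untup_in[OF _ z]])
    show "openin (Aut_topology \<A> B) {\<pi> \<in> Aut_over \<A> B. \<psi> \<pi> z = y}" if z: "z \<in> Q" for z y
    proof (cases "y \<in> Q")
      case True
      \<comment> \<open>A tuple is moved to \<open>y\<close> if and only if each coordinate is, so
        the transporter is a finite intersection of open transporters; the whole group is
        intersected to cover the product of no factors.\<close>
      have "{\<pi> \<in> Aut_over \<A> B. \<psi> \<pi> z = y} = Aut_over \<A> B \<inter>
          (\<Inter>i\<in>{..<n}. {\<pi> \<in> Aut_over \<A> B. snd (X i) \<pi> (untup n z ! i) = untup n y ! i})"
      proof (intro equalityI subsetI)
        fix \<pi> assume "\<pi> \<in> {\<pi> \<in> Aut_over \<A> B. \<psi> \<pi> z = y}"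
        then show "\<pi> \<in> Aut_over \<A> B \<inter>
          (\<Inter>i\<in>{..<n}. {\<pi> \<in> Aut_over \<A> B. snd (X i) \<pi> (untup n z ! i) = untup n y ! i})"
          using untup_\<psi>[OF _ z] by auto
      next
        fix \<pi> assume *: "\<pi> \<in> Aut_over \<A> B \<inter>
          (\<Inter>i\<in>{..<n}. {\<pi> \<in> Aut_over \<A> B. snd (X i) \<pi> (untup n z ! i) = untup n y ! i})"
        then have \<pi>: "\<pi> \<in> Aut_over \<A> B" by blast
        have "\<psi> \<pi> z = y"
          by (rule Q_eqI[OF \<psi>_in[OF \<pi> z] True]) (use * untup_\<psi>[OF \<pi> z] in simp)
        then show "\<pi> \<in> {\<pi> \<in> Aut_over \<A> B. \<psi> \<pi> z = y}" using \<pi> by blast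
      qed
      moreover have "openin (Aut_topology \<A> B) (Aut_over \<A> B \<inter>
          (\<Inter>i\<in>{..<n}. {\<pi> \<in> Aut_over \<A> B. snd (X i) \<pi> (untup n z ! i) = untup n y ! i}))"
      proof (cases "n = 0")
        case True
        then show ?thesis using openin_topspace[of "Aut_topology \<A> B"] by simp
      next
        case False
        have "openin (Aut_topology \<A> B) (\<Inter>i\<in>{..<n}. {\<pi> \<in> Aut_over \<A> B. snd (X i) \<pi> (untup n z ! i) = untup n y ! i})"
          by (rule openin_INT2) (use False Cont_open[OF B X untup_in[OF _ z]] in auto)
        then show ?thesis using openin_topspace[of "Aut_topology \<A> B"] by (simp add: openin_Int)
      qed
      ultimately show ?thesis by simp
    next
      case False
      then have "{\<pi> \<in> Aut_over \<A> B. \<psi> \<pi> z = y} = {}" using \<psi>_in[OF _ z] by blast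
      then show ?thesis by (simp only: openin_empty)
    qed
  qed
  define q where "q i = ((Q, \<psi>), X i, \<lambda>z\<in>Q. untup n z ! i)" for i
  have q: "q i \<in> Hom (Cont_Aut \<A> elts B) (Q, \<psi>) (X i)" if i: "i < n" for i
    unfolding Cont_Hom_iff q_def
  proof (intro exI conjI ballI refl Obj X i)
    show "(\<lambda>z\<in>Q. untup n z ! i) \<in> fst (Q, \<psi>) \<rightarrow>\<^sub>E fst (X i)" using untup_in[OF i] by simp
    fix \<pi> z assume "\<pi> \<in> Aut_over \<A> B" "z \<in> fst (Q, \<psi>)"
    then show "(\<lambda>z\<in>Q. untup n z ! i) (snd (Q, \<psi>) \<pi> z) = snd (X i) \<pi> ((\<lambda>z\<in>Q. untup n z ! i) z)"
      using untup_\<psi> \<psi>_in i by simp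
  qed (rule refl)
  show ?thesis
  proof (intro exI[of _ "(Q, \<psi>)"] exI[of _ q] conjI allI impI ballI Obj q)
    fix z z' assume "z \<in> fst (Q, \<psi>)" "z' \<in> fst (Q, \<psi>)"
      and eq: "\<forall>i<n. snd (snd (q i)) z = snd (snd (q i)) z'"
    then have z: "z \<in> Q" "z' \<in> Q" by auto
    show "z = z'"
      by (rule Q_eqI[OF z]) (use eq z in \<open>simp add: q_def\<close>)
  next
    fix y assume y: "\<forall>i<n. y i \<in> fst (X i)"
    have z: "tup (map y [0..<n]) \<in> Q" unfolding Q_def by (rule tup_map_in) (use y in blast)
    show "\<exists>z\<in>fst (Q, \<psi>). \<forall>i<n. snd (snd (q i)) z = y i"
      by (rule bexI[of _ "tup (map y [0..<n])"]) (use z in \<open>auto simp: q_def\<close>)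
  qed
qed

lemma concrete_cat_Cont:
  assumes "lawvere_theory L" and B: "B \<subseteq> A"
  shows "concrete_cat L (Cont_Aut \<A> elts B) fst (\<lambda>F. snd (snd F))"
proof (unfold_locales)
  let ?C = "Cont_Aut \<A> elts B"
  show "lawvere_theory L" by fact
  show "Dom ?C F \<in> Obj ?C \<and> Cod ?C F \<in> Obj ?C" if "F \<in> Arr ?C" for F
    using that by (cases F) (auto simp: Cont_simps(2,3) Cont_Arr_iff)
  show "Ide ?C P \<in> Hom ?C P P" if P: "P \<in> Obj ?C" for P
    unfolding Cont_Hom_iff Cont_simps(4)
    using P Cont_closed[OF B P] by auto
  show "snd (snd (Ide ?C P)) x = x" if "P \<in> Obj ?C" "x \<in> fst P" for P x
    using that(2) by (simp add: Cont_simps(4))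
  show in_Q: "snd (snd F) x \<in> fst Q" if "F \<in> Hom ?C P Q" "x \<in> fst P" for F P Q x
    using that unfolding Cont_Hom_iff by auto
  show "Cmp ?C G F \<in> Hom ?C P R" if F: "F \<in> Hom ?C P Q" and G: "G \<in> Hom ?C Q R" for F G P Q R
  proof -
    obtain f where f: "F = (P, Q, f)" "P \<in> Obj ?C" "f \<in> fst P \<rightarrow>\<^sub>E fst Q"
      "\<forall>\<pi>\<in>Aut_over \<A> B. \<forall>x\<in>fst P. f (snd P \<pi> x) = snd Q \<pi> (f x)"
      using F unfolding Cont_Hom_iff by blast
    obtain g where g: "G = (Q, R, g)" "R \<in> Obj ?C" "g \<in> fst Q \<rightarrow>\<^sub>E fst R"
      "\<forall>\<pi>\<in>Aut_over \<A> B. \<forall>x\<in>fst Q. g (snd Q \<pi> x) = snd R \<pi> (g x)"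
      using G unfolding Cont_Hom_iff by blast
    have "compose (fst P) g f \<in> fst P \<rightarrow>\<^sub>E fst R" using f(3) g(3) by (auto simp: compose_def)
    moreover have "compose (fst P) g f (snd P \<pi> x) = snd R \<pi> (compose (fst P) g f x)"
      if "\<pi> \<in> Aut_over \<A> B" "x \<in> fst P" for \<pi> x
    proof -
      have "f x \<in> fst Q" using f(3) that(2) by auto
      then show ?thesis using that f(4) g(4) Cont_closed[OF B f(2) that] by (simp add: compose_def)
    qed
    ultimately show ?thesis unfolding Cont_Hom_iff f(1) g(1) Cont_simps(5) using f(2) g(2) by blast
  qed
  show "snd (snd (Cmp ?C G F)) x = snd (snd G) (snd (snd F) x)"
    if "F \<in> Hom ?C P Q" "G \<in> Hom ?C Q R" "x \<in> fst P" for F G P Q R x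
    using that unfolding Cont_Hom_iff by (auto simp: Cont_simps(5) compose_def)
  show "F = G" if F: "F \<in> Hom ?C P Q" and G: "G \<in> Hom ?C P Q"
    and eq: "\<And>x. x \<in> fst P \<Longrightarrow> snd (snd F) x = snd (snd G) x" for F G P Q
  proof -
    obtain f where f: "F = (P, Q, f)" "f \<in> fst P \<rightarrow>\<^sub>E fst Q" using F unfolding Cont_Hom_iff by blast
    obtain g where g: "G = (P, Q, g)" "g \<in> fst P \<rightarrow>\<^sub>E fst Q" using G unfolding Cont_Hom_iff by blast
    have "f = g" by (rule PiE_ext[OF f(2) g(2)]) (use eq f(1) g(1) in auto)
    then show ?thesis using f(1) g(1) by simp
  qed
  show "\<exists>u'\<in>Hom ?C Q P. \<forall>x\<in>fst Q. snd (snd u') x = u x"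
    if *: "P \<in> Obj ?C" "Q \<in> Obj ?C"
      "\<And>i. i < n \<Longrightarrow> p i \<in> Hom ?C P (X i)" "\<And>i. i < n \<Longrightarrow> q i \<in> Hom ?C Q (X i)"
      "\<And>z z'. z \<in> fst P \<Longrightarrow> z' \<in> fst P \<Longrightarrow> (\<And>i. i < n \<Longrightarrow> snd (snd (p i)) z = snd (snd (p i)) z') \<Longrightarrow> z = z'"
      "\<And>x. x \<in> fst Q \<Longrightarrow> u x \<in> fst P"
      "\<And>i x. i < n \<Longrightarrow> x \<in> fst Q \<Longrightarrow> snd (snd (p i)) (u x) = snd (snd (q i)) x"
    for P Q and n :: nat and p X q u
    by (rule Cont_lift[of B P Q n p X q u]) (fact B *)+
qed (rule Cont_products[OF B])

section \<open>Categorical models from equivariant set models\<close>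

lemma ZFA_equivariant_simps:
  "Obj (ZFA_equivariant \<A> elts B) = {X \<in> Obj (ZFA \<A> elts). equivariant \<A> elts B X}"
  "Dom (ZFA_equivariant \<A> elts B) = Dom (ZFA \<A> elts)"
  "Cod (ZFA_equivariant \<A> elts B) = Cod (ZFA \<A> elts)"
  "Ide (ZFA_equivariant \<A> elts B) = Ide (ZFA \<A> elts)"
  "Cmp (ZFA_equivariant \<A> elts B) = Cmp (ZFA \<A> elts)"
  "F \<in> Arr (ZFA_equivariant \<A> elts B) \<longleftrightarrow> F \<in> Arr (ZFA \<A> elts) \<and> equivariant \<A> elts B (fst F) \<and>
     equivariant \<A> elts B (fst (snd F)) \<and> equivariant \<A> elts B (snd (snd F))"
  unfolding ZFA_equivariant_def by (auto split: prod.splits)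

context
  fixes B assumes fin: "finite B" and sub: "B \<subseteq> A"
begin

lemma equivariant_iff: "equivariant \<A> elts B x \<longleftrightarrow> symmetric \<A> elts x \<and> supports B x"
  unfolding equivariant_def supports_def using fin sub by blast

lemma ZFA_equivariant_Obj:
  "X \<in> Obj (ZFA_equivariant \<A> elts B) \<longleftrightarrow> X \<in> Obj (ZFA \<A> elts) \<and> supports B X"
  by (auto simp: ZFA_equivariant_simps equivariant_iff ZFA_simps)

lemma ZFA_equivariant_Hom_iff:
  "F \<in> Hom (ZFA_equivariant \<A> elts B) X Y \<longleftrightarrow>
     F \<in> Hom (ZFA \<A> elts) X Y \<and> supports B X \<and> supports B Y \<and> supports B (snd (snd F))"
proof -
  obtain X' Y' f where "F = (X', Y', f)" by (cases F)
  then show ?thesis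
    unfolding Hom_def by (auto simp: ZFA_equivariant_simps equivariant_iff ZFA_simps)
qed

lemma graph_Hom_equivariant:
  assumes X: "X \<in> Obj (ZFA \<A> elts)" "supports B X" and Y: "Y \<in> Obj (ZFA \<A> elts)" "supports B Y"
    and k: "k \<in> elts X \<rightarrow> elts Y" "\<And>\<pi> x. \<pi> \<in> Aut_over \<A> B \<Longrightarrow> x \<in> elts X \<Longrightarrow> k (moved \<pi> x) = moved \<pi> (k x)"
  shows "(X, Y, graph X k) \<in> Hom (ZFA_equivariant \<A> elts B) X Y"
  unfolding ZFA_equivariant_Hom_iff
proof (intro conjI X(2) Y(2))
  show "(X, Y, graph X k) \<in> Hom (ZFA \<A> elts) X Y" by (rule graph_Hom[OF X(1) Y(1) X(2) k])
  have "X \<notin> A" using X(1) by (simp add: ZFA_simps)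
  then have "supports B (graph X k)" by (rule supports_graph[OF X(2) _ k(2)])
  then show "supports B (snd (snd (X, Y, graph X k)))" by simp
qed

lemma ZFA_equivariant_zfn:
  assumes "F \<in> Hom (ZFA_equivariant \<A> elts B) X Y" "\<pi> \<in> Aut_over \<A> B" "x \<in> elts X"
  shows "zfn F (moved \<pi> x) = moved \<pi> (zfn F x)"
proof -
  have F: "F \<in> Hom (ZFA \<A> elts) X Y" "supports B X" "supports B (snd (snd F))"
    using assms(1) unfolding ZFA_equivariant_Hom_iff by auto
  obtain f where f: "F = (X, Y, f)" "X \<notin> A" "is_graph A elts X Y f" using F(1) by (rule ZFA_HomE)
  show ?thesis
    using F(3) unfolding f(1) by (intro zfn_equivariant[OF F(2) f(2,3) _ assms(2,3)]) simp
qed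

lemma as_action_obj_simps:
  "fst (as_action_obj \<A> elts B X) = elts X"
  "\<pi> \<in> Aut_over \<A> B \<Longrightarrow> x \<in> elts X \<Longrightarrow> snd (as_action_obj \<A> elts B X) \<pi> x = moved \<pi> x"
  unfolding as_action_obj_def by simp_all

text \<open>Continuity asks for a finite support of each member of \<open>X\<close>. This is where
  symmetry of the members enters, beyond the support of \<open>X\<close> itself.\<close>

lemma as_action_obj_Obj:
  assumes X: "X \<in> Obj (ZFA \<A> elts)" "supports B X"
  shows "as_action_obj \<A> elts B X \<in> Obj (Cont_Aut \<A> elts B)"
  unfolding as_action_obj_def
proof (rule Cont_ObjI[OF sub])
  have XA: "X \<notin> A" and Xs: "symmetric \<A> elts X" using X(1) by (auto simp: ZFA_simps)
  note closed = supports_elts[OF X(2) XA]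
  show "small (elts X)" by (rule small_elts[OF XA])
  let ?\<phi> = "\<lambda>\<pi>\<in>Aut_over \<A> B. \<lambda>x\<in>elts X. moved \<pi> x"
  show "?\<phi> \<in> extensional (Aut_over \<A> B)" by simp
  show "?\<phi> \<pi> \<in> extensional (elts X)" if "\<pi> \<in> Aut_over \<A> B" for \<pi> using that by simp
  show "?\<phi> \<pi> x \<in> elts X" if "\<pi> \<in> Aut_over \<A> B" "x \<in> elts X" for \<pi> x using closed that by simp
  show "?\<phi> (\<lambda>a\<in>A. a) x = x" if "x \<in> elts X" for x
    using that id_Aut_over[OF sub] moved_id[of "\<lambda>a\<in>A. a" x] by simp
  show "?\<phi> (compose A \<pi> \<rho>) x = ?\<phi> \<pi> (?\<phi> \<rho> x)"
    if "\<pi> \<in> Aut_over \<A> B" "\<rho> \<in> Aut_over \<A> B" "x \<in> elts X" for \<pi> \<rho> x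
    using that compose_Aut_over[OF sub that(1,2)] moved_compose[OF that(2)] closed by simp
  show "openin (Aut_topology \<A> B) {\<pi> \<in> Aut_over \<A> B. ?\<phi> \<pi> x = y}" if x: "x \<in> elts X" for x y
  proof -
    obtain C where "supports C x" using symmetric_supports[OF symmetric_elts[OF Xs x]] .
    moreover have "{\<pi> \<in> Aut_over \<A> B. ?\<phi> \<pi> x = y} = {\<pi> \<in> Aut_over \<A> B. moved \<pi> x = y}" using x by auto
    ultimately show ?thesis using open_transporter[OF _ sub] by simp
  qed
qed

lemma as_action_farr:
  assumes F: "F \<in> Hom (ZFA_equivariant \<A> elts B) X Y"
  shows "farr (as_action \<A> elts B) F = (as_action_obj \<A> elts B X, as_action_obj \<A> elts B Y, \<lambda>x\<in>elts X. zfn F x)"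
proof -
  have "F \<in> Hom (ZFA \<A> elts) X Y" using F unfolding ZFA_equivariant_Hom_iff by auto
  then obtain f where "F = (X, Y, f)" by (rule ZFA_HomE)
  then show ?thesis by (simp add: as_action_def zfn.simps)
qed

lemma as_action_Hom:
  assumes F: "F \<in> Hom (ZFA_equivariant \<A> elts B) X Y"
  shows "farr (as_action \<A> elts B) F \<in>
    Hom (Cont_Aut \<A> elts B) (as_action_obj \<A> elts B X) (as_action_obj \<A> elts B Y)"
proof -
  have F': "F \<in> Hom (ZFA \<A> elts) X Y" "supports B X" "supports B Y"
    using F unfolding ZFA_equivariant_Hom_iff by auto
  obtain f where f: "F = (X, Y, f)" "X \<notin> A" "symmetric \<A> elts X" "Y \<notin> A" "symmetric \<A> elts Y" "is_graph A elts X Y f"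
    using F'(1) by (rule ZFA_HomE)
  have X: "X \<in> Obj (ZFA \<A> elts)" and Y: "Y \<in> Obj (ZFA \<A> elts)" using f by (auto simp: ZFA_simps)
  have in_Y: "zfn F x \<in> elts Y" if "x \<in> elts X" for x unfolding f(1) by (rule zfn_in[OF f(6) that])
  show ?thesis
    unfolding Cont_Hom_iff as_action_farr[OF F]
  proof (intro exI conjI ballI)
    show "as_action_obj \<A> elts B X \<in> Obj (Cont_Aut \<A> elts B)" "as_action_obj \<A> elts B Y \<in> Obj (Cont_Aut \<A> elts B)"
      using as_action_obj_Obj X Y F' by auto
    show "(\<lambda>x\<in>elts X. zfn F x) \<in> fst (as_action_obj \<A> elts B X) \<rightarrow>\<^sub>E fst (as_action_obj \<A> elts B Y)"
      using in_Y by (simp add: as_action_obj_simps)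
    fix \<pi> x assume \<pi>: "\<pi> \<in> Aut_over \<A> B" and "x \<in> fst (as_action_obj \<A> elts B X)"
    then have x: "x \<in> elts X" by (simp add: as_action_obj_simps)
    show "(\<lambda>x\<in>elts X. zfn F x) (snd (as_action_obj \<A> elts B X) \<pi> x) =
        snd (as_action_obj \<A> elts B Y) \<pi> ((\<lambda>x\<in>elts X. zfn F x) x)"
      using supports_elts[OF F'(2) f(2) \<pi> x] in_Y[OF x] x \<pi> ZFA_equivariant_zfn[OF F \<pi> x]
      by (simp add: as_action_obj_simps)
  qed (rule refl)
qed

end

end

locale symmetric_theory = structure_with_atoms \<A> elts V + lawvere_theory_loc L
  for \<A> :: "('v, 'f, 'r) alg_structure" and elts and V :: "'o::wellorder \<Rightarrow> 'v set" and L :: "'l lawvere"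
begin

sublocale Z: concrete_cat L "ZFA \<A> elts" elts zfn
  by (rule concrete_cat_ZFA[OF lawvere])

end

text \<open>The common input of both halves of the theorem: \<open>C\<close> and \<open>I\<close>
  will be the decoded algebra of a given model, and later the free algebra. From them a model in
  \<open>ZFA\<close> and one in \<open>Cont\<close> are built on the same sets.\<close>

locale equivariant_set_model = symmetric_theory \<A> elts V L
  for \<A> :: "('v, 'f, 'r) alg_structure" and elts and V :: "'o::wellorder \<Rightarrow> 'v set" and L :: "'l lawvere" +
  fixes B :: "'v set" and C :: "'v set" and I :: "'l \<Rightarrow> 'v list \<Rightarrow> 'v list"
  assumes fin: "finite B" and sub: "B \<subseteq> univ \<A>" and small_C: "small C"
    and symmetric_C: "\<And>c. c \<in> C \<Longrightarrow> symmetric \<A> elts c"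
    and closed_C: "\<And>\<pi> c. \<pi> \<in> Aut_over \<A> B \<Longrightarrow> c \<in> C \<Longrightarrow> moved \<pi> c \<in> C"
    and model_I: "set_model L C I"
    and equivariant_I: "\<And>\<pi> n m t xs. \<pi> \<in> Aut_over \<A> B \<Longrightarrow> t \<in> Hom L n m \<Longrightarrow> xs \<in> pw C n \<Longrightarrow>
      I t (map (moved \<pi>) xs) = map (moved \<pi>) (I t xs)"
begin

sublocale Q: concrete_cat L "Cont_Aut \<A> elts B" fst "\<lambda>F. snd (snd F)"
  by (rule concrete_cat_Cont[OF lawvere sub])

text \<open>As one-element tuples are coded by their entry, the power at 1 has the member set
  \<open>C\<close> itself and not a copy of it.\<close>

definition power :: "nat \<Rightarrow> 'v" where
  "power n = set_of (tup ` pw C n)"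

lemma power_Obj: "power n \<in> Obj (ZFA \<A> elts)" and power_supports: "supports B (power n)"
    and elts_power: "elts (power n) = tup ` pw C n"
proof -
  have sup: "supports B (set_of C)" by (rule supports_set_of[OF small_C fin sub closed_C])
  have Obj: "set_of C \<in> Obj (ZFA \<A> elts)"
    using symmetric_set_ofI[OF sup small_C symmetric_C] small_C by (simp add: ZFA_simps)
  have eq: "power n = set_of (tuples n (\<lambda>i. elts (set_of C)))"
    unfolding power_def using small_C by (simp add: tuples_pw)
  show "power n \<in> Obj (ZFA \<A> elts)" unfolding eq by (rule tuples_Obj[OF Obj fin sub sup])
  show "supports B (power n)" unfolding eq by (rule tuples_supports[OF Obj fin sub sup])
  show "elts (power n) = tup ` pw C n" unfolding power_def by (simp add: small_tup[OF small_C])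
qed

lemma power_notin: "power n \<notin> univ \<A>"
  using power_Obj by (simp add: ZFA_simps)

lemma elts_power_1: "elts (power 1) = C"
proof -
  have "c \<in> tup ` pw C 1" if "c \<in> C" for c
    by (rule image_eqI[of _ _ "[c]"]) (use that in \<open>auto simp: pw_1\<close>)
  moreover have "tup ` pw C 1 \<subseteq> C" by (auto simp: pw_1)
  ultimately show ?thesis unfolding elts_power by blast
qed

lemma untup_pw: "xs \<in> pw C n \<Longrightarrow> untup n (tup xs) = xs"
  unfolding pw_def by simp

definition alg :: "(nat, 'l, 'v, 'v \<times> 'v \<times> 'v) functor_data" where
  "alg = \<lparr>fobj = power, farr = (\<lambda>t. (power (Dom L t), power (Cod L t),
     graph (power (Dom L t)) (\<lambda>z. tup (I t (untup (Dom L t) z)))))\<rparr>"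

lemma fobj_alg: "fobj alg n = power n"
  unfolding alg_def by simp

lemma farr_alg:
  assumes t: "t \<in> Hom L n m"
  shows "farr alg t \<in> Hom (ZFA_equivariant \<A> elts B) (power n) (power m)"
    and "xs \<in> pw C n \<Longrightarrow> zfn (farr alg t) (tup xs) = tup (I t xs)"
proof -
  have eq: "farr alg t = (power n, power m, graph (power n) (\<lambda>z. tup (I t (untup n z))))"
    using t unfolding alg_def Hom_def by auto
  show "farr alg t \<in> Hom (ZFA_equivariant \<A> elts B) (power n) (power m)"
    unfolding eq
  proof (rule graph_Hom_equivariant[OF fin sub power_Obj power_supports power_Obj power_supports])
    show "(\<lambda>z. tup (I t (untup n z))) \<in> elts (power n) \<rightarrow> elts (power m)"
      unfolding elts_power using set_model_in[OF model_I t] by (auto simp: untup_pw)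
    fix \<pi> z assume \<pi>: "\<pi> \<in> Aut_over \<A> B" and "z \<in> elts (power n)"
    then obtain xs where xs: "xs \<in> pw C n" "z = tup xs" unfolding elts_power by blast
    have "map (moved \<pi>) xs \<in> pw C n" using closed_C[OF \<pi>] by (intro pw_map[OF xs(1)]) blast
    then show "tup (I t (untup n (moved \<pi> z))) = moved \<pi> (tup (I t (untup n z)))"
      unfolding xs(2) moved_tup using untup_pw xs(1) equivariant_I[OF \<pi> t xs(1)] by simp
  qed
  show "zfn (farr alg t) (tup xs) = tup (I t xs)" if "xs \<in> pw C n"
  proof -
    have "tup xs \<in> elts (power n)" unfolding elts_power using that by blast
    then show ?thesis unfolding eq using zfn_graph[OF power_notin] untup_pw[OF that] by simp
  qed
qed

lemma farr_alg_ZFA: "t \<in> Hom L n m \<Longrightarrow> farr alg t \<in> Hom (ZFA \<A> elts) (power n) (power m)"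
  using farr_alg(1) unfolding ZFA_equivariant_Hom_iff[OF fin sub] by blast

lemma elts_power_cases:
  assumes "z \<in> elts (power n)" obtains xs where "xs \<in> pw C n" "z = tup xs"
  using assms unfolding elts_power by blast

lemma functor_alg: "is_functor L (ZFA \<A> elts) alg"
  unfolding is_functor_def fobj_alg
proof (intro conjI ballI allI category Z.category_D power_Obj farr_alg_ZFA)
  fix n
  show "farr alg (Ide L n) = Ide (ZFA \<A> elts) (power n)"
  proof (rule Z.faithful[OF farr_alg_ZFA[OF Ide_Hom] Z.ide_hom[OF power_Obj]])
    fix z assume z: "z \<in> elts (power n)"
    then obtain xs where "xs \<in> pw C n" "z = tup xs" by (rule elts_power_cases)
    then show "zfn (farr alg (Ide L n)) z = zfn (Ide (ZFA \<A> elts) (power n)) z"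
      using farr_alg(2)[OF Ide_Hom] set_model_Ide[OF model_I] Z.fn_ide[OF power_Obj z] by simp
  qed
next
  fix n m k t u assume t: "t \<in> Hom L n m" and u: "u \<in> Hom L m k"
  note ft = farr_alg_ZFA[OF t] and fu = farr_alg_ZFA[OF u]
  show "farr alg (Cmp L u t) = Cmp (ZFA \<A> elts) (farr alg u) (farr alg t)"
  proof (rule Z.faithful[OF farr_alg_ZFA[OF Cmp_Hom[OF t u]] Z.cmp_hom[OF ft fu]])
    fix z assume z: "z \<in> elts (power n)"
    then obtain xs where xs: "xs \<in> pw C n" "z = tup xs" by (rule elts_power_cases)
    show "zfn (farr alg (Cmp L u t)) z = zfn (Cmp (ZFA \<A> elts) (farr alg u) (farr alg t)) z"
      unfolding Z.fn_cmp[OF ft fu z] unfolding xs(2)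
      using farr_alg(2)[OF Cmp_Hom[OF t u] xs(1)] farr_alg(2)[OF t xs(1)]
        farr_alg(2)[OF u set_model_in[OF model_I t xs(1)]] set_model_Cmp[OF model_I t u xs(1)] by simp
  qed
qed

text \<open>\<open>canonical_image\<close> asks for a functor into the equivariant subcategory,
  hence for its category laws. Equations are inherited from \<open>ZFA\<close>; identities and
  composites stay inside because they are graphs of equivariant functions.\<close>

lemma category_ZFA_equivariant: "is_category (ZFA_equivariant \<A> elts B)"
proof -
  have Z: "is_category (ZFA \<A> elts)" by (rule Z.category_D)
  note iff = ZFA_equivariant_Hom_iff[OF fin sub]
  have Arr: "F \<in> Hom (ZFA \<A> elts) (Dom (ZFA \<A> elts) F) (Cod (ZFA \<A> elts) F)"
    "F \<in> Hom (ZFA_equivariant \<A> elts B) (Dom (ZFA \<A> elts) F) (Cod (ZFA \<A> elts) F)"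
    if "F \<in> Arr (ZFA_equivariant \<A> elts B)" for F
    using that unfolding Hom_def by (auto simp: ZFA_equivariant_simps)
  show ?thesis
    unfolding is_category_def ZFA_equivariant_simps(2-5)
  proof (intro conjI ballI allI)
    fix F assume F: "F \<in> Arr (ZFA_equivariant \<A> elts B)"
    show "Dom (ZFA \<A> elts) F \<in> Obj (ZFA_equivariant \<A> elts B)" "Cod (ZFA \<A> elts) F \<in> Obj (ZFA_equivariant \<A> elts B)"
      using Arr[OF F] Z.hom_obj[OF Arr(1)[OF F]] unfolding iff ZFA_equivariant_Obj[OF fin sub] by auto
    show "Cmp (ZFA \<A> elts) F (Ide (ZFA \<A> elts) (Dom (ZFA \<A> elts) F)) = F"
      "Cmp (ZFA \<A> elts) (Ide (ZFA \<A> elts) (Cod (ZFA \<A> elts) F)) F = F"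
      using Z.cmp_ide[OF Arr(1)[OF F]] Z.ide_cmp[OF Arr(1)[OF F]] by auto
  next
    fix X assume "X \<in> Obj (ZFA_equivariant \<A> elts B)"
    then have X: "X \<in> Obj (ZFA \<A> elts)" "supports B X" unfolding ZFA_equivariant_Obj[OF fin sub] by auto
    show "Ide (ZFA \<A> elts) X \<in> Hom (ZFA_equivariant \<A> elts B) X X"
      unfolding Ide_ZFA by (rule graph_Hom_equivariant[OF fin sub X X]) auto
  next
    fix X Y W F G assume F: "F \<in> Hom (ZFA_equivariant \<A> elts B) X Y" and G: "G \<in> Hom (ZFA_equivariant \<A> elts B) Y W"
    have F': "F \<in> Hom (ZFA \<A> elts) X Y" "supports B X" and G': "G \<in> Hom (ZFA \<A> elts) Y W" "supports B W"
      using F G unfolding iff by auto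
    obtain f where f: "F = (X, Y, f)" using F'(1) by (rule ZFA_HomE)
    obtain g where g: "G = (Y, W, g)" using G'(1) by (rule ZFA_HomE)
    have "(X, W, graph X (\<lambda>x. zfn G (zfn F x))) \<in> Hom (ZFA_equivariant \<A> elts B) X W"
    proof (rule graph_Hom_equivariant[OF fin sub Z.hom_obj(1)[OF F'(1)] F'(2) Z.hom_obj(2)[OF G'(1)] G'(2)])
      show "(\<lambda>x. zfn G (zfn F x)) \<in> elts X \<rightarrow> elts W"
        using Z.fn_in[OF G'(1) Z.fn_in[OF F'(1)]] by blast
      fix \<pi> x assume \<pi>: "\<pi> \<in> Aut_over \<A> B" and x: "x \<in> elts X"
      show "zfn G (zfn F (moved \<pi> x)) = moved \<pi> (zfn G (zfn F x))"
        using ZFA_equivariant_zfn[OF fin sub F \<pi> x] ZFA_equivariant_zfn[OF fin sub G \<pi> Z.fn_in[OF F'(1) x]] by simp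
    qed
    moreover have "Cmp (ZFA \<A> elts) G F = (X, W, graph X (\<lambda>x. zfn G (zfn F x)))"
      using Cmp_ZFA[OF F'(1)[unfolded f] G'(1)[unfolded g]] unfolding f g .
    ultimately show "Cmp (ZFA \<A> elts) G F \<in> Hom (ZFA_equivariant \<A> elts B) X W" by simp
  next
    fix X Y W W' F G H assume "F \<in> Hom (ZFA_equivariant \<A> elts B) X Y"
      "G \<in> Hom (ZFA_equivariant \<A> elts B) Y W" "H \<in> Hom (ZFA_equivariant \<A> elts B) W W'"
    then have "F \<in> Hom (ZFA \<A> elts) X Y" "G \<in> Hom (ZFA \<A> elts) Y W" "H \<in> Hom (ZFA \<A> elts) W W'"
      unfolding iff by blast+
    then show "Cmp (ZFA \<A> elts) H (Cmp (ZFA \<A> elts) G F) = Cmp (ZFA \<A> elts) (Cmp (ZFA \<A> elts) H G) F"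
      using Z unfolding is_category_def by blast
  qed
qed

lemma functor_alg_equivariant: "is_functor L (ZFA_equivariant \<A> elts B) alg"
  unfolding is_functor_def fobj_alg ZFA_equivariant_simps(4,5)
proof (intro conjI ballI allI category category_ZFA_equivariant farr_alg(1))
  show "power n \<in> Obj (ZFA_equivariant \<A> elts B)" for n
    unfolding ZFA_equivariant_Obj[OF fin sub] using power_Obj power_supports by blast
  show "farr alg (Ide L n) = Ide (ZFA \<A> elts) (power n)" for n
    using Z.functor_ide[OF functor_alg, of n] unfolding fobj_alg .
  show "farr alg (Cmp L u t) = Cmp (ZFA \<A> elts) (farr alg u) (farr alg t)"
    if "t \<in> Hom L n m" "u \<in> Hom L m k" for n m k t u
    by (rule Z.functor_cmp[OF functor_alg that])
qed

lemma bij_betw_decode: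
  assumes "\<And>xs. xs \<in> pw C n \<Longrightarrow> d (tup xs) = xs"
  shows "bij_betw d (elts (power n)) (pw (elts (power 1)) n)"
  unfolding elts_power_1
  by (rule bij_betw_byWitness[where f' = tup]) (use assms in \<open>auto simp: elts_power\<close>)

lemma I_Prj: "xs \<in> pw C n \<Longrightarrow> i < n \<Longrightarrow> tup (I (Prj L n i) xs) = xs ! i"
  using set_model_Prj[OF model_I] by simp

lemma map_nth_pw: "xs \<in> pw C n \<Longrightarrow> (\<And>i. i < n \<Longrightarrow> g i = xs ! i) \<Longrightarrow> map g [0..<n] = xs"
  unfolding pw_def by (auto intro: nth_equalityI)

lemma dec_alg: "xs \<in> pw C n \<Longrightarrow> Z.dec alg n (tup xs) = xs"
  unfolding Z.dec_def by (rule map_nth_pw) (simp_all add: farr_alg(2)[OF Prj_Hom] I_Prj)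

lemma model_alg: "is_model L (ZFA \<A> elts) alg"
  by (rule Z.modelI[OF functor_alg]) (simp only: fobj_alg, rule bij_betw_decode[OF dec_alg])

text \<open>Decoding undoes the coding by \<open>tup\<close>, so homomorphism questions about
  \<open>alg\<close> can be answered with the original operations \<open>I\<close>.\<close>

lemma interp_alg:
  assumes t: "t \<in> Hom L n m" and xs: "xs \<in> pw C n"
  shows "Z.interp alg t xs = I t xs"
proof -
  have "tup xs \<in> elts (fobj alg n)" unfolding fobj_alg elts_power using xs by blast
  from Z.dec_farr[OF model_alg t this] show ?thesis
    using dec_alg[OF xs] dec_alg[OF set_model_in[OF model_I t xs]] farr_alg(2)[OF t xs] by simp
qed

section \<open>The corresponding model of continuous actions\<close>

definition calg where
  "calg = functor_comp (as_action \<A> elts B) alg"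

lemma canonical_image_alg: "canonical_image L \<A> elts B calg alg"
  unfolding canonical_image_def calg_def using functor_alg_equivariant by blast

lemma fobj_calg: "fobj calg n = as_action_obj \<A> elts B (power n)"
  unfolding calg_def functor_comp_def by (simp add: fobj_alg as_action_def)

lemma fst_fobj_calg: "fst (fobj calg n) = elts (power n)"
  unfolding fobj_calg by (rule as_action_obj_simps[OF fin sub])

lemma farr_calg:
  assumes t: "t \<in> Hom L n m"
  shows "farr calg t \<in> Hom (Cont_Aut \<A> elts B) (fobj calg n) (fobj calg m)"
    and "z \<in> elts (power n) \<Longrightarrow> snd (snd (farr calg t)) z = zfn (farr alg t) z"
  using as_action_Hom[OF fin sub farr_alg(1)[OF t]] as_action_farr[OF fin sub farr_alg(1)[OF t]]
  unfolding fobj_calg by (simp_all add: calg_def functor_comp_def)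

lemma functor_calg: "is_functor L (Cont_Aut \<A> elts B) calg"
  unfolding is_functor_def
proof (intro conjI ballI allI category Q.category_D farr_calg(1))
  show Obj: "fobj calg n \<in> Obj (Cont_Aut \<A> elts B)" for n
    unfolding fobj_calg by (rule as_action_obj_Obj[OF fin sub power_Obj power_supports])
  show "farr calg (Ide L n) = Ide (Cont_Aut \<A> elts B) (fobj calg n)" for n
  proof (rule Q.faithful[OF farr_calg(1)[OF Ide_Hom] Q.ide_hom[OF Obj]])
    fix z assume z: "z \<in> fst (fobj calg n)"
    then have z': "z \<in> elts (power n)" unfolding fst_fobj_calg .
    show "snd (snd (farr calg (Ide L n))) z = snd (snd (Ide (Cont_Aut \<A> elts B) (fobj calg n))) z"
      unfolding Q.fn_ide[OF Obj z] farr_calg(2)[OF Ide_Hom z'] Z.functor_ide[OF functor_alg] fobj_alg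
      by (rule Z.fn_ide[OF power_Obj z'])
  qed
  fix n m k t u assume t: "t \<in> Hom L n m" and u: "u \<in> Hom L m k"
  note ft = farr_calg(1)[OF t] and fu = farr_calg(1)[OF u]
  show "farr calg (Cmp L u t) = Cmp (Cont_Aut \<A> elts B) (farr calg u) (farr calg t)"
  proof (rule Q.faithful[OF farr_calg(1)[OF Cmp_Hom[OF t u]] Q.cmp_hom[OF ft fu]])
    fix z assume z: "z \<in> fst (fobj calg n)"
    then have z': "z \<in> elts (power n)" unfolding fst_fobj_calg .
    have tz: "zfn (farr alg t) z \<in> elts (power m)" by (rule Z.fn_in[OF farr_alg_ZFA[OF t] z'])
    show "snd (snd (farr calg (Cmp L u t))) z = snd (snd (Cmp (Cont_Aut \<A> elts B) (farr calg u) (farr calg t))) z"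
      unfolding Q.fn_cmp[OF ft fu z] farr_calg(2)[OF Cmp_Hom[OF t u] z'] farr_calg(2)[OF t z'] farr_calg(2)[OF u tz]
      by (rule Z.fn_functor_cmp[OF functor_alg t u]) (unfold fobj_alg, rule z')
  qed
qed

lemma dec_calg: "xs \<in> pw C n \<Longrightarrow> Q.dec calg n (tup xs) = xs"
  unfolding Q.dec_def
  by (rule map_nth_pw) (simp_all add: farr_calg(2)[OF Prj_Hom] farr_alg(2)[OF Prj_Hom] I_Prj elts_power)

lemma model_calg: "is_model L (Cont_Aut \<A> elts B) calg"
  by (rule Q.modelI[OF functor_calg]) (simp only: fst_fobj_calg, rule bij_betw_decode[OF dec_calg])

lemma interp_calg:
  assumes t: "t \<in> Hom L n m" and xs: "xs \<in> pw C n"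
  shows "Q.interp calg t xs = I t xs"
proof -
  have z: "tup xs \<in> elts (power n)" unfolding elts_power using xs by blast
  then have "tup xs \<in> fst (fobj calg n)" unfolding fst_fobj_calg .
  from Q.dec_farr[OF model_calg t this] show ?thesis
    using dec_calg[OF xs] dec_calg[OF set_model_in[OF model_I t xs]] farr_alg(2)[OF t xs] farr_calg(2)[OF t z]
    by simp
qed

end

section \<open>Models and free algebras\<close>

context symmetric_theory
begin

text \<open>Equivariance of the decoded operation, which involves the value at 1 alone; the sets at
  the other \<open>n\<close> may have no common finite support.\<close>

definition commutes :: "(nat, 'l, 'v, 'v \<times> 'v \<times> 'v) functor_data \<Rightarrow> 'l \<Rightarrow> 'v set \<Rightarrow> bool" where
  "commutes M t B \<longleftrightarrow> (\<forall>\<pi>\<in>Aut_over \<A> B. \<forall>xs\<in>pw (elts (fobj M 1)) (Dom L t).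
     Z.interp M t (map (moved \<pi>) xs) = map (moved \<pi>) (Z.interp M t xs))"

lemma commutes_mono: "commutes M t B \<Longrightarrow> B \<subseteq> B' \<Longrightarrow> commutes M t B'"
  unfolding commutes_def using Aut_over_mono by blast

lemma arrow_finite_support:
  assumes "F \<in> Hom (ZFA \<A> elts) X Y"
  shows "\<exists>B. finite B \<and> B \<subseteq> A \<and> (\<forall>\<pi>\<in>Aut_over \<A> B. \<forall>x\<in>elts X. zfn F (moved \<pi> x) = moved \<pi> (zfn F x))"
proof -
  obtain B where B: "supports B X" "supports B Y"
    "\<forall>\<pi>\<in>Aut_over \<A> B. \<forall>x\<in>elts X. zfn F (moved \<pi> x) = moved \<pi> (zfn F x)"
    by (rule Hom_equivariant[OF assms])
  then show ?thesis unfolding supports_def by blast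
qed

text \<open>Decoding is itself only finitely supported, so the supports of the projections at
  \<open>n\<close> and \<open>m\<close> join that of the arrow. A support of the value at
  \<open>n\<close> keeps moved elements inside it.\<close>

lemma commutes_ex:
  assumes M: "is_model L (ZFA \<A> elts) M" and t: "t \<in> Hom L n m"
  shows "\<exists>B. finite B \<and> B \<subseteq> A \<and> commutes M t B"
proof -
  note func = Z.model_functor[OF M]
  define P where "P k i B \<longleftrightarrow> (\<forall>\<pi>\<in>Aut_over \<A> B. \<forall>x\<in>elts (fobj M k).
    zfn (farr M (Prj L k i)) (moved \<pi> x) = moved \<pi> (zfn (farr M (Prj L k i)) x))" for k i B
  have P: "\<exists>B. finite B \<and> B \<subseteq> A \<and> (\<forall>i<k. P k i B)" for k
  proof (rule finite_supports)
    show "\<exists>B. finite B \<and> B \<subseteq> A \<and> P k i B" if "i < k" for i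
      unfolding P_def by (rule arrow_finite_support[OF Z.functor_hom[OF func Prj_Hom[OF that]]])
    show "P k i B'" if "P k i B" "B \<subseteq> B'" for i B B'
      using that unfolding P_def using Aut_over_mono by blast
  qed
  obtain Bn where Bn: "finite Bn" "Bn \<subseteq> A" "\<forall>i<n. P n i Bn" using P by blast
  obtain Bm where Bm: "finite Bm" "Bm \<subseteq> A" "\<forall>i<m. P m i Bm" using P by blast
  obtain Bt where Bt: "finite Bt" "Bt \<subseteq> A" "\<forall>\<pi>\<in>Aut_over \<A> Bt. \<forall>x\<in>elts (fobj M n).
      zfn (farr M t) (moved \<pi> x) = moved \<pi> (zfn (farr M t) x)"
    using arrow_finite_support[OF Z.functor_hom[OF func t]] by blast
  have Mn: "fobj M n \<in> Obj (ZFA \<A> elts)" by (rule Z.functor_obj[OF func])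
  then obtain B0 where B0: "supports B0 (fobj M n)" using symmetric_supports by (auto simp: ZFA_simps)
  define B where "B = Bn \<union> Bm \<union> Bt \<union> B0"
  have B: "finite B" "B \<subseteq> A" using Bn Bm Bt B0 unfolding B_def supports_def by auto
  have "commutes M t B"
    unfolding commutes_def
  proof (intro ballI)
    fix \<pi> xs assume \<pi>: "\<pi> \<in> Aut_over \<A> B" and "xs \<in> pw (elts (fobj M 1)) (Dom L t)"
    then have xs: "xs \<in> pw (elts (fobj M 1)) n" using t unfolding Hom_def by simp
    have "\<pi> \<in> Aut_over \<A> Bn" "\<pi> \<in> Aut_over \<A> Bm" "\<pi> \<in> Aut_over \<A> Bt" "\<pi> \<in> Aut_over \<A> B0"
      using \<pi> unfolding B_def Aut_over_def by auto
    note \<pi>' = this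
    show "Z.interp M t (map (moved \<pi>) xs) = map (moved \<pi>) (Z.interp M t xs)"
    proof (rule Z.interp_commute[OF M t, where a = "\<lambda>_. moved \<pi>"])
      show "moved \<pi> x \<in> elts (fobj M n)" if "x \<in> elts (fobj M n)" for x
        using supports_elts[OF B0 _ \<pi>'(4) that] Mn by (simp add: ZFA_simps)
      show "zfn (farr M (Prj L n i)) (moved \<pi> x) = moved \<pi> (zfn (farr M (Prj L n i)) x)"
        if "i < n" "x \<in> elts (fobj M n)" for i x
        using Bn(3) that \<pi>'(1) unfolding P_def by blast
      show "zfn (farr M (Prj L m i)) (moved \<pi> x) = moved \<pi> (zfn (farr M (Prj L m i)) x)"
        if "i < m" "x \<in> elts (fobj M m)" for i x
        using Bm(3) that \<pi>'(2) unfolding P_def by blast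
      show "zfn (farr M t) (moved \<pi> x) = moved \<pi> (zfn (farr M t) x)" if "x \<in> elts (fobj M n)" for x
        using Bt(3) that \<pi>'(3) by blast
    qed (rule xs)
  qed
  then show ?thesis using B by blast
qed

text \<open>Induction over the generation of arrows. The support is chosen for the generators and
  the value at 1, and no closure rule enlarges it, so it serves for all arrows at once.\<close>

lemma model_equivariant:
  assumes ops: "finitely_many_operations L" and M: "is_model L (ZFA \<A> elts) M"
  shows "\<exists>B. equivariant_set_model \<A> elts V L B (elts (fobj M 1)) (Z.interp M)"
proof -
  let ?C = "elts (fobj M 1)" and ?I = "Z.interp M"
  note I = Z.interp_set_model[OF M]
  obtain \<Omega> where \<Omega>: "finite \<Omega>" "\<Omega> \<subseteq> {f \<in> Arr L. Cod L f = 1}" "generated_by L \<Omega> = Arr L"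
    using ops unfolding finitely_many_operations_def by blast
  have "\<forall>t\<in>\<Omega>. \<exists>B. finite B \<and> B \<subseteq> A \<and> commutes M t B"
    using \<Omega>(2) commutes_ex[OF M] unfolding Hom_def by blast
  then obtain \<beta> where \<beta>: "\<And>t. t \<in> \<Omega> \<Longrightarrow> finite (\<beta> t) \<and> \<beta> t \<subseteq> A \<and> commutes M t (\<beta> t)" by metis
  have M1: "fobj M 1 \<in> Obj (ZFA \<A> elts)" by (rule Z.functor_obj[OF Z.model_functor[OF M]])
  then have M1': "fobj M 1 \<notin> A" "symmetric \<A> elts (fobj M 1)" by (auto simp: ZFA_simps)
  obtain B0 where B0: "supports B0 (fobj M 1)" using M1'(2) by (rule symmetric_supports)
  define B where "B = B0 \<union> (\<Union>t\<in>\<Omega>. \<beta> t)"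
  have B: "finite B" "B \<subseteq> A" using \<beta> B0 \<Omega>(1) unfolding B_def supports_def by auto
  have sup: "supports B (fobj M 1)" by (rule supports_mono[OF B0 _ B]) (simp add: B_def)
  have closed: "map (moved \<pi>) xs \<in> pw ?C n" if "\<pi> \<in> Aut_over \<A> B" "xs \<in> pw ?C n" for \<pi> xs n
    using supports_elts[OF sup M1'(1) that(1)] by (intro pw_map[OF that(2)]) blast
  have "commutes M t B" if "t \<in> generated_by L \<Omega>" for t
    using that
  proof induction
    case (basic t)
    show ?case by (rule commutes_mono[of _ _ "\<beta> t"]) (use basic \<beta> in \<open>auto simp: B_def\<close>)
  next
    \<comment> \<open>A decoded projection is a list lookup, which commutes with every
      automorphism.\<close>
    case (projection i n)
    have "Dom L (Prj L n i) = n" using Prj_Hom[OF projection] unfolding Hom_def by simp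
    then show ?case
      unfolding commutes_def using closed set_model_Prj[OF I projection] projection
      by (auto simp: pw_def)
  next
    case (composition f g)
    have f: "f \<in> Hom L (Dom L f) (Cod L f)" and g: "g \<in> Hom L (Cod L f) (Cod L g)"
      using composition \<Omega>(3) unfolding Hom_def by auto
    have "Dom L (Cmp L g f) = Dom L f" using Cmp_Hom[OF f g] unfolding Hom_def by simp
    then show ?case
      unfolding commutes_def
    proof (intro ballI)
      fix \<pi> xs assume \<pi>: "\<pi> \<in> Aut_over \<A> B" and "xs \<in> pw ?C (Dom L (Cmp L g f))" "Dom L (Cmp L g f) = Dom L f"
      then have xs: "xs \<in> pw ?C (Dom L f)" by simp
      have "?I f (map (moved \<pi>) xs) = map (moved \<pi>) (?I f xs)"
        using composition.IH(1) \<pi> xs unfolding commutes_def by blast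
      moreover have "?I g (map (moved \<pi>) (?I f xs)) = map (moved \<pi>) (?I g (?I f xs))"
        using composition.IH(2) \<pi> set_model_in[OF I f xs] composition.hyps(3) unfolding commutes_def by simp
      ultimately show "?I (Cmp L g f) (map (moved \<pi>) xs) = map (moved \<pi>) (?I (Cmp L g f) xs)"
        using set_model_Cmp[OF I f g xs] set_model_Cmp[OF I f g closed[OF \<pi> xs]] by simp
    qed
  next
    case (tuple h)
    define n m where "n = Dom L h" and "m = Cod L h"
    have h: "h \<in> Hom L n m" using tuple.hyps(1) unfolding Hom_def n_def m_def by simp
    show ?case
      unfolding commutes_def n_def[symmetric]
    proof (intro ballI)
      fix \<pi> xs assume \<pi>: "\<pi> \<in> Aut_over \<A> B" and xs: "xs \<in> pw ?C n"
      note \<pi>xs = closed[OF \<pi> xs]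
      have len: "length (?I h xs) = m" "length (?I h (map (moved \<pi>) xs)) = m"
        using set_model_in[OF I h xs] set_model_in[OF I h \<pi>xs] unfolding pw_def by auto
      show "?I h (map (moved \<pi>) xs) = map (moved \<pi>) (?I h xs)"
      proof (rule nth_equalityI)
        fix i assume "i < length (?I h (map (moved \<pi>) xs))"
        then have i: "i < m" using len by simp
        have "Dom L (Cmp L (Prj L m i) h) = n"
          using Cmp_Hom[OF h Prj_Hom[OF i]] unfolding Hom_def by simp
        then have "?I (Cmp L (Prj L m i) h) (map (moved \<pi>) xs) = map (moved \<pi>) (?I (Cmp L (Prj L m i) h) xs)"
          using tuple.IH[of i] i \<pi> xs unfolding commutes_def m_def by simp
        then show "?I h (map (moved \<pi>) xs) ! i = map (moved \<pi>) (?I h xs) ! i"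
          using set_model_component[OF I h xs i] set_model_component[OF I h \<pi>xs i] i len by simp
      qed (use len in simp)
    qed
  qed
  then have comm: "commutes M t B" if "t \<in> Arr L" for t using that \<Omega>(3) by simp
  have "equivariant_set_model \<A> elts V L B ?C ?I"
  proof unfold_locales
    show "finite B" "B \<subseteq> A" by (fact B)+
    show "small ?C" by (rule small_elts[OF M1'(1)])
    show "symmetric \<A> elts c" if "c \<in> ?C" for c by (rule symmetric_elts[OF M1'(2) that])
    show "moved \<pi> c \<in> ?C" if "\<pi> \<in> Aut_over \<A> B" "c \<in> ?C" for \<pi> c by (rule supports_elts[OF sup M1'(1) that])
    show "set_model L ?C ?I" by (rule I)
    show "?I t (map (moved \<pi>) xs) = map (moved \<pi>) (?I t xs)"
      if "\<pi> \<in> Aut_over \<A> B" "t \<in> Hom L n m" "xs \<in> pw ?C n" for \<pi> n m t xs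
      using comm[of t] that unfolding commutes_def Hom_def by auto
  qed
  then show ?thesis ..
qed

lemma models_equivariant:
  assumes "finitely_many_operations L" and M: "is_model L (ZFA \<A> elts) M"
  shows "\<exists>B N F. finite B \<and> B \<subseteq> A \<and> is_model L (Cont_Aut \<A> elts B) N \<and>
    canonical_image L \<A> elts B N F \<and> naturally_isomorphic L (ZFA \<A> elts) F M"
proof -
  obtain B where "equivariant_set_model \<A> elts V L B (elts (fobj M 1)) (Z.interp M)"
    using model_equivariant[OF assms] by blast
  then interpret E: equivariant_set_model \<A> elts V L B "elts (fobj M 1)" "Z.interp M" .
  have M1: "fobj M 1 \<notin> A" using Z.functor_obj[OF Z.model_functor[OF M], of 1] by (simp add: ZFA_simps)
  have "naturally_isomorphic L (ZFA \<A> elts) E.alg M"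
  proof (rule Z.naturally_isomorphicI[OF E.model_alg M])
    \<comment> \<open>An equality of objects, not merely an isomorphism, thanks to the coding of
      one-element tuples.\<close>
    show "fobj E.alg 1 = fobj M 1"
      unfolding E.fobj_alg by (rule extensionality[OF E.power_notin M1 E.elts_power_1])
    show "Z.interp E.alg t xs = Z.interp M t xs" if "t \<in> Hom L n m" "xs \<in> pw (elts (fobj E.alg 1)) n" for n m t xs
      using that E.interp_alg[OF that(1)] unfolding E.fobj_alg E.elts_power_1 by blast
  qed
  then show ?thesis using E.fin E.sub E.model_calg E.canonical_image_alg by blast
qed

end

section \<open>The free algebra coded by symmetric sets\<close>

locale free_equivariant = symmetric_theory \<A> elts V L
  for \<A> :: "('v, 'f, 'r) alg_structure" and elts and V :: "'o::wellorder \<Rightarrow> 'v set" and L :: "'l lawvere" +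
  fixes B :: "'v set" and X :: "'v"
  assumes fin: "finite B" and sub: "B \<subseteq> univ \<A>" and countable: "countable (Arr L)"
    and X_Obj: "X \<in> Obj (ZFA \<A> elts)" and X_supports: "supports B X"
begin

text \<open>The numeral is fixed by automorphisms, so they act on the variables only. It determines
  the arrow by countability, hence the arity, which makes the tuple decodable.\<close>

definition enc_expr :: "'l \<times> 'v list \<Rightarrow> 'v" where
  "enc_expr e = pair (num (to_nat_on (Arr L) (fst e))) (tup (snd e))"

definition exprs :: "('l \<times> 'v list) set" where
  "exprs = {(f, xs). \<exists>n. f \<in> Hom L n 1 \<and> xs \<in> pw (elts X) n}"

definition enc_class :: "('l \<times> 'v list) set \<Rightarrow> 'v" where
  "enc_class S = set_of (enc_expr ` S)"

lemma X_notin: "X \<notin> univ \<A>" and X_symmetric: "symmetric \<A> elts X"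
  using X_Obj by (auto simp: ZFA_simps)

lemma inj_enc_expr: "inj_on enc_expr exprs"
proof (rule inj_onI)
  fix e e' assume e: "e \<in> exprs" and e': "e' \<in> exprs" and eq: "enc_expr e = enc_expr e'"
  have arr: "fst e \<in> Arr L" "fst e' \<in> Arr L" using e e' unfolding exprs_def Hom_def by auto
  have "to_nat_on (Arr L) (fst e) = to_nat_on (Arr L) (fst e')"
    using eq num_inj unfolding enc_expr_def by simp
  then have f: "fst e = fst e'" using to_nat_on_inj[OF countable arr] by simp
  \<comment> \<open>Equal arrows have equal domains, and \<open>tup\<close> is injective on lists of
    equal length.\<close>
  have "length (snd e) = length (snd e')"
    using e e' f unfolding exprs_def Hom_def pw_def by auto
  then have "snd e = snd e'" using eq unfolding enc_expr_def by (auto intro: tup_inj)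
  then show "e = e'" using f by (simp add: prod_eq_iff)
qed

text \<open>Countably many arrows, and for each a small set of variable lists.\<close>

lemma small_exprs: "small (enc_expr ` exprs)"
proof -
  have "small (\<Union>f\<in>Arr L. pair (num (to_nat_on (Arr L) f)) ` tup ` pw (elts X) (Dom L f))"
    by (intro small_UN_countable[OF countable] small_image small_tup small_elts X_notin)
  moreover have "enc_expr ` exprs \<subseteq> (\<Union>f\<in>Arr L. pair (num (to_nat_on (Arr L) f)) ` tup ` pw (elts X) (Dom L f))"
    unfolding enc_expr_def exprs_def Hom_def by auto
  ultimately show ?thesis by (rule small_subset)
qed

lemma small_enc: "S \<subseteq> exprs \<Longrightarrow> small (enc_expr ` S)"
  by (rule small_subset[OF small_exprs]) (rule image_mono)

sublocale free: free_set_model L "elts X" enc_class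
proof unfold_locales
  show "inj_on enc_class (Pow {(f, xs). \<exists>n. f \<in> Hom L n 1 \<and> xs \<in> pw (elts X) n})"
    unfolding exprs_def[symmetric]
  proof (rule inj_onI)
    fix S S' assume S: "S \<in> Pow exprs" "S' \<in> Pow exprs" and "enc_class S = enc_class S'"
    then have "enc_expr ` S = enc_expr ` S'" unfolding enc_class_def using small_enc by simp
    then show "S = S'" using inj_on_image_eq_iff[OF inj_enc_expr] S by blast
  qed
qed

lemma moved_X: "\<pi> \<in> Aut_over \<A> B \<Longrightarrow> moved \<pi> \<in> elts X \<rightarrow> elts X"
  using supports_elts[OF X_supports X_notin] by blast

lemma expr_class_sub: "free.expr_class f xs \<subseteq> exprs"
  unfolding free.expr_class_def exprs_def by auto

text \<open>Members of the class are transported along \<open>\<pi>\<close>, and back along its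
  inverse, by \<open>same_value_transport\<close>; so the image of a class is again a full
  class.\<close>

lemma moved_expr:
  assumes \<pi>: "\<pi> \<in> Aut_over \<A> B" and f: "f \<in> Hom L n 1" and xs: "xs \<in> pw (elts X) n"
  shows "moved \<pi> (free.expr f xs) = free.expr f (map (moved \<pi>) xs)"
proof -
  obtain \<rho> where \<rho>: "\<rho> \<in> Aut_over \<A> B" "\<And>x. moved \<rho> (moved \<pi> x) = x" "\<And>x. moved \<pi> (moved \<rho> x) = x"
    using Aut_over_inverse[OF sub \<pi>] by blast
  have map_inv: "map (moved \<rho>) (map (moved \<pi>) ys) = ys" "map (moved \<pi>) (map (moved \<rho>) ys) = ys" for ys
    using \<rho>(2,3) by (simp_all add: map_idI)
  have moved_enc: "moved \<pi> (enc_expr (g, ys)) = enc_expr (g, map (moved \<pi>) ys)" for g ys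
    unfolding enc_expr_def by (simp add: moved_tup)
  have "moved \<pi> ` enc_expr ` free.expr_class f xs = enc_expr ` free.expr_class f (map (moved \<pi>) xs)"
  proof (intro equalityI subsetI)
    fix z assume "z \<in> moved \<pi> ` enc_expr ` free.expr_class f xs"
    then obtain g ys m where g: "g \<in> Hom L m 1" "ys \<in> pw (elts X) m" "free.same_value f xs g ys"
      "z = moved \<pi> (enc_expr (g, ys))" unfolding free.expr_class_def by auto
    have "(g, map (moved \<pi>) ys) \<in> free.expr_class f (map (moved \<pi>) xs)"
      using g(1) pw_map[OF g(2) moved_X[OF \<pi>]] free.same_value_transport[OF moved_X[OF \<pi>] g(3)]
      unfolding free.expr_class_def by blast
    then show "z \<in> enc_expr ` free.expr_class f (map (moved \<pi>) xs)" unfolding g(4) moved_enc by (rule imageI)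
  next
    fix z assume "z \<in> enc_expr ` free.expr_class f (map (moved \<pi>) xs)"
    then obtain g ys m where g: "g \<in> Hom L m 1" "ys \<in> pw (elts X) m" "free.same_value f (map (moved \<pi>) xs) g ys"
      "z = enc_expr (g, ys)" unfolding free.expr_class_def by auto
    have "free.same_value f xs g (map (moved \<rho>) ys)"
      using free.same_value_transport[OF moved_X[OF \<rho>(1)] g(3)] unfolding map_inv(1) .
    then have "(g, map (moved \<rho>) ys) \<in> free.expr_class f xs"
      using g(1) pw_map[OF g(2) moved_X[OF \<rho>(1)]] unfolding free.expr_class_def by blast
    moreover have "z = moved \<pi> (enc_expr (g, map (moved \<rho>) ys))" unfolding moved_enc map_inv(2) by (rule g(4))
    ultimately show "z \<in> moved \<pi> ` enc_expr ` free.expr_class f xs" by blast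
  qed
  then show ?thesis
    unfolding free.expr_def enc_class_def moved_set_of[OF small_enc[OF expr_class_sub]] by simp
qed

text \<open>The finitely many variables have a common finite support; enlarged by \<open>B\<close>,
  over which \<open>moved_expr\<close> holds, it supports the class. The members of the class are
  codes built from numerals and members of \<open>X\<close>.\<close>

lemma symmetric_expr:
  assumes f: "f \<in> Hom L n 1" and xs: "xs \<in> pw (elts X) n"
  shows "symmetric \<A> elts (free.expr f xs)"
proof -
  have "symmetric \<A> elts (xs ! i)" if "i < n" for i
    by (rule symmetric_elts[OF X_symmetric pw_nth[OF xs that]])
  then have ex: "\<exists>D. finite D \<and> D \<subseteq> univ \<A> \<and> supports D (xs ! i)" if "i < n" for i
    using that symmetric_iff[of "xs ! i"] unfolding supports_def by blast
  have "\<exists>D. finite D \<and> D \<subseteq> univ \<A> \<and> (\<forall>i<n. supports D (xs ! i))"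
    by (rule finite_supports) (erule ex, rule supports_mono)
  then obtain D where D: "finite D" "D \<subseteq> univ \<A>" "\<forall>i<n. supports D (xs ! i)" by blast
  have "supports (B \<union> D) (free.expr f xs)"
    unfolding supports_def
  proof (intro conjI ballI)
    show "finite (B \<union> D)" "B \<union> D \<subseteq> univ \<A>" using fin sub D by auto
    fix \<pi> assume "\<pi> \<in> Aut_over \<A> (B \<union> D)"
    then have \<pi>: "\<pi> \<in> Aut_over \<A> B" "\<pi> \<in> Aut_over \<A> D" unfolding Aut_over_def by auto
    have "map (moved \<pi>) xs = xs"
      using D(3) supportsD[OF _ \<pi>(2)] xs by (intro nth_equalityI) (auto simp: pw_def)
    then show "moved \<pi> (free.expr f xs) = free.expr f xs" using moved_expr[OF \<pi>(1) f xs] by simp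
  qed
  then show ?thesis
    unfolding free.expr_def enc_class_def
  proof (rule symmetric_set_ofI[OF _ small_enc[OF expr_class_sub]])
    fix z assume "z \<in> enc_expr ` free.expr_class f xs"
    then obtain e where e: "e \<in> exprs" "z = enc_expr e" using expr_class_sub by blast
    then have "set (snd e) \<subseteq> elts X" unfolding exprs_def pw_def by auto
    then have "symmetric \<A> elts (tup (snd e))"
      using symmetric_elts[OF X_symmetric] by (intro symmetric_tup) blast
    then show "symmetric \<A> elts z" unfolding e(2) enc_expr_def by (rule symmetric_pair[OF symmetric_num])
  qed
qed

lemma small_T: "small free.T"
proof -
  define g where "g = (\<lambda>e. free.expr (fst e) (snd e)) \<circ> inv_into exprs enc_expr"
  have "free.T \<subseteq> g ` enc_expr ` exprs"
  proof
    fix u assume "u \<in> free.T"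
    then obtain f xs n where *: "f \<in> Hom L n 1" "xs \<in> pw (elts X) n" "u = free.expr f xs" by (rule free.T_cases)
    then have e: "(f, xs) \<in> exprs" unfolding exprs_def by blast
    then have "u = g (enc_expr (f, xs))" unfolding g_def using inv_into_f_f[OF inj_enc_expr e] *(3) by simp
    then show "u \<in> g ` enc_expr ` exprs" using e by blast
  qed
  then show ?thesis by (rule small_subset[OF small_image[OF small_exprs]])
qed

sublocale T: equivariant_set_model \<A> elts V L B free.T free.IT
proof unfold_locales
  show "finite B" "B \<subseteq> univ \<A>" by (fact fin sub)+
  show "small free.T" by (rule small_T)
  show "symmetric \<A> elts u" if "u \<in> free.T" for u
    using that by (rule free.T_cases) (simp only: symmetric_expr)
  show "moved \<pi> u \<in> free.T" if "\<pi> \<in> Aut_over \<A> B" "u \<in> free.T" for \<pi> u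
    by (rule funcset_mem[OF free.transport_in[OF moved_X[OF that(1)] moved_expr[OF that(1)]] that(2)])
  show "set_model L free.T free.IT" by (rule free.set_model_IT)
  show "free.IT t (map (moved \<pi>) us) = map (moved \<pi>) (free.IT t us)"
    if "\<pi> \<in> Aut_over \<A> B" "t \<in> Hom L n m" "us \<in> pw free.T n" for \<pi> n m t us
    by (rule free.IT_transport[OF moved_X[OF that(1)] moved_expr[OF that(1)] that(2,3)])
qed

text \<open>\<open>\<sigma>\<close> stands for the action of \<open>\<pi>\<close> on the target:
  \<open>moved \<pi>\<close> for a model in \<open>ZFA\<close>, the given action for one in
  \<open>Cont\<close>. Both freeness proofs get the equivariance of the extended map from
  here.\<close>

lemma value_of_equivariant:
  assumes I: "set_model L C I" and \<phi>: "\<phi> \<in> elts X \<rightarrow> C" and \<pi>: "\<pi> \<in> Aut_over \<A> B"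
    and \<sigma>: "\<And>x. x \<in> elts X \<Longrightarrow> \<phi> (moved \<pi> x) = \<sigma> (\<phi> x)"
      "\<And>t n xs. t \<in> Hom L n 1 \<Longrightarrow> xs \<in> pw C n \<Longrightarrow> I t (map \<sigma> xs) = map \<sigma> (I t xs)"
    and u: "u \<in> free.T"
  shows "free.value_of I \<phi> (moved \<pi> u) = \<sigma> (free.value_of I \<phi> u)"
proof -
  obtain f xs n where f: "f \<in> Hom L n 1" "xs \<in> pw (elts X) n" "u = free.expr f xs"
    using u by (rule free.T_cases)
  have "[free.value_of I \<phi> (moved \<pi> u)] = I f (map \<phi> (map (moved \<pi>) xs))"
    unfolding f(3) moved_expr[OF \<pi> f(1,2)]
    by (rule free.value_of_expr_single[OF I \<phi> f(1) pw_map[OF f(2) moved_X[OF \<pi>]], symmetric])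
  also have "map \<phi> (map (moved \<pi>) xs) = map \<sigma> (map \<phi> xs)"
    using \<sigma>(1) f(2) unfolding pw_def by auto
  also have "I f \<dots> = map \<sigma> (I f (map \<phi> xs))" by (rule \<sigma>(2)[OF f(1) pw_map[OF f(2) \<phi>]])
  also have "\<dots> = [\<sigma> (free.value_of I \<phi> u)]"
    using free.value_of_expr_single[OF I \<phi> f(1,2)] f(3) by simp
  finally show ?thesis by simp
qed

lemma set_hom_cong:
  assumes "\<And>n m t xs. t \<in> Hom L n m \<Longrightarrow> xs \<in> pw C n \<Longrightarrow> I t xs = J t xs"
  shows "set_hom L C I C' I' k \<longleftrightarrow> set_hom L C J C' I' k"
  unfolding set_hom_def using assms by metis

lemma elts_alg_1: "elts (fobj T.alg 1) = free.T"
  unfolding T.fobj_alg by (rule T.elts_power_1)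

lemma fst_calg_1: "fst (fobj T.calg 1) = free.T"
  unfolding T.fst_fobj_calg by (rule T.elts_power_1)

lemma set_hom_alg: "set_hom L free.T (Z.interp T.alg) C I k \<longleftrightarrow> set_hom L free.T free.IT C I k"
  by (rule set_hom_cong) (rule T.interp_alg)

lemma set_hom_calg: "set_hom L free.T (T.Q.interp T.calg) C I k \<longleftrightarrow> set_hom L free.T free.IT C I k"
  by (rule set_hom_cong) (rule T.interp_calg)

text \<open>The unit is an arrow of the equivariant subcategory, so its image under
  \<open>as_action\<close> can be the unit in \<open>Cont\<close>.\<close>

definition unit :: "'v \<times> 'v \<times> 'v" where
  "unit = (X, T.power 1, graph X free.eta)"

lemma unit_Hom: "unit \<in> Hom (ZFA_equivariant \<A> elts B) X (T.power 1)"
  unfolding unit_def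
proof (rule graph_Hom_equivariant[OF fin sub X_Obj X_supports T.power_Obj T.power_supports])
  show "free.eta \<in> elts X \<rightarrow> elts (T.power 1)" unfolding T.elts_power_1 by (rule free.eta_in)
  show "free.eta (moved \<pi> x) = moved \<pi> (free.eta x)" if "\<pi> \<in> Aut_over \<A> B" "x \<in> elts X" for \<pi> x
    using free.eta_transport[OF moved_X[OF that(1)] moved_expr[OF that(1)] that(2)] by simp
qed

lemma unit_Hom_ZFA: "unit \<in> Hom (ZFA \<A> elts) X (T.power 1)"
  using unit_Hom unfolding ZFA_equivariant_Hom_iff[OF fin sub] by blast

lemma zfn_unit: "x \<in> elts X \<Longrightarrow> zfn unit x = free.eta x"
  unfolding unit_def by (rule zfn_graph[OF X_notin])

text \<open>Three finite sets meet: \<open>B\<close> for the free algebra, \<open>B1\<close> for the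
  given map and \<open>B2\<close> for the operations of the target, the last uniform in all arrows
  by \<open>model_equivariant\<close>. Evaluation is equivariant over their union, hence an
  arrow.\<close>

lemma is_free_alg:
  assumes ops: "finitely_many_operations L"
  shows "is_free_algebra L (ZFA \<A> elts) X T.alg unit"
proof (rule Z.free_algebraI[OF X_Obj T.model_alg], unfold elts_alg_1 set_hom_alg)
  show "unit \<in> Hom (ZFA \<A> elts) X (fobj T.alg 1)" unfolding T.fobj_alg by (rule unit_Hom_ZFA)
next
  fix M k k' assume k: "set_hom L free.T free.IT (elts (fobj M 1)) (Z.interp M) k"
    and k': "set_hom L free.T free.IT (elts (fobj M 1)) (Z.interp M) k'"
    and eq: "\<And>x. x \<in> elts X \<Longrightarrow> k (zfn unit x) = k' (zfn unit x)"
  show "\<forall>y\<in>free.T. k y = k' y"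
    by (rule free.set_hom_unique[OF k k']) (use eq zfn_unit in simp)
next
  fix M f assume M: "is_model L (ZFA \<A> elts) M" and f: "f \<in> Hom (ZFA \<A> elts) X (fobj M 1)"
  let ?C = "elts (fobj M 1)" and ?I = "Z.interp M" and ?\<phi> = "zfn f"
  note I = Z.interp_set_model[OF M]
  have \<phi>: "?\<phi> \<in> elts X \<rightarrow> ?C" using Z.fn_in[OF f] by blast
  obtain B1 where B1: "finite B1" "B1 \<subseteq> univ \<A>"
    "\<forall>\<pi>\<in>Aut_over \<A> B1. \<forall>x\<in>elts X. ?\<phi> (moved \<pi> x) = moved \<pi> (?\<phi> x)"
    using arrow_finite_support[OF f] by blast
  obtain B2 where "equivariant_set_model \<A> elts V L B2 ?C ?I" using model_equivariant[OF ops M] by blast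
  then interpret M: equivariant_set_model \<A> elts V L B2 ?C ?I .
  define D where "D = B \<union> B1 \<union> B2"
  have D: "finite D" "D \<subseteq> univ \<A>" using fin sub B1 M.fin M.sub unfolding D_def by auto
  have sup: "supports D (T.power 1)" by (rule supports_mono[OF T.power_supports _ D]) (auto simp: D_def)
  define k where "k = (T.power 1, fobj M 1, graph (T.power 1) (free.value_of ?I ?\<phi>))"
  have "k \<in> Hom (ZFA \<A> elts) (T.power 1) (fobj M 1)"
    unfolding k_def
  proof (rule graph_Hom[OF T.power_Obj Z.functor_obj[OF Z.model_functor[OF M]] sup], unfold T.elts_power_1)
    show "free.value_of ?I ?\<phi> \<in> free.T \<rightarrow> ?C" by (rule free.value_of_in[OF I \<phi>])
    fix \<pi> u assume "\<pi> \<in> Aut_over \<A> D" and u: "u \<in> free.T"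
    then have \<pi>: "\<pi> \<in> Aut_over \<A> B" "\<pi> \<in> Aut_over \<A> B1" "\<pi> \<in> Aut_over \<A> B2"
      unfolding D_def Aut_over_def by auto
    show "free.value_of ?I ?\<phi> (moved \<pi> u) = moved \<pi> (free.value_of ?I ?\<phi> u)"
      by (rule value_of_equivariant[OF I \<phi> \<pi>(1) _ M.equivariant_I[OF \<pi>(3)] u]) (use B1(3) \<pi>(2) in blast)
  qed
  moreover have k: "zfn k u = free.value_of ?I ?\<phi> u" if "u \<in> free.T" for u
    unfolding k_def using that by (intro zfn_graph[OF T.power_notin]) (simp only: T.elts_power_1)
  moreover have "set_hom L free.T free.IT ?C ?I (zfn k)"
    by (rule set_hom_eq_on[OF free.set_model_IT free.set_hom_value_of[OF I \<phi>] k])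
  moreover have "zfn k (zfn unit x) = zfn f x" if "x \<in> elts X" for x
    using k[OF funcset_mem[OF free.eta_in that]] free.value_of_eta[OF I \<phi> that] zfn_unit[OF that] by simp
  ultimately show "\<exists>k\<in>Hom (ZFA \<A> elts) (fobj T.alg 1) (fobj M 1).
      set_hom L free.T free.IT ?C ?I (zfn k) \<and> (\<forall>x\<in>elts X. zfn k (zfn unit x) = zfn f x)"
    unfolding T.fobj_alg by blast
qed

text \<open>Here the given map and the operations of the target are equivariant over all of
  \<open>Aut_over \<A> B\<close>, and so is evaluation.\<close>

lemma is_free_calg:
  "is_free_algebra L (Cont_Aut \<A> elts B) (fobj (as_action \<A> elts B) X) T.calg (farr (as_action \<A> elts B) unit)"
proof -
  let ?X = "as_action_obj \<A> elts B X" and ?\<eta> = "farr (as_action \<A> elts B) unit"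
  have obj: "fobj (as_action \<A> elts B) X = ?X" by (simp add: as_action_def)
  have fst_X: "fst ?X = elts X" by (rule as_action_obj_simps[OF fin sub])
  have \<eta>_fn: "snd (snd ?\<eta>) x = free.eta x" if "x \<in> elts X" for x
    using as_action_farr[OF fin sub unit_Hom] zfn_unit[OF that] that by simp
  show ?thesis
    unfolding obj
  proof (rule T.Q.free_algebraI[OF as_action_obj_Obj[OF fin sub X_Obj X_supports] T.model_calg],
      unfold fst_calg_1 set_hom_calg fst_X)
    show "?\<eta> \<in> Hom (Cont_Aut \<A> elts B) ?X (fobj T.calg 1)"
      unfolding T.fobj_calg by (rule as_action_Hom[OF fin sub unit_Hom])
  next
    fix M k k' assume k: "set_hom L free.T free.IT (fst (fobj M 1)) (T.Q.interp M) k"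
      and k': "set_hom L free.T free.IT (fst (fobj M 1)) (T.Q.interp M) k'"
      and eq: "\<And>x. x \<in> elts X \<Longrightarrow> k (snd (snd ?\<eta>) x) = k' (snd (snd ?\<eta>) x)"
    show "\<forall>y\<in>free.T. k y = k' y"
      by (rule free.set_hom_unique[OF k k']) (use eq \<eta>_fn in simp)
  next
    fix M f assume M: "is_model L (Cont_Aut \<A> elts B) M" and f: "f \<in> Hom (Cont_Aut \<A> elts B) ?X (fobj M 1)"
    let ?C = "fst (fobj M 1)" and ?I = "T.Q.interp M" and ?\<phi> = "snd (snd f)"
    note I = T.Q.interp_set_model[OF M] and func = T.Q.model_functor[OF M]
    have \<phi>: "?\<phi> \<in> elts X \<rightarrow> ?C" using T.Q.fn_in[OF f] unfolding fst_X by blast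
    have \<phi>_equiv: "?\<phi> (moved \<pi> x) = snd (fobj M 1) \<pi> (?\<phi> x)" if "\<pi> \<in> Aut_over \<A> B" "x \<in> elts X" for \<pi> x
    proof -
      have "?\<phi> (snd ?X \<pi> x) = snd (fobj M 1) \<pi> (?\<phi> x)"
        using f that fst_X unfolding Cont_Hom_iff by auto
      then show ?thesis using as_action_obj_simps(2)[OF fin sub that] by simp
    qed
    \<comment> \<open>Arrows of \<open>Cont\<close> intertwine the actions on the values at
      different \<open>n\<close>, and decoding moves this to the action on the value at 1.\<close>
    have I_equiv: "?I t (map (snd (fobj M 1) \<pi>) xs) = map (snd (fobj M 1) \<pi>) (?I t xs)"
      if \<pi>: "\<pi> \<in> Aut_over \<A> B" and t: "t \<in> Hom L n m" and xs: "xs \<in> pw ?C n" for \<pi> t n m xs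
    proof (rule T.Q.interp_commute[OF M t, where a = "\<lambda>n. snd (fobj M n) \<pi>"])
      have arr: "snd (snd (farr M s)) (snd (fobj M i) \<pi> x) = snd (fobj M j) \<pi> (snd (snd (farr M s)) x)"
        if "s \<in> Hom L i j" "x \<in> fst (fobj M i)" for s i j x
        using T.Q.functor_hom[OF func that(1)] that(2) \<pi> unfolding Cont_Hom_iff by auto
      show "snd (fobj M n) \<pi> x \<in> fst (fobj M n)" if "x \<in> fst (fobj M n)" for x
        by (rule Cont_closed[OF sub T.Q.functor_obj[OF func] \<pi> that])
      show "snd (snd (farr M (Prj L n i))) (snd (fobj M n) \<pi> x) = snd (fobj M 1) \<pi> (snd (snd (farr M (Prj L n i))) x)"
        if "i < n" "x \<in> fst (fobj M n)" for i x by (rule arr[OF Prj_Hom[OF that(1)] that(2)])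
      show "snd (snd (farr M (Prj L m i))) (snd (fobj M m) \<pi> x) = snd (fobj M 1) \<pi> (snd (snd (farr M (Prj L m i))) x)"
        if "i < m" "x \<in> fst (fobj M m)" for i x by (rule arr[OF Prj_Hom[OF that(1)] that(2)])
      show "snd (snd (farr M t)) (snd (fobj M n) \<pi> x) = snd (fobj M m) \<pi> (snd (snd (farr M t)) x)"
        if "x \<in> fst (fobj M n)" for x by (rule arr[OF t that])
    qed (rule xs)
    define k where "k = (fobj T.calg 1, fobj M 1, \<lambda>u\<in>free.T. free.value_of ?I ?\<phi> u)"
    have k: "snd (snd k) u = free.value_of ?I ?\<phi> u" if "u \<in> free.T" for u using that unfolding k_def by simp
    have hom: "set_hom L free.T free.IT ?C ?I (free.value_of ?I ?\<phi>)" by (rule free.set_hom_value_of[OF I \<phi>])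
    have "k \<in> Hom (Cont_Aut \<A> elts B) (fobj T.calg 1) (fobj M 1)"
      unfolding Cont_Hom_iff k_def
    proof (intro exI conjI ballI, unfold fst_calg_1)
      show "fobj T.calg 1 \<in> Obj (Cont_Aut \<A> elts B)" by (rule T.Q.functor_obj[OF T.functor_calg])
      show "fobj M 1 \<in> Obj (Cont_Aut \<A> elts B)" by (rule T.Q.functor_obj[OF func])
      show "(\<lambda>u\<in>free.T. free.value_of ?I ?\<phi> u) \<in> free.T \<rightarrow>\<^sub>E ?C" using set_hom_in[OF hom] by simp
      fix \<pi> u assume \<pi>: "\<pi> \<in> Aut_over \<A> B" and u: "u \<in> free.T"
      have "snd (fobj T.calg 1) \<pi> u = moved \<pi> u"
        unfolding T.fobj_calg by (rule as_action_obj_simps(2)[OF fin sub \<pi>]) (unfold T.elts_power_1, rule u)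
      moreover have "free.value_of ?I ?\<phi> (moved \<pi> u) = snd (fobj M 1) \<pi> (free.value_of ?I ?\<phi> u)"
        by (rule value_of_equivariant[OF I \<phi> \<pi> \<phi>_equiv[OF \<pi>] I_equiv[OF \<pi>] u])
      ultimately show "(\<lambda>u\<in>free.T. free.value_of ?I ?\<phi> u) (snd (fobj T.calg 1) \<pi> u) =
          snd (fobj M 1) \<pi> ((\<lambda>u\<in>free.T. free.value_of ?I ?\<phi> u) u)"
        using T.closed_C[OF \<pi> u] u by simp
    qed (rule refl)
    moreover have "set_hom L free.T free.IT ?C ?I (snd (snd k))"
      by (rule set_hom_eq_on[OF free.set_model_IT hom k])
    moreover have "snd (snd k) (snd (snd ?\<eta>) x) = ?\<phi> x" if "x \<in> elts X" for x
      using k[OF funcset_mem[OF free.eta_in that]] free.value_of_eta[OF I \<phi> that] \<eta>_fn[OF that] by simp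
    ultimately show "\<exists>k\<in>Hom (Cont_Aut \<A> elts B) (fobj T.calg 1) (fobj M 1).
        set_hom L free.T free.IT ?C ?I (snd (snd k)) \<and>
        (\<forall>x\<in>elts X. snd (snd k) (snd (snd ?\<eta>) x) = snd (snd f) x)" by blast
  qed
qed

end

theorem mainTheorem2:
  fixes \<A> :: "('v, 'f, 'r) alg_structure"
    and elts :: "'v \<Rightarrow> 'v set"
    and V :: "'o::wellorder \<Rightarrow> 'v set"
    and L :: "'l lawvere"
  assumes "cumulative_hierarchy (univ \<A>) elts V"
    and "is_structure \<A>"
    and "lawvere_theory L"
    and "finitely_many_operations L"
  shows "(\<forall>M. is_model L (ZFA \<A> elts) M \<longrightarrow>
            (\<exists>A0 N F. finite A0 \<and> A0 \<subseteq> univ \<A> \<and>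
               is_model L (Cont_Aut \<A> elts A0) N \<and>
               canonical_image L \<A> elts A0 N F \<and>
               naturally_isomorphic L (ZFA \<A> elts) F M))
       \<and> (\<forall>A0 X. finite A0 \<and> A0 \<subseteq> univ \<A> \<and> X \<in> Obj (ZFA_equivariant \<A> elts A0) \<longrightarrow>
            (\<exists>N F \<eta>. is_free_algebra L (ZFA \<A> elts) X F \<eta> \<and>
               canonical_image L \<A> elts A0 N F \<and>
               \<eta> \<in> Arr (ZFA_equivariant \<A> elts A0) \<and>
               is_free_algebra L (Cont_Aut \<A> elts A0)
                 (fobj (as_action \<A> elts A0) X) N (farr (as_action \<A> elts A0) \<eta>)))"
proof -
  interpret symmetric_theory \<A> elts V L
    using assms by (intro symmetric_theory.intro structure_with_atoms.intro structure_with_atoms_axioms.intro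
        lawvere_theory_loc.intro)
  show ?thesis
  proof (intro conjI allI impI)
    fix M assume "is_model L (ZFA \<A> elts) M"
    then show "\<exists>A0 N F. finite A0 \<and> A0 \<subseteq> univ \<A> \<and> is_model L (Cont_Aut \<A> elts A0) N \<and>
        canonical_image L \<A> elts A0 N F \<and> naturally_isomorphic L (ZFA \<A> elts) F M"
      by (rule models_equivariant[OF assms(4)])
  next
    fix A0 X assume *: "finite A0 \<and> A0 \<subseteq> univ \<A> \<and> X \<in> Obj (ZFA_equivariant \<A> elts A0)"
    then have fin: "finite A0" and sub: "A0 \<subseteq> univ \<A>" by auto
    have X: "X \<in> Obj (ZFA \<A> elts)" "supports A0 X"
      using * unfolding ZFA_equivariant_Obj[OF fin sub] by auto
    interpret E: free_equivariant \<A> elts V L A0 X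
      by unfold_locales (fact fin sub X countable_Arr[OF assms(4)])+
    have "E.unit \<in> Arr (ZFA_equivariant \<A> elts A0)" using E.unit_Hom unfolding Hom_def by blast
    then show "\<exists>N F \<eta>. is_free_algebra L (ZFA \<A> elts) X F \<eta> \<and> canonical_image L \<A> elts A0 N F \<and>
        \<eta> \<in> Arr (ZFA_equivariant \<A> elts A0) \<and>
        is_free_algebra L (Cont_Aut \<A> elts A0) (fobj (as_action \<A> elts A0) X) N (farr (as_action \<A> elts A0) \<eta>)"
      using E.is_free_alg[OF assms(4)] E.is_free_calg E.T.canonical_image_alg by blast
  qed
qed

end
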